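(* Let $d\in\{2,3,\dots\}$ and $\omega\in(0,1)$. Put $\mathbf{F}_+:=\mathbb{H}^{2-\omega}_{\Sigma 0}(\mathbb{T}^d)$, $\mathbf{F}:=\mathbb{H}^1_{\Sigma 0}(\mathbb{T}^d)$, $\mathbf{F}_-:=\mathbb{H}^{-\omega}_{\Sigma 0}(\mathbb{T}^d)$, and $\mathcal{A}:=\Delta\restriction\mathbf{F}_+:\mathbf{F}_+\to\mathbf{F}_-$. Then: (i) $\mathcal{A}$ (viewed as a densely defined operator in $\mathbf{F}_-$) generates a strongly continuous semigroup on $\mathbb{H}^{-\omega}_{\Sigma 0}$; this is the restriction to $[0,+\infty)\times\mathbb{H}^{-\omega}_{\Sigma 0}$ of the map $(t,v)\mapsto e^{t\Delta}v$. (ii) The map $(t,v)\mapsto e^{t\Delta}v$ gives as well a strongly continuous semigroup on $\mathbb{H}^1_{\Sigma 0}$, and $$\|e^{t\Delta}v\|_1\le e^{-t}\|v\|_1\qquad\forall t\in[0,+\infty),\ v\in\mathbb{H}^1_{\Sigma 0}.$$ (iii) The map $(t,v)\mapsto e^{t\Delta}v$ sends continuously $(0,+\infty)\times\mathbb{H}^{-\omega}_{\Sigma 0}$ into $\mathbb{H}^1_{\Sigma 0}$, and $$\|e^{t\Delta}v\|_1\le\mu_\omega(t)\,e^{-t}\,\|v\|_{-\omega}\qquad\forall t\in(0,+\infty),\ v\in\mathbb{H}^{-\omega}_{\Sigma 0},$$ where $$\mu_\omega(t):=\Big(\frac{1+\omega}{2et}\Big)^{\frac{1+\omega}{2}}e^t\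 \text{ for }0<t\le\frac{1+\omega}{2},\qquad \mu_\omega(t):=1\ \text{ for }t>\frac{1+\omega}{2}$$ (note that $\mu_\omega(t)=O(1/t^{(1+\omega)/2})$ for $t\to0^+$). Moreover $$\sup_{t\in[0,+\infty)}\int_0^tds\,e^{-s}\mu_\omega(t-s)<+\infty .$$ (iv) Let $N\in(0,+\infty)$ be any majorant of $\sup_{t\in[0,+\infty)}\int_0^tds\,e^{-s}\mu_\omega(t-s)$, $B:=1$ and $\mu:=\mu_\omega$. Then all the following conditions hold: (a) $\mathcal{A}:\mathbf{F}_+\to\mathbf{F}_-$ is linear, and the norm of $\mathbf{F}_+$ is equivalent to the graph norm $v\mapsto\|v\|_{-\omega}+\|\mathcal{A}v\|_{-\omega}$; (b) $\mathcal{A}$, viewed as a densely defined operator in $\mathbf{F}_-$, generates a strongly continuous semigroup $(e^{t\mathcal{A}})_{t\ge0}$ on $\mathbf{F}_-$; (c) $e^{t\mathcal{A}}(\mathbf{F})\subset\mathbf{F}$ for $t\in[0,+\infty)$, the map $(v,t)\mapsto e^{t\mathcal{A}}v$ is continuous from $\mathbf{F}\times[0,+\infty)$ to $\mathbf{F}$ (giving a strongly continuous semigroup on $\mathbf{F}$), and $\|e^{t\mathcal{A}}v\|_1\le e^{-Bt}\|v\|_1$ for all $t\ge 0$, $v\in\mathbf{F}$; (d) $e^{t\mathcal{A}}(\mathbf{F}_-)\subset\mathbf{F}$ for $t\in(0,+\infty)$, the map $(v,t)\mapsto e^{t\mathcal{A}}v$ is continuous from $\mathbf{F}_-\times(0,+\infty)$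 to $\mathbf{F}$, $\mu\in C((0,+\infty),(0,+\infty))$, $\|e^{t\mathcal{A}}v\|_1\le\mu(t)e^{-Bt}\|v\|_{-\omega}$ for $t>0$, $v\in\mathbf{F}_-$, $\mu(t)=O(1/t^\varepsilon)$ for $t\to0^+$ with some $\varepsilon\in[0,1)$, and $\int_0^tds\,e^{-Bs}\mu(t-s)\le N$ for all $t\in[0,+\infty)$.
   Context: $\mathbb{T}^d:=(\mathbb{R}/2\pi\mathbb{Z})^d$, $\mathbb{Z}^d_0:=\mathbb{Z}^d\setminus\{0\}$, and $e_k(x):=(2\pi)^{-d/2}e^{ik\cdot x}$ for $k\in\mathbb{Z}^d$. A vector field is a $d$-tuple $v=(v^1,\dots,v^d)$ of real (periodic) distributions on $\mathbb{T}^d$; its Fourier coefficients are $v_k=(\langle v^r,e_{-k}\rangle)_{r=1,\dots,d}\in\mathbb{C}^d$, so that $v=\sum_{k\in\mathbb{Z}^d}v_ke_k$ and $\overline{v_k}=v_{-k}$. For $c\in\mathbb{C}^d$, $|c|$ is the standard Hermitian norm, and $a\cdot b=\sum_r a^rb^r$. For $n\in\mathbb{R}$, $\mathbb{H}^n_0(\mathbb{T}^d)$ is the space of vector fields $v$ with zero mean ($v_0=0$) and $\sum_{k\in\mathbb{Z}^d_0}|k|^{2n}|v_k|^2<+\infty$, with the Hilbert norm $\|v\|_n:=\big(\sum_{k\in\mathbb{Z}^d_0}|k|^{2n}|v_k|^2\big)^{1/2}$. $\mathbb{H}^n_{\Sigma 0}(\mathbb{T}^d)$ is its closed subspace of divergence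 free elements ($k\cdot v_k=0$ for all $k$), with the same norm. $\Delta v=-\sum_{k}|k|^2v_ke_k$ and $e^{t\Delta}v:=\sum_{k\in\mathbb{Z}^d}e^{-t|k|^2}v_ke_k$ for $t\ge0$. *)

theory Defs
  imports "HOL-Analysis.Analysis" "HOL-Library.Landau_Symbols"
begin

section \<open>Test functions and real distributions on the torus\<close>

text \<open>
  Functions on the torus are functions on \<open>real^'d\<close> that are \<open>2\<pi>\<close>-periodic in each
  coordinate; the dimension is \<open>d = CARD('d)\<close>.
\<close>

definition partial_deriv :: "'d \<Rightarrow> (real^'d::finite \<Rightarrow> complex) \<Rightarrow> real^'d \<Rightarrow> complex" where
  "partial_deriv i f x = frechet_derivative f (at x) (axis i 1)"

definition partial_derivs :: "'d list \<Rightarrow> (real^'d::finite \<Rightarrow> complex) \<Rightarrow> real^'d \<Rightarrow> complex" where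
  "partial_derivs is f = foldr partial_deriv is f"

definition torus_test :: "(real^'d::finite \<Rightarrow> complex) set" where
  "torus_test = {f. (\<forall>is x. partial_derivs is f differentiable (at x)) \<and>
                    (\<forall>i x. f (x + axis i (2 * pi)) = f x)}"

text \<open>
  A distribution is a linear functional on the test functions that is continuous for the
  seminorms \<open>sup |\<partial>\<^sub>i\<^sub>s f|\<close>: for some \<open>C\<close> and \<open>m\<close>, its value at \<open>f\<close> is at most \<open>C\<close> times any
  common bound \<open>M\<close> of the derivatives of \<open>f\<close> of order \<open>\<le> m\<close>.  It is real if it commutes with
  complex conjugation.  The functional is set to 0 outside the test functions, so that equality
  of functionals is equality of distributions.
\<close>

definition is_real_distribution :: "((real^'d::finite \<Rightarrow> complex) \<Rightarrow> complex) \<Rightarrow> bool" where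
  "is_real_distribution T \<longleftrightarrow>
     (\<forall>f\<in>torus_test. \<forall>g\<in>torus_test. T (\<lambda>x. f x + g x) = T f + T g) \<and>
     (\<forall>f\<in>torus_test. \<forall>c. T (\<lambda>x. c * f x) = c * T f) \<and>
     (\<exists>C m. \<forall>f\<in>torus_test. \<forall>M.
        (\<forall>is x. length is \<le> m \<longrightarrow> cmod (partial_derivs is f x) \<le> M) \<longrightarrow> cmod (T f) \<le> C * M) \<and>
     (\<forall>f\<in>torus_test. T (\<lambda>x. cnj (f x)) = cnj (T f)) \<and>
     (\<forall>f. f \<notin> torus_test \<longrightarrow> T f = 0)"

lemma is_real_distribution_zero: "is_real_distribution (\<lambda>f. 0)"
  unfolding is_real_distribution_def
  by (auto intro!: exI[of _ "0::real"])

lemma is_real_distribution_add: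
  assumes "is_real_distribution S" "is_real_distribution T"
  shows "is_real_distribution (\<lambda>f. S f + T f)"
proof -
  obtain C m where S: "\<And>f M. f \<in> torus_test \<Longrightarrow>
      (\<forall>is x. length is \<le> m \<longrightarrow> cmod (partial_derivs is f x) \<le> M) \<Longrightarrow> cmod (S f) \<le> C * M"
    using assms(1) unfolding is_real_distribution_def by blast
  obtain D n where T: "\<And>f M. f \<in> torus_test \<Longrightarrow>
      (\<forall>is x. length is \<le> n \<longrightarrow> cmod (partial_derivs is f x) \<le> M) \<Longrightarrow> cmod (T f) \<le> D * M"
    using assms(2) unfolding is_real_distribution_def by blast
  have "\<exists>C m. \<forall>f\<in>torus_test. \<forall>M.
        (\<forall>is x. length is \<le> m \<longrightarrow> cmod (partial_derivs is f x) \<le> M) \<longrightarrow>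
        cmod (S f + T f) \<le> C * M"
  proof (intro exI ballI allI impI)
    fix f :: "real^'a \<Rightarrow> complex" and M
    assume f: "f \<in> torus_test"
      and M: "\<forall>is x. length is \<le> max m n \<longrightarrow> cmod (partial_derivs is f x) \<le> M"
    have "cmod (S f) \<le> C * M" "cmod (T f) \<le> D * M"
      using S[OF f] T[OF f] M by auto
    then show "cmod (S f + T f) \<le> (C + D) * M"
      using norm_triangle_ineq[of "S f" "T f"] by (simp add: distrib_right)
  qed
  then show ?thesis
    using assms unfolding is_real_distribution_def
    by (simp add: algebra_simps)
qed

lemma is_real_distribution_scale:
  assumes "is_real_distribution T"
  shows "is_real_distribution (\<lambda>f. a *\<^sub>R T f)"
proof -
  obtain C m where T: "\<And>f M. f \<in> torus_test \<Longrightarrow>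
      (\<forall>is x. length is \<le> m \<longrightarrow> cmod (partial_derivs is f x) \<le> M) \<Longrightarrow> cmod (T f) \<le> C * M"
    using assms unfolding is_real_distribution_def by blast
  have "\<exists>C m. \<forall>f\<in>torus_test. \<forall>M.
        (\<forall>is x. length is \<le> m \<longrightarrow> cmod (partial_derivs is f x) \<le> M) \<longrightarrow>
        cmod (a *\<^sub>R T f) \<le> C * M"
  proof (intro exI ballI allI impI)
    fix f :: "real^'a \<Rightarrow> complex" and M
    assume f: "f \<in> torus_test"
      and M: "\<forall>is x. length is \<le> m \<longrightarrow> cmod (partial_derivs is f x) \<le> M"
    have "cmod (T f) \<le> C * M" using T[OF f] M by auto
    then have "\<bar>a\<bar> * cmod (T f) \<le> \<bar>a\<bar> * (C * M)" by (rule mult_left_mono) simp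
    then show "cmod (a *\<^sub>R T f) \<le> (\<bar>a\<bar> * C) * M" by (simp add: mult.assoc)
  qed
  then show ?thesis
    using assms unfolding is_real_distribution_def
    by (simp add: scaleR_add_right)
qed

typedef ('d::finite) distr =
    "{T :: (real^'d \<Rightarrow> complex) \<Rightarrow> complex. is_real_distribution T}"
  morphisms pairing Abs_distr
  using is_real_distribution_zero by blast

setup_lifting type_definition_distr

instantiation distr :: (finite) real_vector
begin

lift_definition zero_distr :: "'a distr" is "\<lambda>f. 0"
  by (rule is_real_distribution_zero)

lift_definition plus_distr :: "'a distr \<Rightarrow> 'a distr \<Rightarrow> 'a distr" is "\<lambda>S T f. S f + T f"
  by (rule is_real_distribution_add)

lift_definition scaleR_distr :: "real \<Rightarrow> 'a distr \<Rightarrow> 'a distr" is "\<lambda>a T f. a *\<^sub>R T f"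
  by (rule is_real_distribution_scale)

lift_definition uminus_distr :: "'a distr \<Rightarrow> 'a distr" is "\<lambda>T f. - T f"
  using is_real_distribution_scale[where a = "-1"] by simp

lift_definition minus_distr :: "'a distr \<Rightarrow> 'a distr \<Rightarrow> 'a distr" is "\<lambda>S T f. S f - T f"
  using is_real_distribution_add[OF _ is_real_distribution_scale[where a = "-1"]] by simp

instance
  by (standard; transfer; simp add: fun_eq_iff algebra_simps)

end


section \<open>Vector fields and Fourier series\<close>

type_synonym 'd vfield = "'d distr ^ 'd"

definition rvec :: "int^'d \<Rightarrow> real^'d::finite" where
  "rvec k = (\<chi> r. of_int (k $ r))"

definition fmode :: "int^'d \<Rightarrow> real^'d::finite \<Rightarrow> complex" where
  "fmode k x = of_real ((2 * pi) powr (- real CARD('d) / 2)) * cis (rvec k \<bullet> x)"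

lemma has_derivative_fmode:
  fixes k :: "int^'d::finite"
  shows "((\<lambda>x. c * fmode k x) has_derivative (\<lambda>h. (c * of_real (rvec k \<bullet> h) * \<i>) * fmode k x)) (at x)"
proof -
  have "((\<lambda>y. \<i> * of_real (rvec k \<bullet> y)) has_derivative (\<lambda>h. \<i> * of_real (rvec k \<bullet> h))) (at x)"
    by (auto intro!: derivative_eq_intros)
  moreover have "(exp has_derivative (\<lambda>h. exp (\<i> * of_real (rvec k \<bullet> x)) * h))
      (at (\<i> * complex_of_real (rvec k \<bullet> x)))"
    using DERIV_exp unfolding has_field_derivative_def by blast
  ultimately have "((\<lambda>y. exp (\<i> * of_real (rvec k \<bullet> y))) has_derivative
      (\<lambda>h. exp (\<i> * of_real (rvec k \<bullet> x)) * (\<i> * of_real (rvec k \<bullet> h)))) (at x)"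
    by (rule has_derivative_compose)
  then have "((\<lambda>y. (c * of_real ((2 * pi) powr (- real CARD('d) / 2))) *
        exp (\<i> * of_real (rvec k \<bullet> y))) has_derivative
      (\<lambda>h. (c * of_real ((2 * pi) powr (- real CARD('d) / 2))) *
        (exp (\<i> * of_real (rvec k \<bullet> x)) * (\<i> * of_real (rvec k \<bullet> h))))) (at x)"
    by (rule has_derivative_mult_right)
  then show ?thesis
    by (simp add: fmode_def cis_conv_exp ac_simps)
qed

lemma partial_derivs_fmode:
  fixes k :: "int^'d::finite"
  shows "\<exists>c. partial_derivs is (fmode k) = (\<lambda>x. c * fmode k x)"
proof (induction "is")
  case Nil
  show ?case by (rule exI[of _ 1]) (simp add: partial_derivs_def)
next
  case (Cons i "is")
  then obtain c where c: "partial_derivs is (fmode k) = (\<lambda>x. c * fmode k x)" by blast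
  have "partial_deriv i (\<lambda>x. c * fmode k x) = (\<lambda>x. (c * of_real (rvec k \<bullet> axis i 1) * \<i>) * fmode k x)"
    unfolding partial_deriv_def frechet_derivative_at[OF has_derivative_fmode, symmetric] by simp
  then show ?case
    using c by (auto simp: partial_derivs_def)
qed

lemma fmode_in_torus_test: "fmode k \<in> torus_test"
proof -
  have "(\<lambda>x. c * fmode k x) differentiable (at x)" for c x
    using has_derivative_fmode differentiable_def by blast
  moreover have "fmode k (x + axis i (2 * pi)) = fmode k x" for i x
    using cis_multiple_2pi[of "of_int (k $ i)"]
    by (simp add: fmode_def rvec_def inner_add_right inner_axis cis_mult[symmetric] mult.commute)
  ultimately show ?thesis
    unfolding torus_test_def using partial_derivs_fmode[of _ k] by (auto, metis)
qed

definition fcoeff :: "('d::finite) vfield \<Rightarrow> int^'d \<Rightarrow> complex^'d" where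
  "fcoeff v k = (\<chi> r. pairing (v $ r) (fmode (- k)))"

text \<open>
  The vector field \<open>\<Sum>\<^sub>k c\<^sub>k e\<^sub>k\<close>, the series converging in the weak sense of distributions;
  \<open>e\<^sub>k\<close> acts on a test function \<open>f\<close> as \<open>\<integral> e\<^sub>k f\<close> over a period cell.
\<close>

definition fseries :: "(int^'d \<Rightarrow> complex^'d) \<Rightarrow> ('d::finite) vfield" where
  "fseries c = (THE v. \<forall>r. \<forall>f\<in>torus_test.
     ((\<lambda>k. c k $ r * integral (cbox 0 (\<chi> i. 2 * pi)) (\<lambda>x. fmode k x * f x))
        has_sum pairing (v $ r) f) UNIV)"

definition laplacian :: "('d::finite) vfield \<Rightarrow> 'd vfield" where
  "laplacian v = fseries (\<lambda>k. - ((norm (rvec k))\<^sup>2 *\<^sub>R fcoeff v k))"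

definition heat :: "real \<Rightarrow> ('d::finite) vfield \<Rightarrow> 'd vfield" where
  "heat t v = fseries (\<lambda>k. exp (- t * (norm (rvec k))\<^sup>2) *\<^sub>R fcoeff v k)"


section \<open>Sobolev spaces of zero mean, divergence free vector fields\<close>

definition Sob0 :: "real \<Rightarrow> ('d::finite) vfield set" where
  "Sob0 n = {v. fcoeff v 0 = 0 \<and>
     (\<lambda>k. norm (rvec k) powr (2 * n) * (norm (fcoeff v k))\<^sup>2) summable_on {k. k \<noteq> 0}}"

definition Sob_norm :: "real \<Rightarrow> ('d::finite) vfield \<Rightarrow> real" where
  "Sob_norm n v =
     sqrt (\<Sum>\<^sub>\<infinity>k\<in>{k. k \<noteq> 0}. norm (rvec k) powr (2 * n) * (norm (fcoeff v k))\<^sup>2)"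

definition SobS0 :: "real \<Rightarrow> ('d::finite) vfield set" where
  "SobS0 n = {v \<in> Sob0 n. \<forall>k. (\<Sum>r\<in>UNIV. of_int (k $ r) * fcoeff v k $ r) = 0}"


section \<open>Strongly continuous semigroups on a Banach space given by carrier and norm\<close>

text \<open>
  The norm is passed as a function \<open>N\<close> on the ambient vector space, of which only the values on
  the carrier \<open>X\<close> matter.  The distance is cut off to 0 outside \<open>X\<close> because the locale
  \<open>Metric_space\<close> demands a symmetric and nonnegative distance on the whole type.
\<close>

abbreviation norm_topology :: "'v set \<Rightarrow> ('v::real_vector \<Rightarrow> real) \<Rightarrow> 'v topology" where
  "norm_topology X N \<equiv> Metric_space.mtopology X (\<lambda>v w. if v \<in> X \<and> w \<in> X then N (v - w) else 0)"

definition banach_on :: "'v set \<Rightarrow> ('v::real_vector \<Rightarrow> real) \<Rightarrow> bool" where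
  "banach_on X N \<longleftrightarrow>
     subspace X \<and>
     (\<forall>v\<in>X. N v \<ge> 0 \<and> (N v = 0 \<longrightarrow> v = 0)) \<and>
     (\<forall>v\<in>X. \<forall>a. N (a *\<^sub>R v) = \<bar>a\<bar> * N v) \<and>
     (\<forall>v\<in>X. \<forall>w\<in>X. N (v + w) \<le> N v + N w) \<and>
     Metric_space.mcomplete X (\<lambda>v w. if v \<in> X \<and> w \<in> X then N (v - w) else 0)"

definition linear_map_on ::
    "'v set \<Rightarrow> 'w set \<Rightarrow> ('v::real_vector \<Rightarrow> 'w::real_vector) \<Rightarrow> bool" where
  "linear_map_on X Y f \<longleftrightarrow>
     subspace X \<and> subspace Y \<and> f \<in> X \<rightarrow> Y \<and>
     (\<forall>v\<in>X. \<forall>w\<in>X. f (v + w) = f v + f w) \<and>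
     (\<forall>v\<in>X. \<forall>a. f (a *\<^sub>R v) = a *\<^sub>R f v)"

definition C0_semigroup ::
    "'v set \<Rightarrow> ('v::real_vector \<Rightarrow> real) \<Rightarrow> (real \<Rightarrow> 'v \<Rightarrow> 'v) \<Rightarrow> bool" where
  "C0_semigroup X N T \<longleftrightarrow>
     banach_on X N \<and>
     (\<forall>t\<ge>0. linear_map_on X X (T t) \<and> (\<exists>C. \<forall>v\<in>X. N (T t v) \<le> C * N v)) \<and>
     (\<forall>v\<in>X. T 0 v = v) \<and>
     (\<forall>s\<ge>0. \<forall>t\<ge>0. \<forall>v\<in>X. T (s + t) v = T s (T t v)) \<and>
     (\<forall>v\<in>X. continuous_map (top_of_set {0..}) (norm_topology X N) (\<lambda>t. T t v))"

definition densely_defined ::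
    "'v set \<Rightarrow> ('v::real_vector \<Rightarrow> real) \<Rightarrow> 'v set \<Rightarrow> ('v \<Rightarrow> 'v) \<Rightarrow> bool" where
  "densely_defined X N D A \<longleftrightarrow>
     D \<subseteq> X \<and> linear_map_on D X A \<and> norm_topology X N closure_of D = X"

text \<open>
  The operator \<open>A\<close> with domain \<open>D\<close> generates \<open>T\<close>: the domain consists of exactly those \<open>v\<close> for
  which \<open>(T h v - v)/h\<close> has a limit in \<open>X\<close> as \<open>h \<rightarrow> 0+\<close>, and this limit is \<open>A v\<close>.
\<close>

definition generates ::
    "'v set \<Rightarrow> ('v::real_vector \<Rightarrow> real) \<Rightarrow> 'v set \<Rightarrow> ('v \<Rightarrow> 'v) \<Rightarrow> (real \<Rightarrow> 'v \<Rightarrow> 'v) \<Rightarrow> bool" where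
  "generates X N D A T \<longleftrightarrow>
     C0_semigroup X N T \<and> D \<subseteq> X \<and> A \<in> D \<rightarrow> X \<and>
     (\<forall>v\<in>X. \<forall>w\<in>X. (v \<in> D \<and> A v = w) \<longleftrightarrow>
        ((\<lambda>h. N ((1 / h) *\<^sub>R (T h v - v) - w)) \<longlongrightarrow> 0) (at_right 0))"


definition mu_heat :: "real \<Rightarrow> real \<Rightarrow> real" where
  "mu_heat \<omega> t =
     (if t \<le> (1 + \<omega>) / 2 then ((1 + \<omega>) / (2 * exp 1 * t)) powr ((1 + \<omega>) / 2) * exp t else 1)"

end

theory Submission
  imports Defs
begin

text \<open>
  On the Fourier side the theorem is elementary: \<open>e\<^sup>t\<^sup>\<Delta>\<close> multiplies the
  coefficient \<open>v\<^sub>k\<close> by \<open>exp (- t * |k|\<^sup>2)\<close>, the Laplacian multiplies it by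
  \<open>- |k|\<^sup>2\<close>, and the Sobolev norms are weighted \<open>\<ell>\<^sup>2\<close> norms of the
  coefficients.  The work is to justify the passage to coefficients for distributions.

  A vector field is determined by its coefficients (\<open>fcoeff_inject\<close>), and every real family of
  coefficients of polynomial growth belongs to a vector field (\<open>fcoeff_fseries\<close>).  The
  second fact holds because the coefficients of a smooth periodic function decrease rapidly, by
  integration by parts over the period cell.  The first needs in addition that the Fourier series of
  such a function converges to it together with all derivatives
  (\<open>distribution_fourier_expansion\<close>); the sum is the right one (\<open>fourier_inversion\<close>)
  because by the Stone--Weierstrass theorem on the torus no continuous periodic function except 0
  has only zero coefficients.  With this the
  multipliers \<open>heat t\<close> and \<open>laplacian\<close> act on coefficients as they should, and the spaces
  are complete (\<open>mcomplete_SobS0\<close>).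

  A multiplier maps one Sobolev space to another with norm at most the supremum over \<open>|k| \<ge> 1\<close>
  of its symbol times the quotient of the weights.  This gives the contraction rate \<open>exp (- t)\<close>,
  attained at \<open>|k| = 1\<close>, and, by maximizing \<open>x powr (1 + \<omega>) * exp (- t * x\<^sup>2)\<close>
  over \<open>x \<ge> 1\<close>, exactly the rate \<open>mu_heat \<omega> t * exp (- t)\<close> (\<open>symbol_le_mu_heat\<close>).
  All limits in time are dominated convergence of series over the frequencies
  (\<open>Sob_norm_tendsto_zero\<close>): strong continuity, and convergence of the difference quotients,
  which identifies the generator (\<open>heat_generator_iff\<close>).  The exponent \<open>(1 + \<omega>) / 2\<close>
  of the singularity of \<open>mu_heat\<close> is less than 1, so that the convolution integrals are bounded.

  A semigroup with generator \<open>laplacian\<close> is the heat semigroup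
  (\<open>generated_semigroup_eq_heat\<close>), since along its orbits each coefficient solves
  \<open>c' = - |k|\<^sup>2 c\<close>.  Hence what is proved for \<open>heat\<close> holds for every
  semigroup that the operator generates.
\<close>

section \<open>Periodic test functions\<close>

lemma partial_derivs_Nil [simp]: "partial_derivs [] f = f"
  by (simp add: partial_derivs_def)

lemma partial_derivs_Cons [simp]: "partial_derivs (i # is) f = partial_deriv i (partial_derivs is f)"
  by (simp add: partial_derivs_def)

lemma partial_derivs_append: "partial_derivs (is @ js) f = partial_derivs is (partial_derivs js f)"
  by (simp add: partial_derivs_def)

lemma partial_deriv_eqI: "(f has_derivative D) (at x) \<Longrightarrow> partial_deriv i f x = D (axis i 1)"
  by (simp add: partial_deriv_def flip: frechet_derivative_at)

lemma torus_test_differentiable: "f \<in> torus_test \<Longrightarrow> partial_derivs is f differentiable (at x)"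
  by (simp add: torus_test_def)

lemma torus_test_has_derivative:
  "f \<in> torus_test \<Longrightarrow>
    (partial_derivs is f has_derivative frechet_derivative (partial_derivs is f) (at x)) (at x)"
  using torus_test_differentiable frechet_derivative_works by blast

lemma torus_test_derivs_continuous_on:
  "f \<in> torus_test \<Longrightarrow> continuous_on S (partial_derivs is f)"
  by (meson continuous_at_imp_continuous_on differentiable_imp_continuous_within
      torus_test_differentiable)

lemma torus_test_continuous_on: "f \<in> torus_test \<Longrightarrow> continuous_on S f"
  using torus_test_derivs_continuous_on[of f S "[]"] by simp

lemma torus_test_periodic: "f \<in> torus_test \<Longrightarrow> f (x + axis i (2 * pi)) = f x"
  by (simp add: torus_test_def)

lemma partial_deriv_periodic:
  assumes "\<And>x. f (x + p) = f x" and "f differentiable (at (x + p))"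
  shows "partial_deriv i f (x + p) = partial_deriv i f x"
proof -
  obtain D where D: "(f has_derivative D) (at (x + p))"
    using assms(2) by (auto simp: differentiable_def)
  have "((\<lambda>y. y + p) has_derivative (\<lambda>h. h)) (at x)"
    by (auto intro!: derivative_eq_intros)
  from has_derivative_compose[OF this D] have "(f has_derivative D) (at x)"
    by (simp add: assms(1))
  then show ?thesis using D by (simp add: partial_deriv_eqI)
qed

lemma torus_test_partial_derivs:
  assumes "f \<in> torus_test"
  shows "partial_derivs is f \<in> torus_test"
proof -
  have "\<forall>i x. partial_derivs is f (x + axis i (2 * pi)) = partial_derivs is f x"
  proof (induction "is")
    case Nil
    then show ?case using assms by (simp add: torus_test_periodic)
  next
    case (Cons j "is")
    then show ?case
      using partial_deriv_periodic[of "partial_derivs is f" "axis _ (2 * pi)" _ j]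
        torus_test_differentiable[OF assms] by simp
  qed
  then show ?thesis
    using assms unfolding torus_test_def by (simp flip: partial_derivs_append)
qed

lemma torus_test_partial_deriv: "f \<in> torus_test \<Longrightarrow> partial_deriv i f \<in> torus_test"
  using torus_test_partial_derivs[of f "[i]"] by simp

lemma partial_derivs_bounded_linear:
  assumes "f \<in> torus_test" and L: "bounded_linear L"
  shows "partial_derivs is (\<lambda>x. L (f x)) = (\<lambda>x. L (partial_derivs is f x))"
proof (induction "is")
  case (Cons j "is")
  have "partial_deriv j (\<lambda>x. L (partial_derivs is f x)) x = L (partial_deriv j (partial_derivs is f) x)" for x
    using partial_deriv_eqI[OF bounded_linear.has_derivative[OF L torus_test_has_derivative[OF assms(1)]]]
    by (simp add: partial_deriv_def)
  then show ?case by (simp add: Cons fun_eq_iff)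
qed simp

lemma torus_test_bounded_linear:
  assumes "f \<in> torus_test" and "bounded_linear L"
  shows "(\<lambda>x. L (f x)) \<in> torus_test"
proof -
  have "(\<lambda>x. L (partial_derivs is f x)) differentiable (at x)" for "is" x
    using bounded_linear.has_derivative[OF assms(2) torus_test_has_derivative[OF assms(1)]]
    by (auto simp: differentiable_def)
  then show ?thesis
    using assms(1) unfolding torus_test_def
    by (simp add: partial_derivs_bounded_linear[OF assms])
qed

lemma partial_derivs_add:
  assumes "f \<in> torus_test" "g \<in> torus_test"
  shows "partial_derivs is (\<lambda>x. f x + g x) = (\<lambda>x. partial_derivs is f x + partial_derivs is g x)"
proof (induction "is")
  case (Cons j "is")
  have "partial_deriv j (\<lambda>x. partial_derivs is f x + partial_derivs is g x) x =
    partial_deriv j (partial_derivs is f) x + partial_deriv j (partial_derivs is g) x" for x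
    using partial_deriv_eqI[OF has_derivative_add[OF torus_test_has_derivative[OF assms(1)]
        torus_test_has_derivative[OF assms(2)]]]
    by (simp add: partial_deriv_def)
  then show ?case by (simp add: Cons fun_eq_iff)
qed simp

lemma torus_test_add:
  assumes "f \<in> torus_test" "g \<in> torus_test"
  shows "(\<lambda>x. f x + g x) \<in> torus_test"
proof -
  have "(\<lambda>x. partial_derivs is f x + partial_derivs is g x) differentiable (at x)" for "is" x
    using assms by (intro differentiable_add torus_test_differentiable)
  then show ?thesis
    using assms unfolding torus_test_def
    by (simp add: partial_derivs_add[OF assms])
qed

lemmas torus_test_cmult = torus_test_bounded_linear[OF _ bounded_linear_mult_right]
lemmas partial_derivs_cmult = partial_derivs_bounded_linear[OF _ bounded_linear_mult_right]
lemmas torus_test_cnj = torus_test_bounded_linear[OF _ bounded_linear_cnj]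

lemma torus_test_zero: "(\<lambda>x. 0) \<in> torus_test"
  using torus_test_cmult[OF fmode_in_torus_test, of 0 0] by simp

lemma torus_test_sum:
  assumes "\<And>k. k \<in> K \<Longrightarrow> f k \<in> torus_test"
  shows "(\<lambda>x. \<Sum>k\<in>K. f k x) \<in> torus_test"
  using assms
  by (induction K rule: infinite_finite_induct) (auto simp: torus_test_zero torus_test_add)

lemma partial_derivs_zero: "partial_derivs is (\<lambda>x. 0) = (\<lambda>x. 0)"
  using partial_derivs_cmult[OF fmode_in_torus_test, of "is" 0] by simp

lemma partial_derivs_sum:
  assumes "\<And>k. k \<in> K \<Longrightarrow> f k \<in> torus_test"
  shows "partial_derivs is (\<lambda>x. \<Sum>k\<in>K. f k x) = (\<lambda>x. \<Sum>k\<in>K. partial_derivs is (f k) x)"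
  using assms
  by (induction K rule: infinite_finite_induct)
    (auto simp: partial_derivs_zero partial_derivs_add torus_test_sum)

lemma has_vector_derivative_along_axis:
  fixes f :: "real^'d::finite \<Rightarrow> complex"
  assumes "f differentiable (at (x + axis i s))"
  shows "((\<lambda>s. f (x + axis i s)) has_vector_derivative partial_deriv i f (x + axis i s)) (at s within U)"
proof -
  have 1: "((\<lambda>s. x + axis i s) has_derivative (\<lambda>h. axis i h)) (at s within U)"
  proof -
    have "((\<lambda>s. x + s *\<^sub>R axis i 1) has_derivative (\<lambda>h. h *\<^sub>R axis i 1)) (at s within U)"
      by (auto intro!: derivative_eq_intros)
    moreover have "s *\<^sub>R axis i 1 = (axis i s :: real^'d)" for s by (simp add: vec_eq_iff axis_def)
    ultimately show ?thesis by simp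
  qed
  have 2: "(f has_derivative frechet_derivative f (at (x + axis i s))) (at (x + axis i s))"
    using assms frechet_derivative_works by blast
  have "frechet_derivative f (at (x + axis i s)) (axis i h) = h *\<^sub>R partial_deriv i f (x + axis i s)" for h
  proof -
    have "axis i h = h *\<^sub>R (axis i 1 :: real^'d)" by (simp add: vec_eq_iff axis_def)
    then show ?thesis
      using linear_scale[OF has_derivative_linear[OF 2]] by (simp add: partial_deriv_def)
  qed
  then show ?thesis
    using has_derivative_compose[OF 1 2] by (simp add: has_vector_derivative_def)
qed

section \<open>Integration over a period cell\<close>

abbreviation period_cell :: "(real^'d::finite) set" where
  "period_cell \<equiv> cbox 0 (\<chi> i. 2 * pi)"

text \<open>
  What the shifted cell loses at one face it gains at the opposite one: \<open>L\<close> is the slab left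
  behind, \<open>R\<close> the slab entered, and \<open>R\<close> is \<open>L\<close> moved by one period.
\<close>

lemma integral_period_cell_shift:
  fixes g :: "real^'d::finite \<Rightarrow> complex"
  assumes g: "continuous_on UNIV g" and per: "\<And>x. g (x + axis i (2 * pi)) = g x"
    and s: "0 \<le> s" "s \<le> 2 * pi"
  shows "integral period_cell (\<lambda>x. g (x + axis i s)) = integral period_cell g"
proof -
  let ?p = "(\<chi> i. 2 * pi) :: real^'d"
  define L where "L = cbox 0 (?p + axis i (s - 2 * pi))"
  define M where "M = cbox (axis i s) ?p"
  define R where "R = cbox (axis i (2 * pi)) (?p + axis i s)"
  have int: "g integrable_on cbox a b" for a b
    using g continuous_on_subset integrable_continuous by blast
  have LM: "period_cell = L \<union> M" and MR: "cbox (axis i s) (?p + axis i s) = M \<union> R"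
    using s unfolding L_def M_def R_def
    by (auto simp: mem_box_cart axis_def split: if_splits) (smt (verit))+
  have "x \<bullet> axis i 1 = s" if "x \<in> L" "x \<in> M" for x
  proof -
    have "x $ i \<le> s" using that(1) unfolding L_def mem_box_cart
      by (auto simp: axis_def dest!: spec[of _ i])
    moreover have "s \<le> x $ i" using that(2) unfolding M_def mem_box_cart
      by (auto simp: axis_def dest!: spec[of _ i])
    ultimately show ?thesis by (simp add: inner_axis)
  qed
  then have "L \<inter> M \<subseteq> {x. x \<bullet> axis i 1 = s}" by blast
  then have n1: "negligible (L \<inter> M)"
    using negligible_standard_hyperplane[of "axis i 1 :: real^'d" s] negligible_subset
    by (auto simp: axis_in_Basis_iff)
  have "x \<bullet> axis i 1 = 2 * pi" if "x \<in> M" "x \<in> R" for x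
  proof -
    have "x $ i \<le> 2 * pi" using that(1) unfolding M_def mem_box_cart
      by (auto simp: axis_def dest!: spec[of _ i])
    moreover have "2 * pi \<le> x $ i" using that(2) unfolding R_def mem_box_cart
      by (auto simp: axis_def dest!: spec[of _ i])
    ultimately show ?thesis by (simp add: inner_axis)
  qed
  then have "M \<inter> R \<subseteq> {x. x \<bullet> axis i 1 = 2 * pi}" by blast
  then have n2: "negligible (M \<inter> R)"
    using negligible_standard_hyperplane[of "axis i 1 :: real^'d" "2 * pi"] negligible_subset
    by (auto simp: axis_in_Basis_iff)
  have "?p + axis i (s - 2 * pi) = ?p + axis i s - axis i (2 * pi)"
    by (simp add: vec_eq_iff axis_def)
  then have "L = cbox (axis i (2 * pi) - axis i (2 * pi)) (?p + axis i s - axis i (2 * pi))"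
    by (simp only: L_def diff_self)
  then have RL: "integral R g = integral L g"
    unfolding R_def using integral_shift_cbox[of "axis i (2 * pi)" "axis i (2 * pi)" "?p + axis i s" g]
    by (simp add: per)
  have "integral period_cell (\<lambda>x. g (x + axis i s)) = integral (cbox (axis i s) (?p + axis i s)) g"
    using integral_shift_cbox[of "axis i s" "axis i s" "?p + axis i s" g] by simp
  also have "\<dots> = integral M g + integral R g"
    unfolding MR by (rule integral_Un) (use n2 int in \<open>auto simp: M_def R_def\<close>)
  also have "\<dots> = integral L g + integral M g" by (simp add: RL)
  also have "\<dots> = integral period_cell g"
    unfolding LM by (rule integral_Un[symmetric]) (use n1 int in \<open>auto simp: M_def L_def\<close>)
  finally show ?thesis .
qed

text \<open>
  The integral is the derivative at \<open>s = 0\<close> of the integral of \<open>g\<close> shifted by \<open>s\<close>, which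
  does not depend on \<open>s\<close>.
\<close>

lemma integral_partial_deriv_period_cell:
  fixes g :: "real^'d::finite \<Rightarrow> complex"
  assumes diff: "\<And>x. g differentiable (at x)"
    and cd: "continuous_on UNIV (partial_deriv i g)"
    and per: "\<And>x. g (x + axis i (2 * pi)) = g x"
  shows "integral period_cell (partial_deriv i g) = 0"
proof -
  let ?U = "{0..2 * pi}"
  let ?J = "\<lambda>s. integral period_cell (\<lambda>x. g (x + axis i s))"
  have cg: "continuous_on UNIV g"
    using diff by (simp add: continuous_at_imp_continuous_on differentiable_imp_continuous_within)
  have cax: "continuous_on V (\<lambda>z. axis i (f z) :: real^'d)" if "continuous_on V f"
    for V :: "'z::topological_space set" and f :: "'z \<Rightarrow> real"
  proof -
    have "(\<lambda>z. axis i (f z) :: real^'d) = (\<lambda>z. f z *\<^sub>R axis i 1)"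
      by (auto simp: vec_eq_iff axis_def)
    then show ?thesis using that by (simp only:) (intro continuous_intros)
  qed
  have "(?J has_vector_derivative integral period_cell (\<lambda>x. partial_deriv i g (x + axis i 0))) (at 0 within ?U)"
  proof (rule leibniz_rule_vector_derivative)
    fix s and x :: "real^'d"
    show "((\<lambda>s. g (x + axis i s)) has_vector_derivative partial_deriv i g (x + axis i s)) (at s within ?U)"
      by (rule has_vector_derivative_along_axis[OF diff])
  next
    fix s :: real
    show "(\<lambda>x. g (x + axis i s)) integrable_on period_cell"
      by (rule integrable_continuous)
        (auto intro!: continuous_on_compose2[OF cg] continuous_intros)
  next
    show "continuous_on (?U \<times> period_cell) (\<lambda>(s, x). partial_deriv i g (x + axis i s))"
      unfolding split_beta
      by (rule continuous_on_compose2[OF cd]) (auto intro!: continuous_intros cax)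
  qed auto
  moreover have "(?J has_vector_derivative 0) (at 0 within ?U)"
  proof (rule has_vector_derivative_transform)
    show "((\<lambda>_. integral period_cell g) has_vector_derivative 0) (at 0 within ?U)" by simp
    show "?J s = integral period_cell g" if "s \<in> ?U" for s
      by (rule integral_period_cell_shift[OF cg]) (use that per in auto)
  qed simp
  ultimately have "integral period_cell (\<lambda>x. partial_deriv i g (x + axis i 0)) = 0"
    by (rule vector_derivative_unique_within[rotated])
      (simp add: trivial_limit_within islimpt_Icc)
  moreover have "axis i 0 = (0 :: real^'d)" by (simp add: vec_eq_iff axis_def)
  ultimately show ?thesis by (simp add: eta_contract_eq)
qed

section \<open>Fourier coefficients of test functions\<close>

abbreviation fmode_scale :: "'d::finite itself \<Rightarrow> real" where
  "fmode_scale _ \<equiv> (2 * pi) powr (- real CARD('d) / 2)"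

definition fourier_int :: "(real^'d::finite \<Rightarrow> complex) \<Rightarrow> int^'d \<Rightarrow> complex" where
  "fourier_int f k = integral period_cell (\<lambda>x. fmode k x * f x)"

lemma norm_fmode: "cmod (fmode k x) = fmode_scale TYPE('d)" for x :: "real^'d::finite"
  by (simp add: fmode_def norm_mult)

lemma continuous_on_fmode [continuous_intros]: "continuous_on S (fmode k)"
  using torus_test_continuous_on[OF fmode_in_torus_test] .

lemma rvec_add: "rvec (k + l) = rvec k + rvec l"
  by (simp add: rvec_def vec_eq_iff)

lemma rvec_uminus: "rvec (- k) = - rvec k"
  by (simp add: rvec_def vec_eq_iff)

lemma rvec_nth [simp]: "rvec k $ i = of_int (k $ i)"
  by (simp add: rvec_def)

lemma rvec_zero [simp]: "rvec 0 = 0"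
  by (simp add: rvec_def vec_eq_iff)

lemma fmode_mult:
  "fmode k x * fmode l x = of_real (fmode_scale TYPE('d)) * fmode (k + l) (x :: real^'d::finite)"
  by (simp add: fmode_def rvec_add inner_add_left cis_mult[symmetric])

lemma fmode_zero: "fmode 0 = (\<lambda>x :: real^'d::finite. of_real (fmode_scale TYPE('d)))"
  by (simp add: fmode_def fun_eq_iff)

lemma cnj_fmode: "cnj (fmode k x) = fmode (- k) x"
  by (simp add: fmode_def rvec_uminus cis_cnj)

lemma partial_deriv_fmode: "partial_deriv i (fmode k) = (\<lambda>x. \<i> * of_int (k $ i) * fmode k x)"
  using partial_deriv_eqI[OF has_derivative_fmode[of 1 k], of i]
  by (simp add: inner_axis fun_eq_iff)

lemma fmode_differentiable: "fmode k differentiable (at x)"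
  using torus_test_differentiable[OF fmode_in_torus_test, of "[]"] by simp

lemma content_period_cell: "measure lborel (period_cell :: (real^'d::finite) set) = (2 * pi) ^ CARD('d)"
  by (subst content_cbox_cart) (auto simp: interval_eq_empty_cart)

lemma fmode_scale_square: "(fmode_scale TYPE('d::finite))\<^sup>2 * (2 * pi) ^ CARD('d) = 1"
proof -
  have "(2 * pi) ^ CARD('d) = (2 * pi) powr real CARD('d)"
    by (rule powr_realpow[symmetric]) simp
  then have "(fmode_scale TYPE('d))\<^sup>2 * (2 * pi) ^ CARD('d) =
      (2 * pi) powr (- real CARD('d) / 2 + - real CARD('d) / 2 + real CARD('d))"
    by (simp only: powr_add power2_eq_square)
  then show ?thesis by simp
qed

lemma integrable_on_period_cell:
  fixes f :: "real^'d::finite \<Rightarrow> complex"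
  assumes "continuous_on UNIV f"
  shows "(\<lambda>x. fmode k x * f x) integrable_on period_cell"
  by (intro integrable_continuous continuous_intros continuous_on_subset[OF assms]) auto

lemma integral_fmode:
  assumes "m \<noteq> 0"
  shows "integral period_cell (fmode m) = 0"
proof -
  obtain i where i: "m $ i \<noteq> 0" using assms by (auto simp: vec_eq_iff)
  have "integral period_cell (partial_deriv i (fmode m)) = 0"
    using torus_test_periodic[OF fmode_in_torus_test]
      torus_test_continuous_on[OF torus_test_partial_deriv[OF fmode_in_torus_test]]
    by (intro integral_partial_deriv_period_cell) (auto simp: fmode_differentiable)
  then show ?thesis using i by (simp add: partial_deriv_fmode)
qed

lemma fourier_int_fmode: "fourier_int (fmode l) k = (if k = - l then 1 else 0)" for k :: "int^'d::finite"
proof -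
  have *: "fourier_int (fmode l) k = of_real (fmode_scale TYPE('d)) * integral period_cell (fmode (k + l))"
    by (simp add: fourier_int_def fmode_mult eta_contract_eq)
  show ?thesis
  proof (cases "k = - l")
    case True
    then have "fourier_int (fmode l) k = of_real ((fmode_scale TYPE('d))\<^sup>2 * (2 * pi) ^ CARD('d))"
      unfolding * by (simp add: fmode_zero content_period_cell power2_eq_square scaleR_conv_of_real)
    then show ?thesis using True by (simp only: fmode_scale_square) simp
  next
    case False
    then have "k + l \<noteq> 0" by (simp add: eq_neg_iff_add_eq_0)
    then show ?thesis using False by (simp add: * integral_fmode)
  qed
qed

lemma fourier_int_cmult: "fourier_int (\<lambda>x. c * f x) k = c * fourier_int f k"
  by (simp add: fourier_int_def mult.left_commute)

lemma fourier_int_add: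
  assumes "continuous_on UNIV f" "continuous_on UNIV g"
  shows "fourier_int (\<lambda>x. f x + g x) k = fourier_int f k + fourier_int g k"
  by (simp add: fourier_int_def distrib_left integral_add integrable_on_period_cell assms)

lemma fourier_int_cnj: "fourier_int (\<lambda>x. cnj (f x)) k = cnj (fourier_int f (- k))"
  by (simp add: fourier_int_def integral_cnj cnj_fmode)

text \<open>
  Integration by parts: the product of \<open>f\<close> with a mode is periodic, so its derivatives have
  integral zero.
\<close>

lemma fourier_int_partial_deriv:
  assumes f: "f \<in> torus_test"
  shows "fourier_int (partial_deriv i f) k = - (\<i> * of_int (k $ i)) * fourier_int f k"
proof -
  let ?g = "\<lambda>x. fmode k x * f x"
  let ?h = "\<lambda>x. fmode k x * partial_deriv i f x + (\<i> * of_int (k $ i)) * (fmode k x * f x)"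
  have Df: "(f has_derivative frechet_derivative f (at x)) (at x)" for x
    using torus_test_has_derivative[OF f, of "[]"] by simp
  have Dk: "(fmode k has_derivative frechet_derivative (fmode k) (at x)) (at x)" for x
    using fmode_differentiable frechet_derivative_works by blast
  have D: "(?g has_derivative (\<lambda>h. fmode k x * frechet_derivative f (at x) h +
      frechet_derivative (fmode k) (at x) h * f x)) (at x)" for x
    by (rule has_derivative_mult[OF Dk Df])
  have pd: "partial_deriv i ?g = ?h"
    using partial_deriv_eqI[OF D, of i] fun_cong[OF partial_deriv_fmode[of i k]]
    by (auto simp: fun_eq_iff partial_deriv_def algebra_simps)
  have cf: "continuous_on UNIV f" "continuous_on UNIV (partial_deriv i f)"
    using torus_test_continuous_on[OF f] torus_test_continuous_on[OF torus_test_partial_deriv[OF f]] by auto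
  have "integral period_cell (partial_deriv i ?g) = 0"
  proof (rule integral_partial_deriv_period_cell)
    show "?g differentiable (at x)" for x using D by (auto simp: differentiable_def)
    show "continuous_on UNIV (partial_deriv i ?g)"
      unfolding pd by (intro continuous_intros cf)
    show "?g (x + axis i (2 * pi)) = ?g x" for x
      by (simp add: torus_test_periodic f fmode_in_torus_test)
  qed
  also have "integral period_cell (partial_deriv i ?g) =
      fourier_int (partial_deriv i f) k + (\<i> * of_int (k $ i)) * fourier_int f k"
    unfolding pd fourier_int_def
    by (subst integral_add) (auto intro!: integrable_on_period_cell cf integrable_on_mult_right)
  finally show ?thesis by (simp add: add_eq_0_iff)
qed

lemma norm_fourier_int_le:
  fixes f :: "real^'d::finite \<Rightarrow> complex"
  assumes "continuous_on UNIV f" and "\<And>x. cmod (f x) \<le> M"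
  shows "cmod (fourier_int f k) \<le> fmode_scale TYPE('d) * (2 * pi) ^ CARD('d) * M"
proof -
  have "cmod (fourier_int f k) \<le> (fmode_scale TYPE('d) * M) * measure lborel (period_cell :: (real^'d) set)"
    unfolding fourier_int_def
  proof (rule has_integral_bound)
    show "((\<lambda>x. fmode k x * f x) has_integral integral period_cell (\<lambda>x. fmode k x * f x)) period_cell"
      by (intro integrable_integral integrable_on_period_cell assms)
    have "0 \<le> M" using assms(2)[of 0] norm_ge_zero order_trans by blast
    then show "0 \<le> fmode_scale TYPE('d) * M" by simp
  qed (use assms(2) in \<open>auto simp: norm_mult norm_fmode intro!: mult_left_mono\<close>)
  then show ?thesis unfolding content_period_cell by (simp add: mult_ac)
qed

lemma fourier_int_partial_derivs_replicate:
  assumes "f \<in> torus_test"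
  shows "fourier_int (partial_derivs (replicate p i) f) k = (- (\<i> * of_int (k $ i))) ^ p * fourier_int f k"
proof (induction p)
  case (Suc p)
  then show ?case
    using fourier_int_partial_deriv[OF torus_test_partial_derivs[OF assms, of "replicate p i"], of i k]
    by simp
qed simp

lemma norm_fourier_int_partial_derivs_le:
  assumes f: "f \<in> torus_test"
  shows "cmod (fourier_int (partial_derivs is f) k) \<le> norm (rvec k) ^ length is * cmod (fourier_int f k)"
proof (induction "is")
  case (Cons j "is")
  have "\<bar>of_int (k $ j)\<bar> \<le> norm (rvec k)"
    using component_le_norm_cart[of "rvec k" j] by simp
  then have "cmod (fourier_int (partial_derivs (j # is) f) k) \<le> 
      norm (rvec k) * cmod (fourier_int (partial_derivs is f) k)"
    using fourier_int_partial_deriv[OF torus_test_partial_derivs[OF f, of "is"], of j k]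
    by (simp add: norm_mult mult_right_mono)
  also have "\<dots> \<le> norm (rvec k) * (norm (rvec k) ^ length is * cmod (fourier_int f k))"
    using Cons by (intro mult_left_mono) auto
  finally show ?case by (simp add: mult_ac)
qed simp

text \<open>
  Integrate by parts \<open>p\<close> times in the direction of the largest component of \<open>k\<close>, which is at
  least \<open>norm (rvec k) / CARD('d)\<close>.
\<close>

lemma fourier_int_decay:
  fixes f :: "real^'d::finite \<Rightarrow> complex"
  assumes f: "f \<in> torus_test"
    and M: "\<And>is x. length is \<le> p \<Longrightarrow> cmod (partial_derivs is f x) \<le> M"
  shows "norm (rvec k) ^ p * cmod (fourier_int f k)
    \<le> real CARD('d) ^ p * (fmode_scale TYPE('d) * (2 * pi) ^ CARD('d)) * M"
proof -
  define a where "a = Max (range (\<lambda>i. \<bar>real_of_int (k $ i)\<bar>))"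
  have "a \<in> range (\<lambda>i. \<bar>real_of_int (k $ i)\<bar>)" unfolding a_def by (rule Max_in) auto
  then obtain i where i: "a = \<bar>real_of_int (k $ i)\<bar>" by blast
  have "norm (rvec k) \<le> (\<Sum>j\<in>UNIV. \<bar>rvec k $ j\<bar>)" by (rule norm_le_l1_cart)
  also have "\<dots> \<le> (\<Sum>j\<in>(UNIV::'d set). a)"
    unfolding a_def by (intro sum_mono) (auto intro!: Max_ge)
  finally have "norm (rvec k) ^ p \<le> (real CARD('d) * a) ^ p"
    by (intro power_mono) auto
  then have "norm (rvec k) ^ p * cmod (fourier_int f k)
      \<le> (real CARD('d) * a) ^ p * cmod (fourier_int f k)"
    by (rule mult_right_mono) simp
  also have "\<dots> = real CARD('d) ^ p * cmod (fourier_int (partial_derivs (replicate p i) f) k)"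
    by (simp add: fourier_int_partial_derivs_replicate[OF f] norm_mult norm_power i power_mult_distrib)
  also have "\<dots> \<le> real CARD('d) ^ p * (fmode_scale TYPE('d) * (2 * pi) ^ CARD('d) * M)"
    by (intro mult_left_mono norm_fourier_int_le torus_test_derivs_continuous_on f M) auto
  finally show ?thesis by (simp add: mult_ac)
qed

section \<open>Reduction to the period cell\<close>

definition cell_rep :: "real^'d::finite \<Rightarrow> real^'d" where
  "cell_rep x = (\<chi> i. x $ i - 2 * pi * of_int \<lfloor>x $ i / (2 * pi)\<rfloor>)"

lemma cell_rep_in_period_cell: "cell_rep x \<in> period_cell"
proof -
  have "0 \<le> x $ i - 2 * pi * of_int \<lfloor>x $ i / (2 * pi)\<rfloor>
    \<and> x $ i - 2 * pi * of_int \<lfloor>x $ i / (2 * pi)\<rfloor> \<le> 2 * pi" for i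
  proof -
    let ?y = "x $ i / (2 * pi)"
    have "2 * pi * of_int \<lfloor>?y\<rfloor> \<le> 2 * pi * ?y"
      by (rule mult_left_mono) (linarith, simp)
    moreover have "2 * pi * ?y \<le> 2 * pi * (of_int \<lfloor>?y\<rfloor> + 1)"
      by (rule mult_left_mono) (linarith, simp)
    moreover have "2 * pi * ?y = x $ i" by simp
    ultimately have "2 * pi * of_int \<lfloor>?y\<rfloor> \<le> x $ i" "x $ i \<le> 2 * pi * of_int \<lfloor>?y\<rfloor> + 2 * pi"
      by (simp_all only: distrib_left mult_1_right)
    then show ?thesis by linarith
  qed
  then show ?thesis by (simp add: mem_box_cart cell_rep_def)
qed

lemma periodic_axis_multiple:
  fixes f :: "real^'d::finite \<Rightarrow> 'a"
  assumes "\<And>x. f (x + axis i (2 * pi)) = f x"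
  shows "f (x + axis i (2 * pi * of_int n)) = f x"
proof -
  have nat: "f (x + axis i (2 * pi * of_nat m)) = f x" for m x
  proof (induction m)
    case 0
    have "axis i 0 = (0 :: real^'d)" by (simp add: vec_eq_iff axis_def)
    then show ?case by (simp only: of_nat_0 mult_zero_right add_0_right)
  next
    case (Suc m)
    have "axis i (2 * pi * of_nat (Suc m)) = axis i (2 * pi * of_nat m) + (axis i (2 * pi) :: real^'d)"
      by (simp add: vec_eq_iff axis_def algebra_simps)
    then show ?case using Suc assms by (simp flip: add.assoc)
  qed
  show ?thesis
  proof (cases "n \<ge> 0")
    case True
    then show ?thesis using nat[of x "nat n"] by simp
  next
    case False
    have "x + axis i (2 * pi * of_int n) + axis i (2 * pi * of_nat (nat (- n))) = x"
      using False by (simp add: vec_eq_iff axis_def)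
    from nat[of "x + axis i (2 * pi * of_int n)" "nat (- n)", unfolded this] show ?thesis by (rule sym)
  qed
qed

lemma periodic_cell_rep:
  fixes f :: "real^'d::finite \<Rightarrow> 'a"
  assumes "\<And>i x. f (x + axis i (2 * pi)) = f x"
  shows "f (cell_rep x) = f x"
proof -
  have "finite I \<Longrightarrow> f (\<chi> i. if i \<in> I then cell_rep x $ i else x $ i) = f x" for I
  proof (induction I rule: finite_induct)
    case empty
    then show ?case by simp
  next
    case (insert j I)
    have "(\<chi> i. if i \<in> insert j I then cell_rep x $ i else x $ i) =
      (\<chi> i. if i \<in> I then cell_rep x $ i else x $ i) + axis j (2 * pi * of_int (- \<lfloor>x $ j / (2 * pi)\<rfloor>))"
      using insert.hyps(2) by (simp add: vec_eq_iff axis_def cell_rep_def)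
    then show ?case using insert.IH by (simp only: periodic_axis_multiple[of f j, OF assms])
  qed
  from this[of UNIV] show ?thesis by (simp add: vec_lambda_eta)
qed

lemma torus_test_cell_rep: "f \<in> torus_test \<Longrightarrow> f (cell_rep x) = f x"
  by (rule periodic_cell_rep[of f]) (rule torus_test_periodic)

text \<open>
  By periodicity the values on the compact period cell suffice, and there are finitely many
  derivatives of bounded order.
\<close>

lemma torus_test_derivs_bounded:
  fixes f :: "real^'d::finite \<Rightarrow> complex"
  assumes f: "f \<in> torus_test"
  obtains M where "\<And>is x. length is \<le> m \<Longrightarrow> cmod (partial_derivs is f x) \<le> M"
proof -
  have "\<exists>B. \<forall>x. cmod (partial_derivs is f x) \<le> B" for "is"
  proof -
    have "compact (partial_derivs is f ` period_cell)"
      by (intro compact_continuous_image torus_test_derivs_continuous_on f compact_cbox)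
    then have "bounded (partial_derivs is f ` period_cell)" by (rule compact_imp_bounded)
    then obtain B where B: "cmod (partial_derivs is f y) \<le> B" if "y \<in> period_cell" for y
      unfolding bounded_iff by blast
    have "cmod (partial_derivs is f x) \<le> B" for x
      using B[OF cell_rep_in_period_cell, of x]
      by (simp only: torus_test_cell_rep[OF torus_test_partial_derivs[OF f]])
    then show ?thesis by blast
  qed
  then obtain B where B: "\<And>is x. cmod (partial_derivs is f x) \<le> B is" by metis
  let ?L = "{is :: 'd list. length is \<le> m}"
  have fin: "finite ?L" using finite_lists_length_le[of "UNIV :: 'd set" m] by simp
  have "cmod (partial_derivs is f x) \<le> Max (B ` ?L)" if "length is \<le> m" for "is" x
  proof -
    have "B is \<le> Max (B ` ?L)" using fin that by (intro Max_ge) simp_all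
    with B[of "is" x] show ?thesis by (rule order_trans)
  qed
  then show thesis by (rule that)
qed

section \<open>Completeness of the Fourier modes\<close>

text \<open>
  Linear combinations of modes, built up one mode at a time so that closure under products is
  proved by induction.
\<close>

inductive trig_poly :: "(real^'d::finite \<Rightarrow> complex) \<Rightarrow> bool" where
  zero: "trig_poly (\<lambda>x. 0)"
| add_mode: "trig_poly F \<Longrightarrow> trig_poly (\<lambda>x. c * fmode k x + F x)"

lemma trig_poly_mode: "trig_poly (\<lambda>x. c * fmode k x)"
  using trig_poly.add_mode[OF trig_poly.zero, of c k] by simp

lemma trig_poly_add: "trig_poly F \<Longrightarrow> trig_poly G \<Longrightarrow> trig_poly (\<lambda>x. F x + G x)"
  by (induction rule: trig_poly.induct) (auto simp: add.assoc intro: trig_poly.intros)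

lemma trig_poly_mode_mult: "trig_poly F \<Longrightarrow> trig_poly (\<lambda>x. c * fmode k x * F x)"
proof (induction rule: trig_poly.induct)
  case zero
  then show ?case by (simp add: trig_poly.zero)
next
  case (add_mode F a l)
  have "(\<lambda>x. c * fmode k x * (a * fmode l x + F x)) =
    (\<lambda>x. (c * a * of_real (fmode_scale TYPE('a))) * fmode (k + l) x + c * fmode k x * F x)"
  proof
    fix x :: "real^'a"
    have "c * fmode k x * (a * fmode l x + F x) = c * a * (fmode k x * fmode l x) + c * fmode k x * F x"
      by (simp add: algebra_simps)
    then show "c * fmode k x * (a * fmode l x + F x) =
        (c * a * of_real (fmode_scale TYPE('a))) * fmode (k + l) x + c * fmode k x * F x"
      by (simp add: fmode_mult mult.assoc)
  qed
  then show ?case using trig_poly.add_mode[OF add_mode.IH] by simp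
qed

lemma trig_poly_mult: "trig_poly F \<Longrightarrow> trig_poly G \<Longrightarrow> trig_poly (\<lambda>x. F x * G x)"
  by (induction rule: trig_poly.induct)
    (auto simp: distrib_right intro: trig_poly.zero trig_poly_add trig_poly_mode_mult)

lemma trig_poly_const: "trig_poly (\<lambda>x. c)"
proof -
  have "(\<lambda>x::real^'a. (c / of_real (fmode_scale TYPE('a))) * fmode 0 x) = (\<lambda>x. c)"
    by (simp add: fmode_zero)
  then show ?thesis using trig_poly_mode[of "c / of_real (fmode_scale TYPE('a))" "0 :: int^'a"] by simp
qed

lemma trig_poly_cis:
  fixes i :: "'d::finite"
  shows "trig_poly (\<lambda>x. cis (x $ i))" "trig_poly (\<lambda>x. cis (- (x $ i)))"
proof -
  have "cis (x $ i) = (1 / of_real (fmode_scale TYPE('d))) * fmode (axis i 1) x"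
       "cis (- (x $ i)) = (1 / of_real (fmode_scale TYPE('d))) * fmode (- axis i 1) x" for x
  proof -
    have "rvec (axis i 1) = (axis i 1 :: real^'d)" by (simp add: vec_eq_iff axis_def)
    then show "cis (x $ i) = (1 / of_real (fmode_scale TYPE('d))) * fmode (axis i 1) x"
       "cis (- (x $ i)) = (1 / of_real (fmode_scale TYPE('d))) * fmode (- axis i 1) x"
      by (simp_all add: fmode_def rvec_uminus inner_axis' )
  qed
  then show "trig_poly (\<lambda>x::real^'d. cis (x $ i))" "trig_poly (\<lambda>x::real^'d. cis (- (x $ i)))"
    by (simp_all only: trig_poly_mode)
qed

lemma trig_poly_continuous: "trig_poly F \<Longrightarrow> continuous_on UNIV F"
  by (induction rule: trig_poly.induct) (auto intro!: continuous_intros)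

lemma integral_trig_poly_mult:
  fixes h :: "real^'d::finite \<Rightarrow> complex"
  assumes "trig_poly F" and h: "continuous_on UNIV h" and "\<And>k. fourier_int h k = 0"
  shows "integral period_cell (\<lambda>x. F x * h x) = 0"
  using assms(1)
proof (induction rule: trig_poly.induct)
  case (add_mode F c k)
  have "(\<lambda>x. F x * h x) integrable_on period_cell"
    by (intro integrable_continuous continuous_on_mult)
      (auto intro: continuous_on_subset[OF h] continuous_on_subset[OF trig_poly_continuous[OF add_mode(1)]])
  then have "integral period_cell (\<lambda>x. c * (fmode k x * h x) + F x * h x) =
      c * fourier_int h k + integral period_cell (\<lambda>x. F x * h x)"
    unfolding fourier_int_def
    by (subst integral_add) (auto intro!: integrable_on_mult_right integrable_on_period_cell h)
  then show ?case using add_mode assms(3) by (simp add: distrib_right mult.assoc)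
qed simp

text \<open>
  The torus as a compact set of points, so that the Stone--Weierstrass theorem applies: it needs
  a space whose points are separated, which the period cell with its opposite faces is not.
\<close>

definition torus_map :: "real^'d::finite \<Rightarrow> complex^'d" where
  "torus_map x = (\<chi> i. cis (x $ i))"

lemma torus_map_eq_imp_cell_rep_eq:
  assumes "torus_map x = torus_map y"
  shows "cell_rep x = cell_rep y"
proof -
  have "x $ i - 2 * pi * of_int \<lfloor>x $ i / (2 * pi)\<rfloor> = y $ i - 2 * pi * of_int \<lfloor>y $ i / (2 * pi)\<rfloor>" for i
  proof -
    have "cis (x $ i) = cis (y $ i)" using assms by (simp add: torus_map_def vec_eq_iff)
    then have "sin (x $ i) = sin (y $ i) \<and> cos (x $ i) = cos (y $ i)" by (simp add: complex_eq_iff)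
    then obtain n :: int where n: "x $ i = y $ i + 2 * pi * n" using sin_cos_eq_iff by blast
    then have "x $ i / (2 * pi) = y $ i / (2 * pi) + of_int n" by (simp add: field_simps)
    then have "\<lfloor>x $ i / (2 * pi)\<rfloor> = \<lfloor>y $ i / (2 * pi)\<rfloor> + n" by simp
    then show ?thesis using n by (simp add: algebra_simps)
  qed
  then show ?thesis by (simp add: cell_rep_def)
qed

lemma continuous_on_torus_map: "continuous_on S torus_map"
  unfolding torus_map_def by (intro continuous_intros)

text \<open>
  The map from the period cell onto the torus is a quotient map, since the image of a closed
  subset of the compact cell is compact and hence closed.
\<close>

lemma periodic_factors_through_torus:
  fixes u :: "real^'d::finite \<Rightarrow> real"
  assumes cont: "continuous_on UNIV u" and per: "\<And>i x. u (x + axis i (2 * pi)) = u x"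
  obtains v where "continuous_on (torus_map ` period_cell) v" "\<And>x. v (torus_map x) = u x"
proof
  define v where "v z = u (inv_into UNIV torus_map z)" for z
  show v: "v (torus_map x) = u x" for x
  proof -
    have "torus_map (inv_into UNIV torus_map (torus_map x)) = torus_map x"
      by (rule f_inv_into_f) simp
    then have "cell_rep (inv_into UNIV torus_map (torus_map x)) = cell_rep x"
      by (rule torus_map_eq_imp_cell_rep_eq)
    then have "u (cell_rep (inv_into UNIV torus_map (torus_map x))) = u (cell_rep x)" by simp
    then show ?thesis unfolding v_def by (simp only: periodic_cell_rep[of u, OF per])
  qed
  show "continuous_on (torus_map ` period_cell) v"
    unfolding continuous_on_closed_invariant
  proof (intro allI impI)
    fix B :: "real set" assume "closed B"
    let ?A = "torus_map ` (period_cell \<inter> u -` B)"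
    have "closed (u -` B)" using cont \<open>closed B\<close> by (simp add: closed_vimage continuous_on_eq_continuous_at)
    then have "compact (period_cell \<inter> u -` B)" by (rule compact_Int_closed[OF compact_cbox])
    then have "closed ?A"
      by (intro compact_imp_closed compact_continuous_image continuous_on_torus_map)
    moreover have "?A \<inter> torus_map ` period_cell = v -` B \<inter> torus_map ` period_cell"
      using v by auto
    ultimately show "\<exists>A. closed A \<and> A \<inter> torus_map ` period_cell = v -` B \<inter> torus_map ` period_cell"
      by blast
  qed
qed

text \<open>
  The functions on the torus that pull back to trigonometric polynomials form an algebra, and the
  real and imaginary parts of the coordinates, which separate points, belong to it.
\<close>

lemma trig_poly_dense_real:
  fixes u :: "real^'d::finite \<Rightarrow> real"
  assumes cont: "continuous_on UNIV u" and per: "\<And>i x. u (x + axis i (2 * pi)) = u x" and "0 < e"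
  obtains F where "trig_poly F" "\<And>x. x \<in> period_cell \<Longrightarrow> cmod (of_real (u x) - F x) < e"
proof -
  let ?S = "torus_map ` (period_cell :: (real^'d) set)"
  obtain v where v: "continuous_on ?S v" "\<And>x. v (torus_map x) = u x"
    using periodic_factors_through_torus[OF cont per] by blast
  let ?P = "\<lambda>g. continuous_on ?S g \<and> trig_poly (\<lambda>x::real^'d. complex_of_real (g (torus_map x)))"
  have "\<exists>g. ?P g \<and> (\<forall>z\<in>?S. \<bar>v z - g z\<bar> < e)"
  proof (rule Stone_Weierstrass_HOL)
    show "compact ?S" by (intro compact_continuous_image continuous_on_torus_map compact_cbox)
    show "?P (\<lambda>x. c)" for c by (simp add: trig_poly_const)
    show "?P (\<lambda>x. f x + g x)" if "?P f \<and> ?P g" for f g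
      using that by (auto intro: continuous_on_add trig_poly_add)
    show "?P (\<lambda>x. f x * g x)" if "?P f \<and> ?P g" for f g
      using that by (auto intro: continuous_on_mult trig_poly_mult)
    show "\<exists>f. ?P f \<and> f z \<noteq> f w" if "z \<in> ?S \<and> w \<in> ?S \<and> z \<noteq> w" for z w
    proof -
      have "z \<noteq> w" using that by blast
      then obtain i where i: "z $ i \<noteq> w $ i" by (auto simp: vec_eq_iff)
      have R: "?P (\<lambda>z. Re (z $ i))"
      proof
        have "trig_poly (\<lambda>x::real^'d. (1/2) * (cis (x $ i) + cis (- (x $ i))))"
          by (intro trig_poly_mult trig_poly_const trig_poly_add trig_poly_cis)
        moreover have "(1/2) * (cis a + cis (- a)) = complex_of_real (Re (cis a))" for a
          by (simp add: complex_eq_iff)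
        ultimately show "trig_poly (\<lambda>x::real^'d. complex_of_real (Re (torus_map x $ i)))"
          by (simp add: torus_map_def)
      qed (intro continuous_intros)
      have I: "?P (\<lambda>z. Im (z $ i))"
      proof
        have "trig_poly (\<lambda>x::real^'d. (- \<i>/2) * (cis (x $ i) + (-1) * cis (- (x $ i))))"
          by (intro trig_poly_mult trig_poly_const trig_poly_add trig_poly_cis)
        moreover have "(- \<i>/2) * (cis a + (-1) * cis (- a)) = complex_of_real (Im (cis a))" for a
          by (simp add: complex_eq_iff)
        ultimately show "trig_poly (\<lambda>x::real^'d. complex_of_real (Im (torus_map x $ i)))"
          by (simp add: torus_map_def)
      qed (intro continuous_intros)
      have "Re (z $ i) \<noteq> Re (w $ i) \<or> Im (z $ i) \<noteq> Im (w $ i)"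
        using i by (simp add: complex_eq_iff)
      then show ?thesis
      proof
        assume "Re (z $ i) \<noteq> Re (w $ i)"
        with R show ?thesis by (intro exI[of _ "\<lambda>z. Re (z $ i)"] conjI) auto
      next
        assume "Im (z $ i) \<noteq> Im (w $ i)"
        with I show ?thesis by (intro exI[of _ "\<lambda>z. Im (z $ i)"] conjI) auto
      qed
    qed
  qed (use v \<open>0 < e\<close> in auto)
  then obtain g where g: "?P g" "\<forall>z\<in>?S. \<bar>v z - g z\<bar> < e" by blast
  have "cmod (of_real (u x) - of_real (g (torus_map x))) < e" if "x \<in> period_cell" for x
    using g(2) v(2) that by (simp flip: of_real_diff)
  with g(1) show thesis by (intro that[of "\<lambda>x. of_real (g (torus_map x))"]) auto
qed

text \<open>
  Such a function \<open>h\<close> is orthogonal to all trigonometric polynomials.  One of these, \<open>Q\<close>, is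
  uniformly close to \<open>cnj h\<close>; so the integral of \<open>|h|\<^sup>2 = cnj h * h\<close> is close to that
  of \<open>Q * h\<close>, which is zero.
\<close>

lemma fourier_int_zero_imp_zero:
  fixes h :: "real^'d::finite \<Rightarrow> complex"
  assumes cont: "continuous_on UNIV h" and per: "\<And>i x. h (x + axis i (2 * pi)) = h x"
    and zero: "\<And>k. fourier_int h k = 0"
  shows "h x = 0"
proof -
  have ch: "continuous_on period_cell h" using cont continuous_on_subset by blast
  let ?I = "integral period_cell (\<lambda>x. (cmod (h x))\<^sup>2)"
  let ?J = "integral period_cell (\<lambda>x. cmod (h x))"
  have int2: "(\<lambda>x. complex_of_real ((cmod (h x))\<^sup>2)) integrable_on period_cell"
    by (intro integrable_continuous continuous_intros ch)
  have intsq: "(\<lambda>x. (cmod (h x))\<^sup>2) integrable_on period_cell"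
    by (intro integrable_continuous continuous_intros ch)
  have intn: "(\<lambda>x. cmod (h x)) integrable_on period_cell"
    by (intro integrable_continuous continuous_intros ch)
  have J0: "0 \<le> ?J" by (rule integral_nonneg[OF intn]) simp
  have I0: "0 \<le> ?I" by (rule integral_nonneg) (auto intro!: integrable_continuous continuous_intros ch)
  have le: "?I \<le> 2 * e * ?J" if e: "0 < e" for e
  proof -
    have cr: "continuous_on UNIV (\<lambda>x. Re (h x))" "continuous_on UNIV (\<lambda>x. Im (h x))"
      by (intro continuous_intros cont)+
    obtain F where F: "trig_poly F" "\<And>x. x \<in> period_cell \<Longrightarrow> cmod (of_real (Re (h x)) - F x) < e"
      by (rule trig_poly_dense_real[OF cr(1) _ e]) (simp only: per, blast)
    obtain G where G: "trig_poly G" "\<And>x. x \<in> period_cell \<Longrightarrow> cmod (of_real (Im (h x)) - G x) < e"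
      by (rule trig_poly_dense_real[OF cr(2) _ e]) (simp only: per, blast)
    define Q where "Q x = F x + (- \<i>) * G x" for x
    have Q: "trig_poly Q" unfolding Q_def
      by (intro trig_poly_add trig_poly_mult trig_poly_const F G)
    have cQ: "continuous_on period_cell Q" using trig_poly_continuous[OF Q] continuous_on_subset by blast
    have near: "cmod (cnj (h x) - Q x) \<le> 2 * e" if x: "x \<in> period_cell" for x
    proof -
      have "cnj (h x) - Q x = (of_real (Re (h x)) - F x) + (- \<i>) * (of_real (Im (h x)) - G x)"
        by (simp add: Q_def complex_eq_iff)
      then have "cmod (cnj (h x) - Q x) \<le> cmod (of_real (Re (h x)) - F x) + cmod ((- \<i>) * (of_real (Im (h x)) - G x))"
        by (simp only: norm_triangle_ineq)
      also have "\<dots> \<le> e + e" using F(2)[OF x] G(2)[OF x] by (simp add: norm_mult)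
      finally show ?thesis by simp
    qed
    have intQ: "(\<lambda>x. Q x * h x) integrable_on period_cell"
      by (intro integrable_continuous continuous_intros ch cQ)
    have sq: "complex_of_real ((cmod (h x))\<^sup>2) = cnj (h x) * h x" for x
      by (simp only: complex_norm_square mult.commute)
    have "complex_of_real ?I = integral period_cell (\<lambda>x. complex_of_real ((cmod (h x))\<^sup>2))"
      using integral_linear[of "\<lambda>x. (cmod (h x))\<^sup>2" period_cell complex_of_real] intsq
      by (simp add: o_def bounded_linear_of_real)
    also have "\<dots> = integral period_cell (\<lambda>x. complex_of_real ((cmod (h x))\<^sup>2)) - integral period_cell (\<lambda>x. Q x * h x)"
      using integral_trig_poly_mult[OF Q cont zero] by simp
    also have "\<dots> = integral period_cell (\<lambda>x. complex_of_real ((cmod (h x))\<^sup>2) - Q x * h x)"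
      by (rule integral_diff[symmetric, OF int2 intQ])
    also have "\<dots> = integral period_cell (\<lambda>x. (cnj (h x) - Q x) * h x)"
      by (simp only: sq left_diff_distrib)
    finally have "cmod (complex_of_real ?I) = cmod (integral period_cell (\<lambda>x. (cnj (h x) - Q x) * h x))"
      by (rule arg_cong)
    then have "\<bar>?I\<bar> = cmod (integral period_cell (\<lambda>x. (cnj (h x) - Q x) * h x))"
      by (simp only: norm_of_real)
    also have "\<dots> \<le> integral period_cell (\<lambda>x. 2 * e * cmod (h x))"
    proof (rule integral_norm_bound_integral)
      show "(\<lambda>x. (cnj (h x) - Q x) * h x) integrable_on period_cell"
        by (intro integrable_continuous continuous_intros ch cQ)
      show "(\<lambda>x. 2 * e * cmod (h x)) integrable_on period_cell"
        by (intro integrable_continuous continuous_intros ch)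
    qed (auto simp: norm_mult intro!: mult_right_mono near)
    also have "\<dots> = 2 * e * ?J" by simp
    finally show ?thesis using I0 by simp
  qed
  have "?I \<le> 0"
  proof (rule field_le_epsilon)
    fix e :: real assume e: "0 < e"
    have "?I \<le> 2 * (e / (2 * (?J + 1))) * ?J" using le[of "e / (2 * (?J + 1))"] e J0 by simp
    also have "\<dots> = e * (?J / (?J + 1))" using J0 by (simp add: field_simps)
    also have "\<dots> \<le> e * 1" using J0 e by (intro mult_left_mono) auto
    finally show "?I \<le> 0 + e" by simp
  qed
  then have "?I = 0" using I0 by simp
  moreover have "box 0 (\<chi> i. 2 * pi) \<noteq> ({} :: (real^'d) set)"
    by (simp add: interval_eq_empty_cart not_le)
  ultimately have "\<forall>x\<in>period_cell. (cmod (h x))\<^sup>2 = 0"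
    by (subst (asm) integral_cbox_eq_0_iff) (auto intro!: continuous_intros ch)
  then have "h (cell_rep x) = 0" using cell_rep_in_period_cell by auto
  then show ?thesis by (simp only: periodic_cell_rep[of h, OF per])
qed

section \<open>Summability over the frequency lattice\<close>

text \<open>
  The norm of a frequency, made positive at \<open>k = 0\<close>, so that growth and decay conditions need no
  exception there.
\<close>

definition freq :: "int^'d::finite \<Rightarrow> real" where
  "freq k = max 1 (norm (rvec k))"

lemma norm_rvec_ge_1:
  assumes "k \<noteq> 0"
  shows "1 \<le> norm (rvec k)"
proof -
  obtain i where "k $ i \<noteq> 0" using assms by (auto simp: vec_eq_iff)
  then have "1 \<le> \<bar>rvec k $ i\<bar>" by simp
  also have "\<dots> \<le> norm (rvec k)" by (rule component_le_norm_cart)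
  finally show ?thesis .
qed

lemma freq_ge_1 [simp]: "1 \<le> freq k" and norm_rvec_le_freq: "norm (rvec k) \<le> freq k"
  by (auto simp: freq_def)

lemma freq_pos [simp]: "0 < freq k"
  using freq_ge_1[of k] by linarith

lemma freq_eq: "k \<noteq> 0 \<Longrightarrow> freq k = norm (rvec k)"
  using norm_rvec_ge_1[of k] by (simp add: freq_def)

lemma freq_uminus [simp]: "freq (- k) = freq k"
  by (simp add: freq_def rvec_uminus)

lemma summable_inverse_square_int: "(\<lambda>n::int. 1 / (1 + (real_of_int n)\<^sup>2)) summable_on UNIV"
proof -
  let ?f = "\<lambda>n::int. 1 / (1 + (real_of_int n)\<^sup>2)"
  have nat: "(\<lambda>n::nat. 1 / (1 + (real n)\<^sup>2)) summable_on UNIV"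
  proof (rule summable_nonneg_imp_summable_on)
    have "summable (\<lambda>n. inverse (real (Suc n) ^ 2))"
      using inverse_power_summable[of 2, where 'a = real]
        summable_Suc_iff[of "\<lambda>n. inverse (real n ^ 2)"] by simp
    then show "summable (\<lambda>n::nat. 1 / (1 + (real n)\<^sup>2))"
    proof (rule summable_comparison_test'[OF summable_mult[of _ 2], where N = 0])
      show "norm (1 / (1 + (real n)\<^sup>2)) \<le> 2 * inverse (real (Suc n) ^ 2)" for n
      proof -
        have "(real (Suc n))\<^sup>2 \<le> 2 * (1 + (real n)\<^sup>2)"
          using sum_squares_bound[of "real n" 1] by (simp add: power2_eq_square algebra_simps)
        moreover have "1 / a \<le> 2 * inverse b" if "0 < a" "0 < b" "b \<le> 2 * a" for a b :: real
          using that by (simp add: field_simps)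
        ultimately show ?thesis by (simp add: add_pos_nonneg del: of_nat_Suc)
      qed
    qed
  qed simp
  have "?f summable_on range int"
    by (subst summable_on_reindex) (use nat in \<open>auto simp: o_def\<close>)
  moreover have "?f summable_on range (\<lambda>n. - int n)"
    by (subst summable_on_reindex) (use nat in \<open>auto simp: o_def inj_on_def\<close>)
  then have "?f summable_on (range (\<lambda>n. - int n) - range int)"
    by (rule summable_on_subset_banach) auto
  ultimately have "?f summable_on (range int \<union> (range (\<lambda>n. - int n) - range int))"
    by (rule summable_on_Un_disjoint) auto
  moreover have "range int \<union> (range (\<lambda>n. - int n) - range int) = UNIV"
  proof -
    have "z \<in> range int \<or> z \<in> range (\<lambda>n. - int n)" for z
      by (cases z rule: int_cases2) auto
    then show ?thesis by blast
  qed
  ultimately show ?thesis by simp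
qed

text \<open>
  The comparison series is the product of one series \<open>1 / (1 + n\<^sup>2)\<close> for each coordinate,
  whose finite partial sums are bounded by a power of the sum of the one-dimensional series.
\<close>

lemma summable_freq: "(\<lambda>k::int^'d::finite. 1 / freq k ^ (2 * CARD('d))) summable_on UNIV"
proof -
  let ?f = "\<lambda>n::int. 1 / (1 + (real_of_int n)\<^sup>2)"
  define S where "S = infsum ?f UNIV"
  have fin: "sum ?f A \<le> S" if "finite A" for A
    unfolding S_def using that summable_inverse_square_int
    by (intro finite_sum_le_infsum) auto
  have bound: "1 / freq k ^ (2 * CARD('d)) \<le> 2 ^ CARD('d) * (\<Prod>i\<in>UNIV. ?f (k $ i))" for k :: "int^'d"
  proof -
    have pos: "0 < 1 + (real_of_int n)\<^sup>2" for n by (simp add: add_pos_nonneg)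
    have "(\<Prod>i\<in>UNIV. 1 + (real_of_int (k $ i))\<^sup>2) \<le> (\<Prod>i\<in>(UNIV::'d set). 2 * (freq k)\<^sup>2)"
    proof (rule prod_mono)
      fix i
      have "\<bar>rvec k $ i\<bar> \<le> freq k" using component_le_norm_cart norm_rvec_le_freq order_trans by blast
      then have "(real_of_int (k $ i))\<^sup>2 \<le> (freq k)\<^sup>2"
        using power_mono[of "\<bar>rvec k $ i\<bar>" "freq k" 2] by simp
      moreover have "1 \<le> (freq k)\<^sup>2" by simp
      ultimately have "1 + (real_of_int (k $ i))\<^sup>2 \<le> 2 * (freq k)\<^sup>2" by linarith
      then show "0 \<le> 1 + (real_of_int (k $ i))\<^sup>2 \<and> 1 + (real_of_int (k $ i))\<^sup>2 \<le> 2 * (freq k)\<^sup>2"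
        by simp
    qed
    also have "\<dots> = 2 ^ CARD('d) * freq k ^ (2 * CARD('d))"
      by (simp add: power_mult_distrib power_mult)
    finally have le: "(\<Prod>i\<in>UNIV. 1 + (real_of_int (k $ i))\<^sup>2) \<le> 2 ^ CARD('d) * freq k ^ (2 * CARD('d))" .
    have "0 < (\<Prod>i\<in>UNIV. 1 + (real_of_int (k $ i))\<^sup>2)" by (rule prod_pos) (use pos in auto)
    then show ?thesis using le by (simp add: prod_dividef field_simps)
  qed
  show ?thesis
  proof (rule nonneg_bdd_above_summable_on)
    show "bdd_above (sum (\<lambda>k::int^'d. 1 / freq k ^ (2 * CARD('d))) ` {F. F \<subseteq> UNIV \<and> finite F})"
    proof (rule bdd_aboveI2)
      fix K :: "(int^'d) set" assume "K \<in> {F. F \<subseteq> UNIV \<and> finite F}"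
      then have K: "finite K" by simp
      define A where "A = (\<Union>k\<in>K. range (vec_nth k))"
      have A: "finite A" unfolding A_def using K by auto
      have inj: "inj_on vec_nth K" by (auto simp: inj_on_def vec_nth_inject)
      have "(\<Sum>k\<in>K. \<Prod>i\<in>UNIV. ?f (k $ i)) = (\<Sum>g\<in>vec_nth ` K. \<Prod>i\<in>UNIV. ?f (g i))"
        by (simp add: sum.reindex[OF inj])
      also have "\<dots> \<le> (\<Sum>g\<in>PiE (UNIV :: 'd set) (\<lambda>_. A). \<Prod>i\<in>UNIV. ?f (g i))"
      proof (rule sum_mono2)
        show "finite (PiE (UNIV :: 'd set) (\<lambda>_. A))" by (rule finite_PiE) (auto intro: A)
        show "vec_nth ` K \<subseteq> PiE UNIV (\<lambda>_. A)" unfolding A_def by (auto simp: PiE_UNIV_domain)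
        show "0 \<le> (\<Prod>i\<in>UNIV. ?f (g i))" for g :: "'d \<Rightarrow> int" by (intro prod_nonneg ballI) simp
      qed
      also have "\<dots> = (\<Prod>i\<in>(UNIV::'d set). \<Sum>n\<in>A. ?f n)"
        by (rule prod_sum_PiE[symmetric]) (simp_all add: A)
      also have "\<dots> \<le> (\<Prod>i\<in>(UNIV::'d set). S)"
        by (rule prod_mono) (simp add: fin[OF A] sum_nonneg)
      finally have "2 ^ CARD('d) * (\<Sum>k\<in>K. \<Prod>i\<in>UNIV. ?f (k $ i)) \<le> 2 ^ CARD('d) * S ^ CARD('d)"
        by simp
      moreover have "(\<Sum>k\<in>K. 1 / freq k ^ (2 * CARD('d))) \<le> (\<Sum>k\<in>K. 2 ^ CARD('d) * (\<Prod>i\<in>UNIV. ?f (k $ i)))"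
        by (rule sum_mono) (rule bound)
      ultimately show "(\<Sum>k\<in>K. 1 / freq k ^ (2 * CARD('d))) \<le> 2 ^ CARD('d) * S ^ CARD('d)"
        by (simp only: sum_distrib_left[symmetric])
    qed
  qed simp
qed

definition decay_const :: "'d::finite itself \<Rightarrow> nat \<Rightarrow> real" where
  "decay_const _ p = real CARD('d) ^ p * (fmode_scale TYPE('d) * (2 * pi) ^ CARD('d))"

lemma decay_const_nonneg [simp]: "0 \<le> decay_const TYPE('d::finite) p"
  by (simp add: decay_const_def)

lemma fourier_int_freq_decay:
  fixes f :: "real^'d::finite \<Rightarrow> complex"
  assumes f: "f \<in> torus_test"
    and M: "\<And>is x. length is \<le> p \<Longrightarrow> cmod (partial_derivs is f x) \<le> M"
  shows "cmod (fourier_int f k) \<le> decay_const TYPE('d) p * M / freq k ^ p"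
proof (cases "k = 0")
  case True
  have "cmod (fourier_int f k) \<le> fmode_scale TYPE('d) * (2 * pi) ^ CARD('d) * M"
    by (rule norm_fourier_int_le[OF torus_test_continuous_on[OF f]]) (use M[of "[]"] in simp)
  also have "\<dots> \<le> real CARD('d) ^ p * (fmode_scale TYPE('d) * (2 * pi) ^ CARD('d) * M)"
  proof -
    have "0 \<le> M" using order_trans[OF norm_ge_zero M[of "[]" 0]] by simp
    moreover have "1 \<le> real CARD('d) ^ p" by (rule one_le_power) (simp add: Suc_leI)
    ultimately show ?thesis
      using mult_right_mono[of 1 "real CARD('d) ^ p" "fmode_scale TYPE('d) * (2 * pi) ^ CARD('d) * M"] by simp
  qed
  finally show ?thesis using True by (simp add: decay_const_def freq_def mult_ac)
next
  case False
  then have "0 < freq k ^ p" by simp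
  moreover have "freq k ^ p * cmod (fourier_int f k) \<le> decay_const TYPE('d) p * M"
    using fourier_int_decay[OF f M, of p k] unfolding decay_const_def freq_eq[OF False] .
  ultimately show ?thesis by (simp only: pos_le_divide_eq mult.commute)
qed

lemma fourier_int_rapid_decay:
  assumes "f \<in> torus_test"
  obtains C where "0 \<le> C" "\<And>k. cmod (fourier_int f k) \<le> C / freq k ^ p"
proof -
  obtain M where M: "\<And>is x. length is \<le> p \<Longrightarrow> cmod (partial_derivs is f x) \<le> M"
    by (rule torus_test_derivs_bounded[OF assms, of p]) blast
  have "0 \<le> M" using order_trans[OF norm_ge_zero M[of "[]" 0]] by simp
  then have "0 \<le> decay_const TYPE('a) p * M" by simp
  then show thesis using fourier_int_freq_decay[OF assms M] by (rule that)
qed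

section \<open>Fourier expansion of test functions and distributions\<close>

text \<open>
  Since the coefficients decrease rapidly, the series converges uniformly to a continuous function
  \<open>g\<close>; integration term by term shows that \<open>g\<close> has the coefficients of \<open>f\<close>, and by
  completeness \<open>g = f\<close>.
\<close>

lemma fourier_inversion:
  fixes f :: "real^'d::finite \<Rightarrow> complex"
  assumes f: "f \<in> torus_test"
  shows "((\<lambda>k. fourier_int f k * fmode (- k) x) has_sum f x) UNIV"
proof -
  let ?p = "2 * CARD('d)"
  let ?c = "fmode_scale TYPE('d)"
  define g where "g x = (\<Sum>\<^sub>\<infinity>k. fourier_int f k * fmode (- k) x)" for x
  obtain C where C: "0 \<le> C" "\<And>k. cmod (fourier_int f k) \<le> C / freq k ^ ?p"
    using fourier_int_rapid_decay[OF f, where p = ?p] by blast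
  have bound: "cmod (fourier_int f k * fmode (- k) x) \<le> C * ?c * (1 / freq k ^ ?p)" for k x
    using mult_right_mono[OF C(2), of ?c k] by (simp add: norm_mult norm_fmode)
  have bound2: "cmod (fmode l x * (fourier_int f k * fmode (- k) x)) \<le> ?c * (C * ?c * (1 / freq k ^ ?p))" for k l x
    unfolding norm_mult[of "fmode l x"] norm_fmode by (rule mult_left_mono[OF bound]) simp
  have sum1: "(\<lambda>k::int^'d. C * ?c * (1 / freq k ^ ?p)) summable_on UNIV"
    by (intro summable_on_cmult_right summable_freq)
  have hs: "((\<lambda>k. fourier_int f k * fmode (- k) x) has_sum g x) UNIV" for x
    unfolding g_def
    by (rule has_sum_infsum, rule abs_summable_summable, rule Infinite_Sum.abs_summable_on_comparison_test'[OF sum1], rule bound)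
  have lim1: "uniform_limit UNIV (\<lambda>K x. \<Sum>k\<in>K. fourier_int f k * fmode (- k) x) g (finite_subsets_at_top UNIV)"
    by (rule Weierstrass_m_test_general'[OF bound hs sum1])
  have contg: "continuous_on UNIV g"
    by (rule uniform_limit_theorem[OF _ lim1])
      (auto intro!: always_eventually continuous_intros)
  have fg: "fourier_int g l = fourier_int f l" for l
  proof -
    have lim2: "uniform_limit period_cell (\<lambda>K x. \<Sum>k\<in>K. fmode l x * (fourier_int f k * fmode (- k) x))
        (\<lambda>x. fmode l x * g x) (finite_subsets_at_top UNIV)"
      by (rule Weierstrass_m_test_general'[OF bound2 has_sum_cmult_right[OF hs]])
        (intro summable_on_cmult_right sum1)
    obtain I J where IJ: "\<And>K. ((\<lambda>x. \<Sum>k\<in>K. fmode l x * (fourier_int f k * fmode (- k) x)) has_integral I K) period_cell"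
      "((\<lambda>x. fmode l x * g x) has_integral J) period_cell" "(I \<longlongrightarrow> J) (finite_subsets_at_top UNIV)"
      by (rule uniform_limit_integral_cbox[OF lim2]) (auto intro!: continuous_intros)
    have I: "I K = fourier_int f l" if K: "finite K" "l \<in> K" for K
    proof -
      have cont: "continuous_on UNIV (\<lambda>x. fourier_int f k * fmode (- k) x)" for k
        by (intro continuous_intros)
      have "I K = integral period_cell (\<lambda>x. \<Sum>k\<in>K. fmode l x * (fourier_int f k * fmode (- k) x))"
        using integral_unique[OF IJ(1)] by simp
      also have "\<dots> = (\<Sum>k\<in>K. integral period_cell (\<lambda>x. fmode l x * (fourier_int f k * fmode (- k) x)))"
        by (intro integral_sum K integrable_on_period_cell cont)
      also have "\<dots> = (\<Sum>k\<in>K. fourier_int (\<lambda>x. fourier_int f k * fmode (- k) x) l)"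
        by (simp only: fourier_int_def[symmetric])
      also have "\<dots> = (\<Sum>k\<in>K. if l = k then fourier_int f k else 0)"
        by (intro sum.cong refl) (simp add: fourier_int_cmult fourier_int_fmode)
      also have "\<dots> = fourier_int f l" using K by simp
      finally show ?thesis .
    qed
    have "eventually (\<lambda>K. I K = fourier_int f l) (finite_subsets_at_top UNIV)"
      unfolding eventually_finite_subsets_at_top by (intro exI[of _ "{l}"]) (simp add: I)
    then have "(I \<longlongrightarrow> fourier_int f l) (finite_subsets_at_top UNIV)"
      by (rule tendsto_eventually)
    then have "J = fourier_int f l" by (rule tendsto_unique[OF finite_subsets_at_top_neq_bot IJ(3)])
    then show ?thesis using integral_unique[OF IJ(2)] by (simp add: fourier_int_def)
  qed
  let ?h = "\<lambda>x. f x + (-1) * g x"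
  have perg: "g (x + axis i (2 * pi)) = g x" for i x
    unfolding g_def by (simp only: torus_test_periodic[OF fmode_in_torus_test])
  have cg: "continuous_on UNIV (\<lambda>x. (-1) * g x)" by (intro continuous_intros contg)
  have "?h x = 0"
  proof (rule fourier_int_zero_imp_zero)
    show "continuous_on UNIV ?h"
      by (intro continuous_intros contg torus_test_continuous_on f)
    show "?h (x + axis i (2 * pi)) = ?h x" for i x
      by (simp only: perg torus_test_periodic[OF f])
    show "fourier_int ?h k = 0" for k
      by (simp only: fourier_int_add[OF torus_test_continuous_on[OF f] cg] fourier_int_cmult fg) simp
  qed
  then have "g x = f x" by simp
  then show ?thesis using hs[of x] by simp
qed

text \<open>
  Differentiating \<open>f\<close> multiplies its coefficient by the same factor as differentiating the mode
  \<open>fmode (- k)\<close>: the Fourier series of a derivative is the series differentiated term by term.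
\<close>

lemma fourier_int_mode_partial_derivs:
  assumes f: "f \<in> torus_test"
  shows "fourier_int f k * partial_derivs is (fmode (- k)) x
       = fourier_int (partial_derivs is f) k * fmode (- k) x"
proof -
  have "\<exists>c. fourier_int (partial_derivs is f) k = c * fourier_int f k \<and>
      partial_derivs is (fmode (- k)) = (\<lambda>x. c * fmode (- k) x)"
  proof (induction "is")
    case Nil
    show ?case by (rule exI[of _ 1]) simp
  next
    case (Cons i "is")
    then obtain c where c: "fourier_int (partial_derivs is f) k = c * fourier_int f k"
      "partial_derivs is (fmode (- k)) = (\<lambda>x. c * fmode (- k) x)" by blast
    have "fourier_int (partial_derivs (i # is) f) k = (- (\<i> * of_int (k $ i)) * c) * fourier_int f k"
      using fourier_int_partial_deriv[OF torus_test_partial_derivs[OF f]] c(1) by simp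
    moreover have "partial_derivs (i # is) (fmode (- k)) = (\<lambda>x. (- (\<i> * of_int (k $ i)) * c) * fmode (- k) x)"
      using partial_derivs_cmult[OF fmode_in_torus_test, of "[i]" c "- k"]
      by (simp add: c(2) partial_deriv_fmode fun_eq_iff)
    ultimately show ?case by blast
  qed
  then show ?thesis by auto
qed

lemma is_real_distributionD:
  assumes "is_real_distribution T"
  shows "f \<in> torus_test \<Longrightarrow> g \<in> torus_test \<Longrightarrow> T (\<lambda>x. f x + g x) = T f + T g"
    and "f \<in> torus_test \<Longrightarrow> T (\<lambda>x. c * f x) = c * T f"
    and "f \<in> torus_test \<Longrightarrow> T (\<lambda>x. cnj (f x)) = cnj (T f)"
    and "f \<notin> torus_test \<Longrightarrow> T f = 0"
  using assms unfolding is_real_distribution_def by blast+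

lemma is_real_distribution_sum:
  assumes T: "is_real_distribution T" and "\<And>k. k \<in> K \<Longrightarrow> f k \<in> torus_test"
  shows "T (\<lambda>x. \<Sum>k\<in>K. f k x) = (\<Sum>k\<in>K. T (f k))"
proof -
  have zero: "T (\<lambda>x. 0) = 0"
    using is_real_distributionD(2)[OF T torus_test_zero, of 0] by simp
  show ?thesis
    using assms(2)
    by (induction K rule: infinite_finite_induct)
      (simp_all add: zero is_real_distributionD(1)[OF T] torus_test_sum)
qed

text \<open>
  The partial sums of the Fourier series of \<open>f\<close> converge uniformly to \<open>f\<close> with all
  derivatives up to the order \<open>m\<close> of the distribution: their remainders are dominated by the
  remainders of one convergent series \<open>?w\<close>.  Continuity of \<open>T\<close> carries this over to its
  values.
\<close>

lemma distribution_fourier_expansion: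
  fixes T :: "(real^'d::finite \<Rightarrow> complex) \<Rightarrow> complex"
  assumes T: "is_real_distribution T" and f: "f \<in> torus_test"
  shows "((\<lambda>k. fourier_int f k * T (fmode (- k))) has_sum T f) UNIV"
proof -
  let ?c = "fmode_scale TYPE('d)"
  let ?p = "2 * CARD('d)"
  obtain B m where B: "\<And>f M. f \<in> torus_test \<Longrightarrow>
      (\<forall>is x. length is \<le> m \<longrightarrow> cmod (partial_derivs is f x) \<le> M) \<Longrightarrow> cmod (T f) \<le> B * M"
    using T unfolding is_real_distribution_def by blast
  obtain C where C: "0 \<le> C" "\<And>k. cmod (fourier_int f k) \<le> C / freq k ^ (m + ?p)"
    using fourier_int_rapid_decay[OF f, where p = "m + ?p"] by blast
  let ?w = "\<lambda>k::int^'d. C * ?c * (1 / freq k ^ ?p)"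
  have sw: "?w summable_on UNIV" by (intro summable_on_cmult_right summable_freq)
  have term_le: "cmod (fourier_int (partial_derivs is f) k * fmode (- k) x) \<le> ?w k"
    if "length is \<le> m" for "is" k x
  proof -
    have "cmod (fourier_int (partial_derivs is f) k) \<le> norm (rvec k) ^ length is * cmod (fourier_int f k)"
      by (rule norm_fourier_int_partial_derivs_le[OF f])
    also have "\<dots> \<le> freq k ^ length is * cmod (fourier_int f k)"
      by (intro mult_right_mono power_mono norm_rvec_le_freq) auto
    also have "\<dots> \<le> freq k ^ m * cmod (fourier_int f k)"
      using that by (intro mult_right_mono power_increasing) auto
    also have "\<dots> \<le> freq k ^ m * (C / freq k ^ (m + ?p))"
      using C(2) by (intro mult_left_mono zero_le_power less_imp_le[OF freq_pos])
    also have "\<dots> = C * (1 / freq k ^ ?p)"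
      using freq_pos[of k] by (simp add: power_add)
    finally have "cmod (fourier_int (partial_derivs is f) k) * ?c \<le> C * (1 / freq k ^ ?p) * ?c"
      by (rule mult_right_mono) simp
    then show ?thesis by (simp add: norm_mult norm_fmode mult_ac)
  qed
  have est: "cmod (T f - (\<Sum>k\<in>K. fourier_int f k * T (fmode (- k)))) \<le> B * (infsum ?w UNIV - sum ?w K)"
    if K: "finite K" for K
  proof -
    let ?s = "\<lambda>x. \<Sum>k\<in>K. fourier_int f k * fmode (- k) x"
    let ?g = "\<lambda>x. f x + (-1) * ?s x"
    have tt: "(\<lambda>x. fourier_int f k * fmode (- k) x) \<in> torus_test" for k
      by (intro torus_test_cmult fmode_in_torus_test)
    have s: "?s \<in> torus_test" by (rule torus_test_sum[OF tt])
    have ms: "(\<lambda>x. (-1) * ?s x) \<in> torus_test" by (rule torus_test_cmult[OF s])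
    have g: "?g \<in> torus_test" by (rule torus_test_add[OF f ms])
    have "cmod (partial_derivs is ?g x) \<le> infsum ?w UNIV - sum ?w K" if "is": "length is \<le> m" for "is" x
    proof -
      let ?t = "\<lambda>k. fourier_int (partial_derivs is f) k * fmode (- k) x"
      have 1: "partial_derivs is ?g x = partial_derivs is f x - sum ?t K"
        by (simp only: partial_derivs_add[OF f ms] partial_derivs_cmult[OF s] partial_derivs_sum[OF tt]
            partial_derivs_cmult[OF fmode_in_torus_test] fourier_int_mode_partial_derivs[OF f]) simp
      have 2: "(?t has_sum (partial_derivs is f x - sum ?t K)) (UNIV - K)"
        by (intro has_sum_Diff fourier_inversion torus_test_partial_derivs f has_sum_finite K) auto
      have 3: "(?w has_sum (infsum ?w UNIV - sum ?w K)) (UNIV - K)"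
        by (intro has_sum_Diff has_sum_infsum sw has_sum_finite K) auto
      show ?thesis unfolding 1
        by (rule norm_infsum_le[OF 2 3]) (rule term_le[OF "is"])
    qed
    then have "cmod (T ?g) \<le> B * (infsum ?w UNIV - sum ?w K)" by (intro B[OF g]) blast
    moreover have "T ?g = T f - (\<Sum>k\<in>K. fourier_int f k * T (fmode (- k)))"
      by (simp only: is_real_distributionD(1)[OF T f ms] is_real_distributionD(2)[OF T s]
          is_real_distribution_sum[OF T tt] is_real_distributionD(2)[OF T fmode_in_torus_test]) simp
    ultimately show ?thesis by simp
  qed
  have "((\<lambda>K. B * (infsum ?w UNIV - sum ?w K)) \<longlongrightarrow> B * (infsum ?w UNIV - infsum ?w UNIV)) (finite_subsets_at_top UNIV)"
    by (intro tendsto_intros infsum_tendsto sw)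
  then have lim0: "((\<lambda>K. B * (infsum ?w UNIV - sum ?w K)) \<longlongrightarrow> 0) (finite_subsets_at_top UNIV)" by simp
  have "((\<lambda>K. T f - (\<Sum>k\<in>K. fourier_int f k * T (fmode (- k)))) \<longlongrightarrow> 0) (finite_subsets_at_top UNIV)"
    by (rule Lim_null_comparison[OF _ lim0])
      (rule eventually_finite_subsets_at_top_weakI, rule est)
  then have "((\<lambda>K. T f - (T f - (\<Sum>k\<in>K. fourier_int f k * T (fmode (- k))))) \<longlongrightarrow> T f - 0) (finite_subsets_at_top UNIV)"
    by (intro tendsto_intros)
  then show ?thesis by (simp add: has_sum_def)
qed

section \<open>Vector fields and their Fourier coefficients\<close>

lemma pairing_is_real_distribution: "is_real_distribution (pairing T)"
  using pairing[of T] by simp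

lemma fcoeff_expansion:
  assumes "f \<in> torus_test"
  shows "((\<lambda>k. fcoeff v k $ r * fourier_int f k) has_sum pairing (v $ r) f) UNIV"
  using distribution_fourier_expansion[OF pairing_is_real_distribution assms, of "v $ r"]
  by (simp add: fcoeff_def mult.commute)

lemma vfield_eqI:
  assumes "\<And>r f. f \<in> torus_test \<Longrightarrow> pairing (v $ r) f = pairing (w $ r) f"
  shows "v = w"
proof -
  have "pairing (v $ r) f = pairing (w $ r) f" for r f
    by (cases "f \<in> torus_test")
      (simp_all add: assms is_real_distributionD(4)[OF pairing_is_real_distribution])
  then show ?thesis by (simp add: vec_eq_iff fun_eq_iff flip: pairing_inject)
qed

lemma fcoeff_inject: "fcoeff v = fcoeff w \<longleftrightarrow> v = w"
proof
  assume eq: "fcoeff v = fcoeff w"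
  show "v = w"
  proof (rule vfield_eqI)
    fix r and f :: "real^'a \<Rightarrow> complex" assume f: "f \<in> torus_test"
    show "pairing (v $ r) f = pairing (w $ r) f"
      using fcoeff_expansion[OF f, of v r] fcoeff_expansion[OF f, of w r]
      unfolding eq by (rule has_sum_unique)
  qed
qed simp

lemma fcoeff_add: "fcoeff (v + w) k = fcoeff v k + fcoeff w k"
  by (simp add: fcoeff_def vec_eq_iff plus_distr.rep_eq)

lemma fcoeff_diff: "fcoeff (v - w) k = fcoeff v k - fcoeff w k"
  by (simp add: fcoeff_def vec_eq_iff minus_distr.rep_eq)

lemma fcoeff_scaleR: "fcoeff (a *\<^sub>R v) k = a *\<^sub>R fcoeff v k"
  by (simp add: fcoeff_def vec_eq_iff scaleR_distr.rep_eq)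

lemma fcoeff_zero: "fcoeff 0 k = 0"
  by (simp add: fcoeff_def vec_eq_iff zero_distr.rep_eq)

lemma fcoeff_uminus_freq: "fcoeff v (- k) $ r = cnj (fcoeff v k $ r)"
proof -
  have "fmode k = (\<lambda>x. cnj (fmode (- k) x))" by (simp add: cnj_fmode)
  then show ?thesis
    using is_real_distributionD(3)[OF pairing_is_real_distribution fmode_in_torus_test, of "v $ r" "- k"]
    by (simp add: fcoeff_def)
qed

text \<open>
  Coefficients of polynomial growth are summable against the rapidly decreasing coefficients of
  a test function, with a bound by finitely many derivatives; so they define a distribution,
  which is real by the symmetry of the coefficients.
\<close>

lemma ex_distribution_with_coefficients:
  fixes a :: "int^'d::finite \<Rightarrow> complex"
  assumes growth: "\<And>k. cmod (a k) \<le> C * freq k ^ p" and real: "\<And>k. a (- k) = cnj (a k)"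
  obtains T where "is_real_distribution T"
    "\<And>f. f \<in> torus_test \<Longrightarrow> ((\<lambda>k. a k * fourier_int f k) has_sum T f) UNIV"
proof -
  let ?q = "2 * CARD('d)"
  let ?w = "\<lambda>k::int^'d. 1 / freq k ^ ?q"
  define W where "W = infsum ?w UNIV"
  define T where "T f = (if f \<in> torus_test then \<Sum>\<^sub>\<infinity>k. a k * fourier_int f k else 0)" for f
  have C0: "0 \<le> C"
    using order_trans[OF norm_ge_zero growth[of 0]] by (simp add: freq_def)
  have term_le: "cmod (a k * fourier_int f k) \<le> (C * D) * ?w k"
    if D: "cmod (fourier_int f k) \<le> D / freq k ^ (p + ?q)" for f k D
  proof -
    have "cmod (a k * fourier_int f k) \<le> (C * freq k ^ p) * (D / freq k ^ (p + ?q))"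
      unfolding norm_mult using C0 less_imp_le[OF freq_pos[of k]] by (intro mult_mono growth D) simp_all
    also have "\<dots> = (C * D) * ?w k" using freq_pos[of k] by (simp add: power_add)
    finally show ?thesis .
  qed
  have sw: "(\<lambda>k. c * ?w k) summable_on UNIV" for c by (intro summable_on_cmult_right summable_freq)
  have summ: "(\<lambda>k. a k * fourier_int f k) summable_on UNIV" if f: "f \<in> torus_test" for f
  proof -
    obtain D where D: "0 \<le> D" "\<And>k. cmod (fourier_int f k) \<le> D / freq k ^ (p + ?q)"
      using fourier_int_rapid_decay[OF f, where p = "p + ?q"] by blast
    show ?thesis
      by (rule abs_summable_summable[OF Infinite_Sum.abs_summable_on_comparison_test'[OF sw]]) (rule term_le[OF D(2)])
  qed
  have T: "((\<lambda>k. a k * fourier_int f k) has_sum T f) UNIV" if f: "f \<in> torus_test" for f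
    using summ[OF f] f by (simp add: T_def)
  have bound: "cmod (T f) \<le> (C * decay_const TYPE('d) (p + ?q) * W) * M"
    if f: "f \<in> torus_test" and M: "\<forall>is x. length is \<le> p + ?q \<longrightarrow> cmod (partial_derivs is f x) \<le> M" for f M
  proof -
    let ?D = "decay_const TYPE('d) (p + ?q) * M"
    have D: "cmod (fourier_int f k) \<le> ?D / freq k ^ (p + ?q)" for k
      using fourier_int_freq_decay[OF f, of "p + ?q" M k] M by simp
    have "cmod (T f) \<le> (C * ?D) * W"
      unfolding W_def
      by (rule norm_infsum_le[OF T[OF f] has_sum_cmult_right[OF has_sum_infsum[OF summable_freq]]])
        (rule term_le[OF D])
    then show ?thesis by (simp add: mult_ac)
  qed
  have "is_real_distribution T"
    unfolding is_real_distribution_def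
  proof (intro conjI ballI allI)
    fix f g :: "real^'d \<Rightarrow> complex" assume f: "f \<in> torus_test" and g: "g \<in> torus_test"
    have "((\<lambda>k. a k * fourier_int (\<lambda>x. f x + g x) k) has_sum T f + T g) UNIV"
      using has_sum_add[OF T[OF f] T[OF g]]
      by (simp add: fourier_int_add[OF torus_test_continuous_on[OF f] torus_test_continuous_on[OF g]] distrib_left)
    then show "T (\<lambda>x. f x + g x) = T f + T g"
      by (rule has_sum_unique[OF T[OF torus_test_add[OF f g]]])
  next
    fix f :: "real^'d \<Rightarrow> complex" and c assume f: "f \<in> torus_test"
    have "((\<lambda>k. a k * fourier_int (\<lambda>x. c * f x) k) has_sum c * T f) UNIV"
      using has_sum_cmult_right[OF T[OF f], of c] by (simp add: fourier_int_cmult mult.left_commute)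
    then show "T (\<lambda>x. c * f x) = c * T f"
      by (rule has_sum_unique[OF T[OF torus_test_cmult[OF f]]])
  next
    show "\<exists>C m. \<forall>f\<in>torus_test. \<forall>M. (\<forall>is x. length is \<le> m \<longrightarrow> cmod (partial_derivs is f x) \<le> M) \<longrightarrow> cmod (T f) \<le> C * M"
      by (intro exI ballI allI impI) (rule bound)
  next
    fix f :: "real^'d \<Rightarrow> complex" assume f: "f \<in> torus_test"
    have "((\<lambda>k. cnj (a k * fourier_int f k)) has_sum cnj (T f)) UNIV"
      by (simp only: has_sum_cnj_iff T[OF f])
    then have "((\<lambda>k. cnj (a k * fourier_int f k)) has_sum cnj (T f)) (uminus ` UNIV)"
      by simp
    then have "((\<lambda>k. cnj (a k * fourier_int f k)) \<circ> uminus has_sum cnj (T f)) UNIV"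
      by (subst (asm) has_sum_reindex) (auto simp: inj_on_def)
    then have "((\<lambda>k. a k * fourier_int (\<lambda>x. cnj (f x)) k) has_sum cnj (T f)) UNIV"
      by (simp add: o_def real fourier_int_cnj)
    then show "T (\<lambda>x. cnj (f x)) = cnj (T f)"
      by (rule has_sum_unique[OF T[OF torus_test_cnj[OF f]]])
  next
    fix f :: "real^'d \<Rightarrow> complex"
    show "f \<notin> torus_test \<longrightarrow> T f = 0" by (simp add: T_def)
  qed
  then show thesis using T by (rule that)
qed

text \<open>
  The distributions defined by the components of \<open>c\<close> satisfy the condition in the definition of
  \<open>fseries\<close>, and their coefficients are read off from the orthogonality of the modes.
\<close>

lemma fcoeff_fseries:
  fixes c :: "int^'d::finite \<Rightarrow> complex^'d"
  assumes growth: "\<And>k. norm (c k) \<le> C * freq k ^ p"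
    and real: "\<And>k r. c (- k) $ r = cnj (c k $ r)"
  shows "fcoeff (fseries c) = c"
proof -
  let ?P = "\<lambda>v. \<forall>r. \<forall>f\<in>torus_test. ((\<lambda>k. c k $ r * fourier_int f k) has_sum pairing (v $ r) f) UNIV"
  have "\<forall>r. \<exists>T. is_real_distribution T \<and> (\<forall>f\<in>torus_test. ((\<lambda>k. c k $ r * fourier_int f k) has_sum T f) UNIV)"
  proof
    fix r
    have "cmod (c k $ r) \<le> C * freq k ^ p" for k
      by (rule order_trans[OF Finite_Cartesian_Product.norm_nth_le growth])
    then obtain T where "is_real_distribution T"
      "\<And>f. f \<in> torus_test \<Longrightarrow> ((\<lambda>k. c k $ r * fourier_int f k) has_sum T f) UNIV"
      using ex_distribution_with_coefficients[of "\<lambda>k. c k $ r", OF _ real] by blast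
    then show "\<exists>T. is_real_distribution T \<and> (\<forall>f\<in>torus_test. ((\<lambda>k. c k $ r * fourier_int f k) has_sum T f) UNIV)"
      by blast
  qed
  from choice[OF this] obtain T where "\<forall>r. is_real_distribution (T r) \<and>
    (\<forall>f\<in>torus_test. ((\<lambda>k. c k $ r * fourier_int f k) has_sum T r f) UNIV)" ..
  then have T: "\<And>r. is_real_distribution (T r)"
    "\<And>r f. f \<in> torus_test \<Longrightarrow> ((\<lambda>k. c k $ r * fourier_int f k) has_sum T r f) UNIV"
    by simp_all
  define v :: "'d vfield" where "v = (\<chi> r. Abs_distr (T r))"
  have v: "pairing (v $ r) = T r" for r by (simp add: v_def Abs_distr_inverse T(1))
  have P: "?P v" using T(2) by (simp add: v)
  have uniq: "w = v" if "?P w" for w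
  proof (rule vfield_eqI)
    fix r and f :: "real^'d \<Rightarrow> complex" assume f: "f \<in> torus_test"
    show "pairing (w $ r) f = pairing (v $ r) f"
      by (rule has_sum_unique[OF that[rule_format, OF f] P[rule_format, OF f]])
  qed
  have fs: "fseries c = v"
    unfolding fseries_def fourier_int_def[symmetric] by (rule the_equality[of ?P, OF P uniq])
  have "fcoeff v l $ r = c l $ r" for l r
  proof -
    have "((\<lambda>k. c k $ r * fourier_int (fmode (- l)) k) has_sum pairing (v $ r) (fmode (- l))) UNIV"
      using P fmode_in_torus_test by blast
    then have "((\<lambda>k. if k = l then c l $ r else 0) has_sum pairing (v $ r) (fmode (- l))) UNIV"
      by (simp add: fourier_int_fmode if_distrib cong: if_cong has_sum_cong)
    moreover have "((\<lambda>k. if k = l then c l $ r else 0) has_sum c l $ r) UNIV"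
    proof -
      have "((\<lambda>k. c l $ r) has_sum c l $ r) {l}" by (rule has_sum_finiteI) simp_all
      then show ?thesis by (subst has_sum_cong_neutral[where T = "{l}"]) auto
    qed
    ultimately have "pairing (v $ r) (fmode (- l)) = c l $ r" by (rule has_sum_unique)
    then show ?thesis by (simp add: fcoeff_def)
  qed
  then show ?thesis by (simp add: fs fun_eq_iff vec_eq_iff)
qed

section \<open>Fourier multipliers\<close>

text \<open>
  Used to see that the coefficients of a distribution grow at most polynomially: a distribution is
  bounded by finitely many derivatives, and each derivative of a mode costs one factor of the
  frequency.
\<close>

lemma norm_partial_derivs_fmode_le:
  "cmod (partial_derivs is (fmode k) x) \<le> fmode_scale TYPE('d::finite) * freq (k :: int^'d) ^ length is"
proof -
  have "\<exists>c. partial_derivs is (fmode k) = (\<lambda>x. c * fmode k x) \<and> cmod c \<le> freq k ^ length is"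
  proof (induction "is")
    case Nil
    show ?case by (rule exI[of _ 1]) simp
  next
    case (Cons i "is")
    then obtain c where c: "partial_derivs is (fmode k) = (\<lambda>x. c * fmode k x)" "cmod c \<le> freq k ^ length is"
      by blast
    have "\<bar>rvec k $ i\<bar> \<le> freq k"
      by (rule order_trans[OF component_le_norm_cart norm_rvec_le_freq])
    then have "cmod (c * (\<i> * of_int (k $ i))) \<le> freq k ^ length is * freq k"
      unfolding norm_mult using c(2) less_imp_le[OF freq_pos[of k]] by (intro mult_mono) simp_all
    moreover have "partial_derivs (i # is) (fmode k) = (\<lambda>x. (c * (\<i> * of_int (k $ i))) * fmode k x)"
      using partial_derivs_cmult[OF fmode_in_torus_test, of "[i]" c k]
      by (simp add: c(1) partial_deriv_fmode mult.assoc)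
    ultimately show ?case
      by (intro exI[of _ "c * (\<i> * of_int (k $ i))"] conjI) (assumption, simp only: list.size power_Suc2 add_0_right add_Suc_right)
  qed
  then obtain c where c: "partial_derivs is (fmode k) = (\<lambda>x. c * fmode k x)" "cmod c \<le> freq k ^ length is"
    by blast
  then show ?thesis
    using mult_right_mono[OF c(2), of "fmode_scale TYPE('d)"]
    by (simp add: norm_mult norm_fmode mult.commute)
qed

lemma distribution_mode_growth:
  fixes T :: "(real^'d::finite \<Rightarrow> complex) \<Rightarrow> complex"
  assumes "is_real_distribution T"
  obtains C p where "0 \<le> C" "\<And>k. cmod (T (fmode (- k))) \<le> C * freq k ^ p"
proof -
  obtain B m where B: "\<And>f M. f \<in> torus_test \<Longrightarrow>
      (\<forall>is x. length is \<le> m \<longrightarrow> cmod (partial_derivs is f x) \<le> M) \<Longrightarrow> cmod (T f) \<le> B * M"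
    using assms unfolding is_real_distribution_def by blast
  have growth: "cmod (T (fmode (- k))) \<le> \<bar>B\<bar> * fmode_scale TYPE('d) * freq k ^ m" for k
  proof -
    have "cmod (partial_derivs is (fmode (- k)) x) \<le> fmode_scale TYPE('d) * freq k ^ m"
      if "length is \<le> m" for "is" x
    proof -
      have "freq k ^ length is \<le> freq k ^ m" using that by (intro power_increasing) simp_all
      then have "fmode_scale TYPE('d) * freq k ^ length is \<le> fmode_scale TYPE('d) * freq k ^ m"
        by (rule mult_left_mono) simp
      then show ?thesis
        by (rule order_trans[rotated]) (use norm_partial_derivs_fmode_le[of "is" "- k" x] in simp)
    qed
    then have "cmod (T (fmode (- k))) \<le> B * (fmode_scale TYPE('d) * freq k ^ m)"
      by (intro B[OF fmode_in_torus_test]) simp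
    also have "\<dots> \<le> \<bar>B\<bar> * (fmode_scale TYPE('d) * freq k ^ m)"
      using less_imp_le[OF freq_pos[of k]] by (intro mult_right_mono) simp_all
    finally show ?thesis by (simp add: mult.assoc)
  qed
  show thesis
    by (rule that[of "\<bar>B\<bar> * fmode_scale TYPE('d)" m]) (simp, rule growth)
qed

lemma fcoeff_growth:
  fixes v :: "('d::finite) vfield"
  obtains C p where "0 \<le> C" "\<And>k. norm (fcoeff v k) \<le> C * freq k ^ p"
proof -
  have "\<forall>r. \<exists>Cp. 0 \<le> fst Cp \<and> (\<forall>k. cmod (fcoeff v k $ r) \<le> fst Cp * freq k ^ snd Cp)"
  proof
    fix r
    obtain C p where "0 \<le> C" "\<And>k. cmod (pairing (v $ r) (fmode (- k))) \<le> C * freq k ^ p"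
      by (rule distribution_mode_growth[OF pairing_is_real_distribution, of "v $ r"]) blast
    then show "\<exists>Cp. 0 \<le> fst Cp \<and> (\<forall>k. cmod (fcoeff v k $ r) \<le> fst Cp * freq k ^ snd Cp)"
      by (intro exI[of _ "(C, p)"]) (simp add: fcoeff_def)
  qed
  from choice[OF this] obtain g
    where g: "\<forall>r. 0 \<le> fst (g r) \<and> (\<forall>k. cmod (fcoeff v k $ r) \<le> fst (g r) * freq k ^ snd (g r))" ..
  define p where "p = Max (range (snd \<circ> g))"
  have growth: "norm (fcoeff v k) \<le> (\<Sum>r\<in>UNIV. fst (g r)) * freq k ^ p" for k
  proof -
    have "norm (fcoeff v k) \<le> (\<Sum>r\<in>UNIV. cmod (fcoeff v k $ r))"
      unfolding norm_vec_def by (rule L2_set_le_sum) simp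
    also have "\<dots> \<le> (\<Sum>r\<in>UNIV. fst (g r) * freq k ^ p)"
    proof (rule sum_mono)
      fix r
      have "snd (g r) \<le> p" unfolding p_def by (rule Max_ge) simp_all
      then have "freq k ^ snd (g r) \<le> freq k ^ p" by (intro power_increasing) simp_all
      then have "fst (g r) * freq k ^ snd (g r) \<le> fst (g r) * freq k ^ p"
        using g by (intro mult_left_mono) simp_all
      with g[rule_format, THEN conjunct2, rule_format] show "cmod (fcoeff v k $ r) \<le> fst (g r) * freq k ^ p"
        by (rule order_trans)
    qed
    finally show ?thesis by (simp add: sum_distrib_right)
  qed
  show thesis
  proof (rule that)
    show "0 \<le> (\<Sum>r\<in>UNIV. fst (g r))" using g by (intro sum_nonneg) simp
  qed (rule growth)
qed

text \<open>
  The products have polynomial growth again, and an even real symbol preserves the symmetry of the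
  coefficients; so they are the coefficients of their series.
\<close>

lemma fcoeff_multiplier:
  fixes m :: "int^'d::finite \<Rightarrow> real"
  assumes m: "\<And>k. \<bar>m k\<bar> \<le> D * freq k ^ q" and even: "\<And>k. m (- k) = m k"
  shows "fcoeff (fseries (\<lambda>k. m k *\<^sub>R fcoeff v k)) k = m k *\<^sub>R fcoeff v k"
proof -
  obtain C p where C: "0 \<le> C" "\<And>k. norm (fcoeff v k) \<le> C * freq k ^ p" by (rule fcoeff_growth[of v]) blast
  have "norm (m k *\<^sub>R fcoeff v k) \<le> (D * C) * freq k ^ (q + p)" for k
  proof -
    have "norm (m k *\<^sub>R fcoeff v k) \<le> (D * freq k ^ q) * (C * freq k ^ p)"
      unfolding norm_scaleR by (rule mult_mono[OF m C(2)]) (use order_trans[OF abs_ge_zero m] in simp_all)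
    then show ?thesis by (simp add: power_add mult_ac)
  qed
  then have "fcoeff (fseries (\<lambda>k. m k *\<^sub>R fcoeff v k)) = (\<lambda>k. m k *\<^sub>R fcoeff v k)"
    by (rule fcoeff_fseries) (simp add: even fcoeff_uminus_freq)
  then show ?thesis by simp
qed

lemma fcoeff_heat:
  assumes "0 \<le> t"
  shows "fcoeff (heat t v) k = exp (- t * (norm (rvec k))\<^sup>2) *\<^sub>R fcoeff v k"
  unfolding heat_def
  by (rule fcoeff_multiplier[where D = 1 and q = 0]) (simp_all add: assms rvec_uminus)

lemma fcoeff_laplacian: "fcoeff (laplacian v) k = - ((norm (rvec k))\<^sup>2 *\<^sub>R fcoeff v k)"
proof -
  have "fcoeff (fseries (\<lambda>k. (- (norm (rvec k))\<^sup>2) *\<^sub>R fcoeff v k)) k = (- (norm (rvec k))\<^sup>2) *\<^sub>R fcoeff v k"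
    by (rule fcoeff_multiplier[where D = 1 and q = 2])
      (simp_all add: rvec_uminus norm_rvec_le_freq power_mono)
  then show ?thesis by (simp add: laplacian_def)
qed

lemma vfield_fcoeff_eqI: "(\<And>k. fcoeff v k = fcoeff w k) \<Longrightarrow> v = w"
  by (simp add: fun_eq_iff flip: fcoeff_inject)

lemma heat_zero: "heat 0 v = v"
  by (rule vfield_fcoeff_eqI) (simp add: fcoeff_heat)

lemma heat_add_time: "0 \<le> s \<Longrightarrow> 0 \<le> t \<Longrightarrow> heat (s + t) v = heat s (heat t v)"
proof (rule vfield_fcoeff_eqI)
  fix k assume st: "0 \<le> s" "0 \<le> t"
  have "exp (- (s + t) * a) = exp (- s * a) * exp (- t * a)" for a :: real
    by (simp add: algebra_simps flip: exp_add)
  then show "fcoeff (heat (s + t) v) k = fcoeff (heat s (heat t v)) k"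
    by (simp only: fcoeff_heat st add_nonneg_nonneg scaleR_scaleR)
qed

lemma heat_add: "0 \<le> t \<Longrightarrow> heat t (v + w) = heat t v + heat t w"
  by (rule vfield_fcoeff_eqI) (simp add: fcoeff_heat fcoeff_add scaleR_add_right)

lemma heat_diff: "0 \<le> t \<Longrightarrow> heat t (v - w) = heat t v - heat t w"
  by (rule vfield_fcoeff_eqI) (simp add: fcoeff_heat fcoeff_diff scaleR_diff_right)

lemma heat_scaleR: "0 \<le> t \<Longrightarrow> heat t (a *\<^sub>R v) = a *\<^sub>R heat t v"
  by (rule vfield_fcoeff_eqI) (simp add: fcoeff_heat fcoeff_scaleR)

lemma laplacian_add: "laplacian (v + w) = laplacian v + laplacian w"
  by (rule vfield_fcoeff_eqI) (simp add: fcoeff_laplacian fcoeff_add scaleR_add_right)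

lemma laplacian_scaleR: "laplacian (a *\<^sub>R v) = a *\<^sub>R laplacian v"
  by (rule vfield_fcoeff_eqI) (simp add: fcoeff_laplacian fcoeff_scaleR)

section \<open>The Sobolev norms as \<open>\<ell>\<^sup>2\<close> norms\<close>

text \<open>
  The numbers whose squares are summed in the Sobolev norm.  At \<open>k = 0\<close> the weight
  \<open>0 powr n\<close> is 0 for every \<open>n\<close>, so that sums over all frequencies and over the nonzero
  ones agree.
\<close>

definition sob_amp :: "real \<Rightarrow> ('d::finite) vfield \<Rightarrow> int^'d \<Rightarrow> real" where
  "sob_amp n v k = norm (rvec k) powr n * norm (fcoeff v k)"

lemma sob_amp_nonneg [simp]: "0 \<le> sob_amp n v k"
  by (simp add: sob_amp_def)

lemma sob_amp_zero_freq [simp]: "sob_amp n v 0 = 0"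
  by (simp add: sob_amp_def)

lemma sob_amp_square: "(sob_amp n v k)\<^sup>2 = norm (rvec k) powr (2 * n) * (norm (fcoeff v k))\<^sup>2"
  unfolding sob_amp_def power2_eq_square mult_2 powr_add by (simp only: ac_simps)

lemma Sob0_iff: "v \<in> Sob0 n \<longleftrightarrow> fcoeff v 0 = 0 \<and> (\<lambda>k. (sob_amp n v k)\<^sup>2) summable_on UNIV"
proof -
  have "(\<lambda>k. (sob_amp n v k)\<^sup>2) summable_on UNIV \<longleftrightarrow> (\<lambda>k. (sob_amp n v k)\<^sup>2) summable_on {k. k \<noteq> 0}"
    by (rule summable_on_cong_neutral) auto
  then show ?thesis by (simp add: Sob0_def sob_amp_square)
qed

lemma Sob_norm_eq: "Sob_norm n v = sqrt (\<Sum>\<^sub>\<infinity>k. (sob_amp n v k)\<^sup>2)"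
proof -
  have "(\<Sum>\<^sub>\<infinity>k. (sob_amp n v k)\<^sup>2) = (\<Sum>\<^sub>\<infinity>k\<in>{k. k \<noteq> 0}. (sob_amp n v k)\<^sup>2)"
    by (rule infsum_cong_neutral) auto
  then show ?thesis by (simp add: Sob_norm_def sob_amp_square)
qed

lemma Sob_norm_nonneg [simp]: "0 \<le> Sob_norm n v"
  by (simp add: Sob_norm_eq infsum_nonneg)

lemma L2_set_le_Sob_norm:
  assumes "v \<in> Sob0 n" "finite K"
  shows "L2_set (sob_amp n v) K \<le> Sob_norm n v"
  unfolding L2_set_def Sob_norm_eq
  using assms by (intro real_sqrt_le_mono finite_sum_le_infsum) (simp_all add: Sob0_iff)

lemma sob_amp_le_Sob_norm: "v \<in> Sob0 n \<Longrightarrow> sob_amp n v k \<le> Sob_norm n v"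
  using L2_set_le_Sob_norm[of v n "{k}"] by (simp add: L2_set_insert)

text \<open>
  Bounds on finite sections give membership and norm at once, so that the triangle inequality,
  domination and completeness reduce to the Euclidean norms \<open>L2_set\<close>.
\<close>

lemma Sob0I_L2_set:
  assumes "fcoeff v 0 = 0" and le: "\<And>K. finite K \<Longrightarrow> L2_set (sob_amp n v) K \<le> B"
  shows "v \<in> Sob0 n" "Sob_norm n v \<le> B"
proof -
  have B0: "0 \<le> B" using le[of "{}"] by simp
  have sq: "(\<Sum>k\<in>K. (sob_amp n v k)\<^sup>2) \<le> B\<^sup>2" if "finite K" for K
    using le[OF that] B0 unfolding L2_set_def by (simp add: real_sqrt_le_iff' sqrt_le_D)
  have summ: "(\<lambda>k. (sob_amp n v k)\<^sup>2) summable_on UNIV"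
    by (rule nonneg_bdd_above_summable_on) (auto intro!: bdd_aboveI2[where M = "B\<^sup>2"] sq)
  then show "v \<in> Sob0 n" using assms(1) by (simp add: Sob0_iff)
  have "(\<Sum>\<^sub>\<infinity>k. (sob_amp n v k)\<^sup>2) \<le> B\<^sup>2"
    by (rule infsum_le_finite_sums[OF summ]) (rule sq)
  then show "Sob_norm n v \<le> B" unfolding Sob_norm_eq using B0 by (simp add: real_le_lsqrt)
qed

lemma Sob0_dominated:
  assumes "v \<in> Sob0 n" "fcoeff u 0 = 0" "0 \<le> C"
    and le: "\<And>k. k \<noteq> 0 \<Longrightarrow> sob_amp n' u k \<le> C * sob_amp n v k"
  shows "u \<in> Sob0 n'" "Sob_norm n' u \<le> C * Sob_norm n v"
proof -
  have le': "sob_amp n' u k \<le> C * sob_amp n v k" for k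
    using le by (cases "k = 0") simp_all
  have "L2_set (sob_amp n' u) K \<le> C * Sob_norm n v" if "finite K" for K
  proof -
    have "L2_set (sob_amp n' u) K \<le> L2_set (\<lambda>k. C * sob_amp n v k) K"
      by (rule L2_set_mono) (simp_all add: le')
    also have "\<dots> = C * L2_set (sob_amp n v) K" using assms(3) by (simp add: L2_set_right_distrib)
    also have "\<dots> \<le> C * Sob_norm n v"
      using L2_set_le_Sob_norm[OF assms(1) that] assms(3) by (rule mult_left_mono)
    finally show ?thesis .
  qed
  then show "u \<in> Sob0 n'" "Sob_norm n' u \<le> C * Sob_norm n v"
    using Sob0I_L2_set[OF assms(2)] by blast+
qed

lemma sob_amp_add_le: "sob_amp n (v + w) k \<le> sob_amp n v k + sob_amp n w k"
  by (simp add: sob_amp_def fcoeff_add norm_triangle_ineq mult_left_mono flip: distrib_left)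

lemma sob_amp_scaleR: "sob_amp n (a *\<^sub>R v) k = \<bar>a\<bar> * sob_amp n v k"
  by (simp add: sob_amp_def fcoeff_scaleR)

lemma Sob0_add:
  assumes "v \<in> Sob0 n" "w \<in> Sob0 n"
  shows "v + w \<in> Sob0 n" "Sob_norm n (v + w) \<le> Sob_norm n v + Sob_norm n w"
proof -
  have "fcoeff (v + w) 0 = 0" using assms by (simp add: Sob0_iff fcoeff_add)
  moreover have "L2_set (sob_amp n (v + w)) K \<le> Sob_norm n v + Sob_norm n w" if "finite K" for K
  proof -
    have "L2_set (sob_amp n (v + w)) K \<le> L2_set (\<lambda>k. sob_amp n v k + sob_amp n w k) K"
      by (rule L2_set_mono) (simp_all add: sob_amp_add_le)
    also have "\<dots> \<le> L2_set (sob_amp n v) K + L2_set (sob_amp n w) K" by (rule L2_set_triangle_ineq)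
    also have "\<dots> \<le> Sob_norm n v + Sob_norm n w"
      by (intro add_mono L2_set_le_Sob_norm assms that)
    finally show ?thesis .
  qed
  ultimately show "v + w \<in> Sob0 n" "Sob_norm n (v + w) \<le> Sob_norm n v + Sob_norm n w"
    using Sob0I_L2_set by blast+
qed

lemma Sob_norm_scaleR: "Sob_norm n (a *\<^sub>R v) = \<bar>a\<bar> * Sob_norm n v"
  by (simp add: Sob_norm_eq sob_amp_scaleR power_mult_distrib infsum_cmult_right' real_sqrt_mult)

lemma Sob0_scaleR: "v \<in> Sob0 n \<Longrightarrow> a *\<^sub>R v \<in> Sob0 n"
  by (simp add: Sob0_iff fcoeff_scaleR sob_amp_scaleR power_mult_distrib summable_on_cmult_right)

definition divergence_free :: "('d::finite) vfield \<Rightarrow> bool" where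
  "divergence_free v \<longleftrightarrow> (\<forall>k. (\<Sum>r\<in>UNIV. of_int (k $ r) * fcoeff v k $ r) = 0)"

lemma SobS0_iff: "v \<in> SobS0 n \<longleftrightarrow> v \<in> Sob0 n \<and> divergence_free v"
  by (simp add: SobS0_def divergence_free_def)

lemma divergence_free_multiplier:
  assumes "divergence_free v" and "\<And>k. fcoeff u k = m k *\<^sub>R fcoeff v k"
  shows "divergence_free u"
  unfolding divergence_free_def
proof
  fix k
  have "(\<Sum>r\<in>UNIV. of_int (k $ r) * fcoeff u k $ r) = of_real (m k) * (\<Sum>r\<in>UNIV. of_int (k $ r) * fcoeff v k $ r)"
    by (simp add: assms(2) sum_distrib_left scaleR_conv_of_real[of _ "_ :: complex"] mult.left_commute)
  then show "(\<Sum>r\<in>UNIV. of_int (k $ r) * fcoeff u k $ r) = 0"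
    using assms(1) by (simp add: divergence_free_def)
qed

lemma subspace_SobS0: "subspace (SobS0 n :: ('d::finite) vfield set)"
proof (rule subspaceI)
  have "(0 :: 'd vfield) \<in> Sob0 n"
    by (simp add: Sob0_iff fcoeff_zero sob_amp_def)
  then show "(0 :: 'd vfield) \<in> SobS0 n" by (simp add: SobS0_iff divergence_free_def fcoeff_zero)
  show "v + w \<in> SobS0 n" if "v \<in> SobS0 n" "w \<in> SobS0 n" for v w :: "'d vfield"
    using that by (simp add: SobS0_iff Sob0_add divergence_free_def fcoeff_add distrib_left sum.distrib)
  show "a *\<^sub>R v \<in> SobS0 n" if "v \<in> SobS0 n" for a and v :: "'d vfield"
    using that divergence_free_multiplier[of v "a *\<^sub>R v" "\<lambda>_. a"]
    by (simp add: SobS0_iff Sob0_scaleR fcoeff_scaleR)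
qed

lemma Sob_norm_eq_0:
  assumes "v \<in> Sob0 n" "Sob_norm n v = 0"
  shows "v = 0"
proof (rule vfield_fcoeff_eqI)
  fix k
  show "fcoeff v k = fcoeff 0 k"
  proof (cases "k = 0")
    case True
    then show ?thesis using assms(1) by (simp add: Sob0_iff fcoeff_zero)
  next
    case False
    have "0 < norm (rvec k)" using norm_rvec_ge_1[OF False] by linarith
    then have "0 < norm (rvec k) powr n" by simp
    moreover have "sob_amp n v k \<le> 0" using sob_amp_le_Sob_norm[OF assms(1), of k] assms(2) by simp
    ultimately show ?thesis by (simp add: sob_amp_def mult_le_0_iff fcoeff_zero)
  qed
qed

section \<open>The Sobolev spaces as Banach spaces\<close>

abbreviation norm_dist :: "'v::real_vector set \<Rightarrow> ('v \<Rightarrow> real) \<Rightarrow> 'v \<Rightarrow> 'v \<Rightarrow> real" where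
  "norm_dist X N \<equiv> \<lambda>v w. if v \<in> X \<and> w \<in> X then N (v - w) else 0"

lemma SobS0_diff: "v \<in> SobS0 n \<Longrightarrow> w \<in> SobS0 n \<Longrightarrow> v - w \<in> SobS0 n"
  by (rule subspace_diff[OF subspace_SobS0])

lemma SobS0_imp_Sob0: "v \<in> SobS0 n \<Longrightarrow> v \<in> Sob0 n"
  by (simp add: SobS0_iff)

lemma Sob_norm_triangle:
  "v \<in> SobS0 n \<Longrightarrow> w \<in> SobS0 n \<Longrightarrow> Sob_norm n (v + w) \<le> Sob_norm n v + Sob_norm n w"
  by (simp add: Sob0_add SobS0_iff)

lemma Sob_norm_minus_commute: "Sob_norm n (v - w) = Sob_norm n (w - v)"
  using Sob_norm_scaleR[of n "-1" "v - w"] by simp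

lemma Sob_norm_zero [simp]: "Sob_norm n 0 = 0"
  using Sob_norm_scaleR[of n 0 0] by simp

lemma Metric_space_SobS0: "Metric_space (SobS0 n) (norm_dist (SobS0 n) (Sob_norm n))"
proof
  fix x y z :: "'a vfield"
  let ?d = "norm_dist (SobS0 n) (Sob_norm n) :: 'a vfield \<Rightarrow> 'a vfield \<Rightarrow> real"
  show "0 \<le> ?d x y" by simp
  show "?d x y = ?d y x" by (simp add: Sob_norm_minus_commute)
  assume x: "x \<in> SobS0 n" and y: "y \<in> SobS0 n"
  show "?d x y = 0 \<longleftrightarrow> x = y"
    using x y Sob_norm_eq_0[OF SobS0_imp_Sob0[OF SobS0_diff[OF x y]]] by auto
  assume z: "z \<in> SobS0 n"
  show "?d x z \<le> ?d x y + ?d y z"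
    using x y z Sob_norm_triangle[OF SobS0_diff[OF x y] SobS0_diff[OF y z]] by simp
qed

lemma norm_fcoeff_le_Sob_norm:
  assumes "v \<in> Sob0 n"
  shows "norm (fcoeff v k) \<le> norm (rvec k) powr (- n) * Sob_norm n v"
proof (cases "k = 0")
  case True
  then show ?thesis using assms by (simp add: Sob0_iff)
next
  case False
  have pos: "0 < norm (rvec k) powr n" using norm_rvec_ge_1[OF False] by (auto simp: powr_gt_zero)
  have "norm (rvec k) powr n * norm (fcoeff v k) \<le> Sob_norm n v"
    using sob_amp_le_Sob_norm[OF assms, of k] by (simp add: sob_amp_def)
  then show ?thesis using pos by (simp add: powr_minus field_simps)
qed

lemma powr_norm_rvec_le_freq:
  "\<exists>p. \<forall>k::int^'d::finite. norm (rvec k) powr a \<le> freq k ^ p"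
proof (intro exI allI)
  fix k :: "int^'d"
  have "norm (rvec k) powr a \<le> freq k powr real (nat \<lceil>a\<rceil>)"
  proof (cases "k = 0")
    case False
    then show ?thesis
      by (auto simp: freq_eq norm_rvec_ge_1 intro!: powr_mono real_nat_ceiling_ge)
  qed simp
  then show "norm (rvec k) powr a \<le> freq k ^ nat \<lceil>a\<rceil>" by (simp add: powr_realpow)
qed

text \<open>
  The coefficients of a Cauchy sequence converge, and the limits grow at most polynomially
  because the sequence is bounded; so they are the coefficients of a vector field, to which the
  sequence converges by Fatou's lemma, here in the form of a limit of finite sums.
\<close>

lemma mcomplete_SobS0:
  "Metric_space.mcomplete (SobS0 n :: ('d::finite) vfield set) (norm_dist (SobS0 n) (Sob_norm n))"
proof -
  interpret Metric_space "SobS0 n :: 'd vfield set" "norm_dist (SobS0 n) (Sob_norm n)"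
    by (rule Metric_space_SobS0)
  show ?thesis
    unfolding mcomplete_def
  proof (intro allI impI)
    fix \<sigma> :: "nat \<Rightarrow> 'd vfield"
    assume "MCauchy \<sigma>"
    then have \<sigma>: "\<sigma> j \<in> SobS0 n" for j by (auto simp: MCauchy_def)
    have cauchy: "\<exists>N. \<forall>i\<ge>N. \<forall>j\<ge>N. Sob_norm n (\<sigma> i - \<sigma> j) < \<epsilon>" if "0 < \<epsilon>" for \<epsilon>
      using \<open>MCauchy \<sigma>\<close> that \<sigma> by (simp add: MCauchy_def)
    have d0: "\<sigma> i - \<sigma> j \<in> Sob0 n" for i j by (intro SobS0_imp_Sob0 SobS0_diff \<sigma>)
    have "Cauchy (\<lambda>j. fcoeff (\<sigma> j) k)" for k
    proof (rule metric_CauchyI)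
      fix e :: real assume e: "0 < e"
      \<comment> \<open>The summand 1 makes the factor positive also at \<open>k = 0\<close>.\<close>
      let ?a = "norm (rvec k) powr (- n) + 1"
      have a: "0 < ?a" by (simp add: add_nonneg_pos)
      obtain N where N: "\<forall>i\<ge>N. \<forall>j\<ge>N. Sob_norm n (\<sigma> i - \<sigma> j) < e / ?a"
        using cauchy[of "e / ?a"] e a by auto
      show "\<exists>M. \<forall>i\<ge>M. \<forall>j\<ge>M. dist (fcoeff (\<sigma> i) k) (fcoeff (\<sigma> j) k) < e"
      proof (intro exI allI impI)
        fix i j assume ij: "N \<le> i" "N \<le> j"
        have "dist (fcoeff (\<sigma> i) k) (fcoeff (\<sigma> j) k) \<le> norm (rvec k) powr (- n) * Sob_norm n (\<sigma> i - \<sigma> j)"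
          using norm_fcoeff_le_Sob_norm[OF d0, of i j k] by (simp add: dist_norm fcoeff_diff)
        also have "\<dots> \<le> ?a * Sob_norm n (\<sigma> i - \<sigma> j)"
          by (rule mult_right_mono) simp_all
        also have "\<dots> < ?a * (e / ?a)"
          using N ij a by (intro mult_strict_left_mono) simp_all
        also have "\<dots> = e" using a by simp
        finally show "dist (fcoeff (\<sigma> i) k) (fcoeff (\<sigma> j) k) < e" .
      qed
    qed
    then have "\<forall>k. \<exists>c. (\<lambda>j. fcoeff (\<sigma> j) k) \<longlonglongrightarrow> c"
      by (simp add: Cauchy_convergent_iff convergent_def)
    from choice[OF this] obtain c where c: "\<forall>k. (\<lambda>j. fcoeff (\<sigma> j) k) \<longlonglongrightarrow> c k" ..
    obtain N where N: "\<forall>i\<ge>N. \<forall>j\<ge>N. Sob_norm n (\<sigma> i - \<sigma> j) < 1" using cauchy[of 1] by auto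
    define B where "B = 1 + Sob_norm n (\<sigma> N)"
    have B: "Sob_norm n (\<sigma> j) \<le> B" if "N \<le> j" for j
    proof -
      have "Sob_norm n (\<sigma> j) \<le> Sob_norm n (\<sigma> j - \<sigma> N) + Sob_norm n (\<sigma> N)"
        using Sob_norm_triangle[OF SobS0_diff[OF \<sigma> \<sigma>] \<sigma>, of j N N] by simp
      also have "Sob_norm n (\<sigma> j - \<sigma> N) < 1" using N that by simp
      finally show ?thesis by (simp add: B_def)
    qed
    obtain p where p: "\<forall>k::int^'d. norm (rvec k) powr (- n) \<le> freq k ^ p"
      using powr_norm_rvec_le_freq by blast
    have growth: "norm (c k) \<le> B * freq k ^ p" for k
    proof (rule LIMSEQ_le_const2)
      show "(\<lambda>j. norm (fcoeff (\<sigma> j) k)) \<longlonglongrightarrow> norm (c k)" using c by (intro tendsto_norm) simp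
      have "norm (fcoeff (\<sigma> j) k) \<le> B * freq k ^ p" if "N \<le> j" for j
      proof -
        have "norm (fcoeff (\<sigma> j) k) \<le> norm (rvec k) powr (- n) * Sob_norm n (\<sigma> j)"
          by (rule norm_fcoeff_le_Sob_norm[OF SobS0_imp_Sob0[OF \<sigma>]])
        also have "\<dots> \<le> freq k ^ p * B"
          by (rule mult_mono[OF p[rule_format] B[OF that]]) (use order_trans[OF powr_ge_zero p[rule_format]] in simp_all)
        finally show ?thesis by (simp add: mult.commute)
      qed
      then show "\<exists>N. \<forall>j\<ge>N. norm (fcoeff (\<sigma> j) k) \<le> B * freq k ^ p" by blast
    qed
    have cr: "(\<lambda>j. fcoeff (\<sigma> j) k $ r) \<longlonglongrightarrow> c k $ r" for k r
      using c by (intro tendsto_vec_nth) simp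
    have real: "c (- k) $ r = cnj (c k $ r)" for k r
    proof (rule LIMSEQ_unique[OF cr])
      show "(\<lambda>j. fcoeff (\<sigma> j) (- k) $ r) \<longlonglongrightarrow> cnj (c k $ r)"
        unfolding fcoeff_uminus_freq by (intro tendsto_cnj cr)
    qed
    define v where "v = fseries c"
    have v: "fcoeff v = c" unfolding v_def by (rule fcoeff_fseries[OF growth real])
    have div: "divergence_free v"
      unfolding divergence_free_def v
    proof
      fix k
      have "(\<lambda>j. \<Sum>r\<in>UNIV. of_int (k $ r) * fcoeff (\<sigma> j) k $ r) \<longlonglongrightarrow> (\<Sum>r\<in>UNIV. of_int (k $ r) * c k $ r)"
        by (intro tendsto_intros cr)
      moreover have "(\<Sum>r\<in>UNIV. of_int (k $ r) * fcoeff (\<sigma> j) k $ r) = 0" for j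
        using \<sigma>[of j] by (simp add: SobS0_iff divergence_free_def)
      ultimately show "(\<Sum>r\<in>UNIV. of_int (k $ r) * c k $ r) = 0"
        using LIMSEQ_unique[OF _ tendsto_const] by simp
    qed
    have zero: "fcoeff v 0 = 0"
    proof -
      have "fcoeff (\<sigma> j) 0 = 0" for j using SobS0_imp_Sob0[OF \<sigma>] by (simp add: Sob0_iff)
      then have "(\<lambda>j. 0) \<longlonglongrightarrow> c 0" using c[rule_format, of 0] by simp
      then show ?thesis unfolding v by (rule LIMSEQ_unique[OF _ tendsto_const])
    qed
    have lim: "\<sigma> i - v \<in> Sob0 n \<and> Sob_norm n (\<sigma> i - v) \<le> \<epsilon>"
      if M: "\<forall>i\<ge>M. \<forall>j\<ge>M. Sob_norm n (\<sigma> i - \<sigma> j) < \<epsilon>" and i: "M \<le> i" for i M \<epsilon>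
    proof -
      have "L2_set (sob_amp n (\<sigma> i - v)) K \<le> \<epsilon>" if K: "finite K" for K
      proof (rule LIMSEQ_le_const2)
        show "(\<lambda>j. L2_set (sob_amp n (\<sigma> i - \<sigma> j)) K) \<longlonglongrightarrow> L2_set (sob_amp n (\<sigma> i - v)) K"
          unfolding L2_set_def sob_amp_def fcoeff_diff v
          by (intro tendsto_intros c[rule_format])
        have "L2_set (sob_amp n (\<sigma> i - \<sigma> j)) K \<le> \<epsilon>" if "M \<le> j" for j
          using order_trans[OF L2_set_le_Sob_norm[OF d0 K] less_imp_le] M i that by simp
        then show "\<exists>N. \<forall>j\<ge>N. L2_set (sob_amp n (\<sigma> i - \<sigma> j)) K \<le> \<epsilon>" by blast
      qed
      moreover have "fcoeff (\<sigma> i - v) 0 = 0"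
        using SobS0_imp_Sob0[OF \<sigma>, of i] zero by (simp add: fcoeff_diff Sob0_iff)
      ultimately show ?thesis using Sob0I_L2_set by blast
    qed
    have vS: "v \<in> SobS0 n"
    proof -
      have "\<sigma> N - v \<in> Sob0 n" using lim[OF N] by simp
      then have "\<sigma> N + (-1) *\<^sub>R (\<sigma> N - v) \<in> Sob0 n"
        by (rule Sob0_add(1)[OF SobS0_imp_Sob0[OF \<sigma>] Sob0_scaleR])
      then show ?thesis using div by (simp add: SobS0_iff)
    qed
    have "limitin mtopology \<sigma> v sequentially"
      unfolding limit_metric_sequentially
    proof (intro conjI allI impI vS)
      fix \<epsilon> :: real assume "0 < \<epsilon>"
      then obtain M where M: "\<forall>i\<ge>M. \<forall>j\<ge>M. Sob_norm n (\<sigma> i - \<sigma> j) < \<epsilon> / 2" using cauchy[of "\<epsilon> / 2"] by auto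
      have "\<sigma> i \<in> SobS0 n \<and> norm_dist (SobS0 n) (Sob_norm n) (\<sigma> i) v < \<epsilon>" if "M \<le> i" for i
        using lim[OF M that] \<sigma> vS \<open>0 < \<epsilon>\<close> by simp
      then show "\<exists>N. \<forall>i\<ge>N. \<sigma> i \<in> SobS0 n \<and> norm_dist (SobS0 n) (Sob_norm n) (\<sigma> i) v < \<epsilon>" by blast
    qed
    then show "\<exists>x. limitin mtopology \<sigma> x sequentially" by blast
  qed
qed

lemma banach_on_SobS0: "banach_on (SobS0 n) (Sob_norm n)"
  unfolding banach_on_def
  by (intro conjI ballI allI subspace_SobS0 mcomplete_SobS0)
    (auto simp: Sob_norm_triangle Sob_norm_scaleR intro: Sob_norm_eq_0 SobS0_imp_Sob0)

text \<open>
  Dominated convergence: the tail of the dominating series outside a finite set is small uniformly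
  in \<open>h\<close>, and on the finite set the coefficients tend to 0.
\<close>

lemma Sob_norm_tendsto_zero:
  fixes u :: "'x \<Rightarrow> ('d::finite) vfield"
  assumes b: "(\<lambda>k. (b k)\<^sup>2) summable_on UNIV"
    and le: "eventually (\<lambda>h. \<forall>k. sob_amp n (u h) k \<le> b k) F"
    and lim: "\<And>k. ((\<lambda>h. fcoeff (u h) k) \<longlongrightarrow> 0) F"
  shows "((\<lambda>h. Sob_norm n (u h)) \<longlongrightarrow> 0) F"
proof -
  have "((\<lambda>h. \<Sum>\<^sub>\<infinity>k. (sob_amp n (u h) k)\<^sup>2) \<longlongrightarrow> 0) F"
  proof (rule tendstoI)
    fix e :: real assume e: "0 < e"
    obtain K where K: "finite K" "dist (\<Sum>k\<in>K. (b k)\<^sup>2) (\<Sum>\<^sub>\<infinity>k. (b k)\<^sup>2) \<le> e / 2"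
      using infsum_finite_approximation[OF b, of "e / 2"] e by auto
    have bK: "(\<lambda>k. (b k)\<^sup>2) summable_on (UNIV - K)" "(\<Sum>\<^sub>\<infinity>k\<in>UNIV - K. (b k)\<^sup>2) \<le> e / 2"
    proof -
      have *: "((\<lambda>k. (b k)\<^sup>2) has_sum ((\<Sum>\<^sub>\<infinity>k. (b k)\<^sup>2) - (\<Sum>k\<in>K. (b k)\<^sup>2))) (UNIV - K)"
        by (intro has_sum_Diff has_sum_infsum b has_sum_finite K) auto
      then show "(\<lambda>k. (b k)\<^sup>2) summable_on (UNIV - K)" by (rule has_sum_imp_summable)
      show "(\<Sum>\<^sub>\<infinity>k\<in>UNIV - K. (b k)\<^sup>2) \<le> e / 2"
        using infsumI[OF *] K(2) unfolding dist_real_def by linarith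
    qed
    have "((\<lambda>h. \<Sum>k\<in>K. (sob_amp n (u h) k)\<^sup>2) \<longlongrightarrow> (\<Sum>k\<in>K. (norm (rvec k) powr n * norm (0 :: complex^'d))\<^sup>2)) F"
      unfolding sob_amp_def by (intro tendsto_intros lim)
    then have lim0: "((\<lambda>h. \<Sum>k\<in>K. (sob_amp n (u h) k)\<^sup>2) \<longlongrightarrow> 0) F" by simp
    have "0 < e / 2" using e by simp
    from order_tendstoD(2)[OF lim0 this]
    have "eventually (\<lambda>h. (\<Sum>k\<in>K. (sob_amp n (u h) k)\<^sup>2) < e / 2) F" .
    with le show "eventually (\<lambda>h. dist (\<Sum>\<^sub>\<infinity>k. (sob_amp n (u h) k)\<^sup>2) 0 < e) F"
    proof eventually_elim
      case (elim h)
      have sq: "(sob_amp n (u h) k)\<^sup>2 \<le> (b k)\<^sup>2" for k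
        using elim(1) by (intro power_mono) simp_all
      have s: "(\<lambda>k. (sob_amp n (u h) k)\<^sup>2) summable_on UNIV"
        by (rule summable_on_comparison_test[OF b]) (simp_all add: sq)
      have s': "(\<lambda>k. (sob_amp n (u h) k)\<^sup>2) summable_on (UNIV - K)"
        by (rule summable_on_subset_banach[OF s]) simp
      have "(\<Sum>\<^sub>\<infinity>k. (sob_amp n (u h) k)\<^sup>2) = (\<Sum>\<^sub>\<infinity>k\<in>K \<union> (UNIV - K). (sob_amp n (u h) k)\<^sup>2)" by simp
      also have "\<dots> = (\<Sum>k\<in>K. (sob_amp n (u h) k)\<^sup>2) + (\<Sum>\<^sub>\<infinity>k\<in>UNIV - K. (sob_amp n (u h) k)\<^sup>2)"
        by (subst infsum_Un_disjoint) (use K s' in auto)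
      also have "(\<Sum>\<^sub>\<infinity>k\<in>UNIV - K. (sob_amp n (u h) k)\<^sup>2) \<le> (\<Sum>\<^sub>\<infinity>k\<in>UNIV - K. (b k)\<^sup>2)"
        by (rule infsum_mono[OF s' bK(1)]) (rule sq)
      finally have "(\<Sum>\<^sub>\<infinity>k. (sob_amp n (u h) k)\<^sup>2) < e" using elim(2) bK(2) by simp
      then show ?case by (simp add: dist_real_def infsum_nonneg)
    qed
  qed
  from tendsto_real_sqrt[OF this] show ?thesis by (simp add: Sob_norm_eq)
qed

section \<open>The heat flow on Sobolev spaces\<close>

lemma sob_amp_heat:
  "0 \<le> t \<Longrightarrow> sob_amp n (heat t v) k = exp (- t * (norm (rvec k))\<^sup>2) * sob_amp n v k"
  by (simp add: sob_amp_def fcoeff_heat)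

lemma sob_amp_shift: "sob_amp m v k = norm (rvec k) powr (m - n) * sob_amp n v k"
  by (simp add: sob_amp_def flip: powr_add)

lemma divergence_free_heat: "0 \<le> t \<Longrightarrow> divergence_free v \<Longrightarrow> divergence_free (heat t v)"
  by (rule divergence_free_multiplier[where v = v and m = "\<lambda>k. exp (- t * (norm (rvec k))\<^sup>2)"])
    (simp_all add: fcoeff_heat)

text \<open>
  The flow acts on each \<open>sob_amp\<close> by a factor, the quotient of the weights times the symbol;
  for fields of mean zero only frequencies of norm at least 1 occur.
\<close>

lemma heat_smoothing:
  assumes "0 \<le> t" "0 \<le> C"
    and C: "\<And>x. 1 \<le> x \<Longrightarrow> x powr (m - n) * exp (- t * x\<^sup>2) \<le> C"
    and v: "v \<in> SobS0 n"
  shows "heat t v \<in> SobS0 m" "Sob_norm m (heat t v) \<le> C * Sob_norm n v"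
proof -
  have le: "sob_amp m (heat t v) k \<le> C * sob_amp n v k" if "k \<noteq> 0" for k
  proof -
    have "sob_amp m (heat t v) k = (norm (rvec k) powr (m - n) * exp (- t * (norm (rvec k))\<^sup>2)) * sob_amp n v k"
      unfolding sob_amp_heat[OF assms(1)] sob_amp_shift[of m v k n] by simp
    also have "\<dots> \<le> C * sob_amp n v k"
      by (rule mult_right_mono[OF C[OF norm_rvec_ge_1[OF that]]]) simp
    finally show ?thesis .
  qed
  have z: "fcoeff (heat t v) 0 = 0"
    using v by (simp add: fcoeff_heat assms(1) SobS0_iff Sob0_iff)
  show "heat t v \<in> SobS0 m" "Sob_norm m (heat t v) \<le> C * Sob_norm n v"
    using Sob0_dominated[OF SobS0_imp_Sob0[OF v] z assms(2) le] v divergence_free_heat[OF assms(1), of v]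
    by (simp_all add: SobS0_iff)
qed

lemma heat_contraction:
  assumes "0 \<le> t" "v \<in> SobS0 n"
  shows "heat t v \<in> SobS0 n" "Sob_norm n (heat t v) \<le> exp (- t) * Sob_norm n v"
proof -
  have "x powr (n - n) * exp (- t * x\<^sup>2) \<le> exp (- t)" if "1 \<le> x" for x :: real
    using that assms(1) mult_left_mono[of 1 "x\<^sup>2" t] by simp
  from heat_smoothing[OF assms(1) _ this assms(2)]
  show "heat t v \<in> SobS0 n" "Sob_norm n (heat t v) \<le> exp (- t) * Sob_norm n v" by simp_all
qed

text \<open>
  The maximum is attained at \<open>x = a / t\<close>; in logarithms the bound is
  \<open>ln y \<le> y - 1\<close> at \<open>y = t * x / a\<close>.
\<close>

lemma powr_mult_exp_le:
  fixes a t x :: real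
  assumes "0 < a" "0 < t" "0 < x"
  shows "x powr a * exp (- t * x) \<le> (a / (exp 1 * t)) powr a"
proof -
  have "ln (t * x / a) \<le> t * x / a - 1" using assms by (intro ln_le_minus_one) simp
  then have "a * ln (t * x / a) \<le> a * (t * x / a - 1)" using assms(1) by (intro mult_left_mono) simp_all
  then have "a * ln (t * x / a) \<le> t * x - a" using assms by (simp add: right_diff_distrib)
  moreover have "ln (t * x / a) = ln x - ln (a / t)" using assms by (simp add: ln_mult ln_div)
  ultimately have "a * ln x - t * x \<le> a * (ln (a / t) - 1)" by (simp add: algebra_simps)
  moreover have "ln (a / (exp 1 * t)) = ln (a / t) - 1" using assms by (simp add: ln_div ln_mult)
  ultimately have "a * ln x - t * x \<le> a * ln (a / (exp 1 * t))" by simp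
  then have "exp (a * ln x - t * x) \<le> exp (a * ln (a / (exp 1 * t)))" by simp
  then show ?thesis using assms by (simp add: powr_def exp_diff exp_minus field_simps)
qed

lemma powr_mult_exp_square_le:
  fixes b t x :: real
  assumes "0 < b" "0 < t" "1 \<le> x"
  shows "x powr b * exp (- t * x\<^sup>2) \<le> (b / 2 / (exp 1 * t)) powr (b / 2)"
proof -
  have "x powr b = x powr (2 * (b / 2))" by simp
  also have "\<dots> = (x powr 2) powr (b / 2)" by (rule powr_powr[symmetric])
  also have "x powr 2 = x\<^sup>2" using assms by simp
  finally show ?thesis using powr_mult_exp_le[of "b / 2" t "x\<^sup>2"] assms by (simp only:) simp
qed

lemma heat_regularizes:
  assumes "0 < t" "n < m" "v \<in> SobS0 n"
  shows "heat t v \<in> SobS0 m"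
proof (rule heat_smoothing(1)[OF _ _ _ assms(3)])
  show "x powr (m - n) * exp (- t * x\<^sup>2) \<le> ((m - n) / 2 / (exp 1 * t)) powr ((m - n) / 2)" if "1 \<le> x" for x
    using assms that by (intro powr_mult_exp_square_le) simp_all
qed (use assms in simp_all)

lemma Sobolev_embedding:
  assumes "n \<le> m" "v \<in> SobS0 m"
  shows "v \<in> SobS0 n" "Sob_norm n v \<le> Sob_norm m v"
proof -
  have "sob_amp n v k \<le> 1 * sob_amp m v k" if "k \<noteq> 0" for k
    using norm_rvec_ge_1[OF that] assms(1) by (auto simp: sob_amp_def intro!: mult_right_mono powr_mono)
  from Sob0_dominated[OF SobS0_imp_Sob0[OF assms(2)] _ _ this] assms(2)
  show "v \<in> SobS0 n" "Sob_norm n v \<le> Sob_norm m v" by (simp_all add: SobS0_iff Sob0_iff)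
qed

lemma SobS0_mono: "n \<le> m \<Longrightarrow> SobS0 m \<subseteq> SobS0 n"
  using Sobolev_embedding(1) by blast

lemma abs_exp_diff_le:
  fixes s t t0 y :: real
  assumes "s \<le> t" "s \<le> t0" "0 \<le> y"
  shows "\<bar>exp (- t * y) - exp (- t0 * y)\<bar> \<le> exp (- s * y)"
proof -
  have "exp (- t * y) \<le> exp (- s * y)" "exp (- t0 * y) \<le> exp (- s * y)"
    using assms by (simp_all add: mult_right_mono)
  then show ?thesis using exp_gt_zero[of "- t * y"] exp_gt_zero[of "- t0 * y"] by linarith
qed

text \<open>
  Strong continuity in time is dominated convergence over the frequencies.  Since times near \<open>t0\<close>
  stay above some \<open>s\<close>, the smoothing of the flow at time \<open>s\<close> provides the dominating sequence.
\<close>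

lemma heat_tendsto:
  assumes s: "0 \<le> s" "s \<le> t0" and ev: "eventually (\<lambda>t. s \<le> t) F" and lim: "((\<lambda>t. t) \<longlongrightarrow> t0) F"
    and C: "\<And>x. 1 \<le> x \<Longrightarrow> x powr (m - n) * exp (- s * x\<^sup>2) \<le> C"
    and v: "v \<in> Sob0 n"
  shows "((\<lambda>t. Sob_norm m (heat t v - heat t0 v)) \<longlongrightarrow> 0) F"
proof (rule Sob_norm_tendsto_zero)
  have t0: "0 \<le> t0" using s by simp
  show "(\<lambda>k. (C * sob_amp n v k)\<^sup>2) summable_on UNIV"
    using v by (simp add: power_mult_distrib Sob0_iff summable_on_cmult_right)
  have co: "fcoeff (heat t v - heat t0 v) k =
      (exp (- t * (norm (rvec k))\<^sup>2) - exp (- t0 * (norm (rvec k))\<^sup>2)) *\<^sub>R fcoeff v k" if "s \<le> t" for t k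
    using s that by (simp add: fcoeff_diff fcoeff_heat scaleR_left_diff_distrib)
  show "eventually (\<lambda>t. \<forall>k. sob_amp m (heat t v - heat t0 v) k \<le> C * sob_amp n v k) F"
    using ev
  proof eventually_elim
    case (elim t)
    show ?case
    proof
      fix k
      show "sob_amp m (heat t v - heat t0 v) k \<le> C * sob_amp n v k"
      proof (cases "k = 0")
        case False
        let ?x = "norm (rvec k)"
        have "sob_amp m (heat t v - heat t0 v) k =
            \<bar>exp (- t * ?x\<^sup>2) - exp (- t0 * ?x\<^sup>2)\<bar> * sob_amp m v k"
          by (simp add: sob_amp_def co[OF elim])
        also have "\<dots> \<le> exp (- s * ?x\<^sup>2) * sob_amp m v k"
          by (rule mult_right_mono[OF abs_exp_diff_le[OF elim s(2)]]) simp_all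
        also have "\<dots> = (?x powr (m - n) * exp (- s * ?x\<^sup>2)) * sob_amp n v k"
          by (simp add: sob_amp_shift[of m v k n])
        also have "\<dots> \<le> C * sob_amp n v k"
          by (rule mult_right_mono[OF C[OF norm_rvec_ge_1[OF False]]]) simp
        finally show ?thesis .
      qed simp
    qed
  qed
  show "((\<lambda>t. fcoeff (heat t v - heat t0 v) k) \<longlongrightarrow> 0) F" for k
  proof -
    have "((\<lambda>t. (exp (- t * (norm (rvec k))\<^sup>2) - exp (- t0 * (norm (rvec k))\<^sup>2)) *\<^sub>R fcoeff v k) \<longlongrightarrow>
        (exp (- t0 * (norm (rvec k))\<^sup>2) - exp (- t0 * (norm (rvec k))\<^sup>2)) *\<^sub>R fcoeff v k) F"
      by (intro tendsto_intros lim)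
    then have "((\<lambda>t. (exp (- t * (norm (rvec k))\<^sup>2) - exp (- t0 * (norm (rvec k))\<^sup>2)) *\<^sub>R fcoeff v k) \<longlongrightarrow> 0) F"
      by simp
    then show ?thesis
      by (rule Lim_transform_eventually) (use ev in eventually_elim, simp add: co)
  qed
qed

text \<open>
  Split \<open>heat t v - heat t0 v0\<close> into \<open>heat t (v - v0)\<close>, small by linearity and the bound
  \<open>C\<close> on the operators that holds locally uniformly in time, and \<open>heat t v0 - heat t0 v0\<close>,
  small by strong continuity.
\<close>

lemma heat_jointly_continuous:
  fixes S :: "real set"
  assumes S: "S \<subseteq> {0..}"
    and loc: "\<And>t0. t0 \<in> S \<Longrightarrow> \<exists>\<delta>>0. \<exists>s C. 0 \<le> s \<and> 0 \<le> C \<and> (\<forall>t\<in>S. \<bar>t - t0\<bar> < \<delta> \<longrightarrow> s \<le> t) \<and>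
      (\<forall>x\<ge>1. x powr (m - n) * exp (- s * x\<^sup>2) \<le> C)"
  shows "continuous_map
      (prod_topology (top_of_set S) (norm_topology (SobS0 n) (Sob_norm n)))
      (norm_topology (SobS0 m :: ('d::finite) vfield set) (Sob_norm m)) (\<lambda>(t, v). heat t v)"
proof -
  interpret X: Metric_space "SobS0 n :: 'd vfield set" "norm_dist (SobS0 n) (Sob_norm n)"
    by (rule Metric_space_SobS0)
  interpret Y: Metric_space "SobS0 m :: 'd vfield set" "norm_dist (SobS0 m) (Sob_norm m)"
    by (rule Metric_space_SobS0)
  show ?thesis
    unfolding Y.continuous_map_to_metric
  proof (intro ballI allI impI)
    fix p :: "real \<times> 'd vfield" and \<epsilon> :: real
    assume "p \<in> topspace (prod_topology (top_of_set S) X.mtopology)" and \<epsilon>: "0 < \<epsilon>"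
    then obtain t0 v0 where p: "p = (t0, v0)" and t0: "t0 \<in> S" and v0: "v0 \<in> SobS0 n" by auto
    obtain \<delta> s C where \<delta>: "0 < \<delta>" and s: "0 \<le> s" and C0: "0 \<le> C"
      and st: "\<And>t. t \<in> S \<Longrightarrow> \<bar>t - t0\<bar> < \<delta> \<Longrightarrow> s \<le> t"
      and C: "\<And>x. 1 \<le> x \<Longrightarrow> x powr (m - n) * exp (- s * x\<^sup>2) \<le> C"
      using loc[OF t0] by blast
    have st0: "s \<le> t0" using st[OF t0] \<delta> by simp
    have Ct: "x powr (m - n) * exp (- t * x\<^sup>2) \<le> C" if "s \<le> t" "1 \<le> x" for t x
    proof -
      have "exp (- t * x\<^sup>2) \<le> exp (- s * x\<^sup>2)" using that by (simp add: mult_right_mono)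
      then have "x powr (m - n) * exp (- t * x\<^sup>2) \<le> x powr (m - n) * exp (- s * x\<^sup>2)"
        by (rule mult_left_mono) simp
      then show ?thesis using C[OF that(2)] by (rule order_trans)
    qed
    have est: "heat t v \<in> SobS0 m" "Sob_norm m (heat t v) \<le> C * Sob_norm n v"
      if "s \<le> t" "v \<in> SobS0 n" for t v
      using heat_smoothing[OF _ C0 Ct[OF that(1)] that(2)] s that(1) by simp_all
    have near: "eventually (\<lambda>t. s \<le> t) (at t0 within S)"
      unfolding eventually_at using \<delta> st by (auto simp: dist_real_def)
    have "((\<lambda>t. Sob_norm m (heat t v0 - heat t0 v0)) \<longlongrightarrow> 0) (at t0 within S)"
      by (rule heat_tendsto[OF s st0 near _ C SobS0_imp_Sob0[OF v0]]) (rule tendsto_ident_at)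
    then have "eventually (\<lambda>t. Sob_norm m (heat t v0 - heat t0 v0) < \<epsilon> / 2) (at t0 within S)"
      by (rule order_tendstoD) (use \<epsilon> in simp)
    then obtain \<delta>' where \<delta>': "0 < \<delta>'" "\<And>t. t \<in> S \<Longrightarrow> t \<noteq> t0 \<Longrightarrow> dist t t0 < \<delta>' \<Longrightarrow>
        Sob_norm m (heat t v0 - heat t0 v0) < \<epsilon> / 2"
      unfolding eventually_at by blast
    define r where "r = \<epsilon> / 2 / (C + 1)"
    have r: "0 < r" using \<epsilon> C0 by (simp add: r_def)
    let ?U = "(S \<inter> ball t0 (min \<delta> \<delta>')) \<times> X.mball v0 r"
    have "openin (prod_topology (top_of_set S) X.mtopology) ?U"
      by (simp add: openin_prod_Times_iff openin_open_Int)
    moreover have "p \<in> ?U" using p t0 v0 r \<delta> \<delta>' by simp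
    moreover have "(case y of (t, v) \<Rightarrow> heat t v) \<in> Y.mball (case p of (t, v) \<Rightarrow> heat t v) \<epsilon>" if "y \<in> ?U" for y
    proof -
      obtain t v where y: "y = (t, v)" by (cases y)
      have t: "t \<in> S" "\<bar>t - t0\<bar> < \<delta>" "dist t t0 < \<delta>'"
        using that by (simp_all add: y dist_real_def abs_minus_commute)
      have v1: "v \<in> SobS0 n" using that by (simp add: y)
      then have "Sob_norm n (v0 - v) < r" using that by (simp add: y v0)
      with v1 have v: "v \<in> SobS0 n" "Sob_norm n (v0 - v) < r" by simp_all
      have t': "s \<le> t" by (rule st[OF t(1,2)])
      have 1: "Sob_norm m (heat t v0 - heat t0 v0) < \<epsilon> / 2"
      proof (cases "t = t0")
        case True
        then show ?thesis using \<epsilon> by simp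
      next
        case False
        then show ?thesis by (rule \<delta>'(2)[OF t(1) _ t(3)])
      qed
      have "Sob_norm m (heat t (v0 - v)) \<le> C * Sob_norm n (v0 - v)"
        by (rule est(2)[OF t' SobS0_diff[OF v0 v(1)]])
      also have "\<dots> \<le> C * r" using v(2) C0 by (intro mult_left_mono) simp_all
      also have "\<dots> \<le> (C + 1) * r" using r by (simp add: distrib_right)
      also have "\<dots> = \<epsilon> / 2"
      proof -
        have "C + 1 \<noteq> 0" using C0 by simp
        then show ?thesis unfolding r_def by (rule nonzero_mult_div_cancel_left[of "C + 1" "\<epsilon> / 2", unfolded times_divide_eq_right[symmetric]])
      qed
      finally have 2: "Sob_norm m (heat t v0 - heat t v) \<le> \<epsilon> / 2"
        using s t' by (simp add: heat_diff)
      have "Sob_norm m (heat t0 v0 - heat t v) \<le>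
          Sob_norm m (heat t0 v0 - heat t v0) + Sob_norm m (heat t v0 - heat t v)"
        using Sob_norm_triangle[OF SobS0_diff[OF est(1)[OF st0 v0] est(1)[OF t' v0]]
            SobS0_diff[OF est(1)[OF t' v0] est(1)[OF t' v(1)]]] by simp
      also have "\<dots> < \<epsilon>" using 1 2 Sob_norm_minus_commute[of m "heat t0 v0" "heat t v0"] by simp
      finally show ?thesis using p y est(1)[OF st0 v0] est(1)[OF t' v(1)] by simp
    qed
    ultimately show "\<exists>U. openin (prod_topology (top_of_set S) X.mtopology) U \<and> p \<in> U \<and>
        (\<forall>y\<in>U. (case y of (t, v) \<Rightarrow> heat t v) \<in> Y.mball (case p of (t, v) \<Rightarrow> heat t v) \<epsilon>)"
      by blast
  qed
qed

lemma heat_jointly_continuous_nonneg_times: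
  "continuous_map
      (prod_topology (top_of_set {0..}) (norm_topology (SobS0 n) (Sob_norm n)))
      (norm_topology (SobS0 n :: ('d::finite) vfield set) (Sob_norm n)) (\<lambda>(t, v). heat t v)"
proof (rule heat_jointly_continuous)
  fix t0 :: real
  show "\<exists>\<delta>>0. \<exists>s C. 0 \<le> s \<and> 0 \<le> C \<and> (\<forall>t\<in>{0..}. \<bar>t - t0\<bar> < \<delta> \<longrightarrow> s \<le> t) \<and>
      (\<forall>x\<ge>1. x powr (n - n) * exp (- s * x\<^sup>2) \<le> C)"
    by (intro exI[of _ 1] exI[of _ 0] conjI) auto
qed simp

lemma heat_jointly_continuous_pos_times:
  assumes "n < m"
  shows "continuous_map
      (prod_topology (top_of_set {0<..}) (norm_topology (SobS0 n) (Sob_norm n)))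
      (norm_topology (SobS0 m :: ('d::finite) vfield set) (Sob_norm m)) (\<lambda>(t, v). heat t v)"
proof (rule heat_jointly_continuous)
  fix t0 :: real assume "t0 \<in> {0<..}"
  then have t0: "0 < t0" by simp
  \<comment> \<open>The smoothing constant at time \<open>t0 / 2\<close> serves all times near \<open>t0\<close>.\<close>
  let ?C = "((m - n) / 2 / (exp 1 * (t0 / 2))) powr ((m - n) / 2)"
  have "\<forall>x\<ge>1. x powr (m - n) * exp (- (t0 / 2) * x\<^sup>2) \<le> ?C"
    using assms t0 by (intro allI impI powr_mult_exp_square_le) simp_all
  moreover have "\<forall>t\<in>{0<..}. \<bar>t - t0\<bar> < t0 / 2 \<longrightarrow> t0 / 2 \<le> t" by (auto simp: abs_if split: if_splits)
  ultimately show "\<exists>\<delta>>0. \<exists>s C. 0 \<le> s \<and> 0 \<le> C \<and> (\<forall>t\<in>{0<..}. \<bar>t - t0\<bar> < \<delta> \<longrightarrow> s \<le> t) \<and>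
      (\<forall>x\<ge>1. x powr (m - n) * exp (- s * x\<^sup>2) \<le> C)"
    using t0 by (intro exI[of _ "t0 / 2"] exI[of _ ?C] conjI) simp_all
qed auto

lemma C0_semigroup_heat: "C0_semigroup (SobS0 n :: ('d::finite) vfield set) (Sob_norm n) heat"
  unfolding C0_semigroup_def linear_map_on_def
proof (intro conjI ballI allI impI banach_on_SobS0 subspace_SobS0)
  fix t :: real assume t: "0 \<le> t"
  show "heat t \<in> SobS0 n \<rightarrow> SobS0 n" by (simp add: heat_contraction t)
  show "\<exists>C. \<forall>v\<in>SobS0 n. Sob_norm n (heat t v) \<le> C * Sob_norm n v"
    using heat_contraction(2)[OF t] by blast
  show "heat t (v + w) = heat t v + heat t w" for v w by (rule heat_add[OF t])
  show "heat t (a *\<^sub>R v) = a *\<^sub>R heat t v" for a v by (rule heat_scaleR[OF t])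
  show "heat (s + t) v = heat s (heat t v)" if "0 \<le> s" for s v by (rule heat_add_time[OF that t])
next
  show "heat 0 v = v" for v by (rule heat_zero)
next
  fix v :: "'d vfield" assume v: "v \<in> SobS0 n"
  interpret X: Metric_space "SobS0 n :: 'd vfield set" "norm_dist (SobS0 n) (Sob_norm n)"
    by (rule Metric_space_SobS0)
  have "continuous_map (top_of_set {0..}) (prod_topology (top_of_set {0..}) X.mtopology) (\<lambda>t. (t, v))"
    using v by (intro continuous_map_pairedI) simp_all
  from continuous_map_compose[OF this heat_jointly_continuous_nonneg_times]
  show "continuous_map (top_of_set {0..}) X.mtopology (\<lambda>t. heat t v)" by (simp add: o_def)
qed

section \<open>The generator of the heat semigroup\<close>

lemma sob_amp_laplacian: "sob_amp n (laplacian v) k = sob_amp (n + 2) v k"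
proof (cases "k = 0")
  case False
  have "0 < norm (rvec k)" using norm_rvec_ge_1[OF False] by linarith
  then show ?thesis by (simp add: sob_amp_def fcoeff_laplacian powr_add)
qed simp

lemma laplacian_Sobolev:
  assumes v: "v \<in> SobS0 (n + 2)"
  shows "laplacian v \<in> SobS0 n" "Sob_norm n (laplacian v) = Sob_norm (n + 2) v"
proof -
  have "divergence_free (laplacian v)"
    by (rule divergence_free_multiplier[where v = v and m = "\<lambda>k. - (norm (rvec k))\<^sup>2"])
      (use v in \<open>simp_all add: SobS0_iff fcoeff_laplacian\<close>)
  then show "laplacian v \<in> SobS0 n"
    using v by (simp add: SobS0_iff Sob0_iff sob_amp_laplacian fcoeff_laplacian)
  show "Sob_norm n (laplacian v) = Sob_norm (n + 2) v"
    by (simp add: Sob_norm_eq sob_amp_laplacian)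
qed

lemma linear_map_on_laplacian:
  assumes "\<And>v. v \<in> SobS0 (n + 2) \<Longrightarrow> A v = laplacian v"
  shows "linear_map_on (SobS0 (n + 2)) (SobS0 n) A"
  unfolding linear_map_on_def
proof (intro conjI ballI allI subspace_SobS0)
  show "A \<in> SobS0 (n + 2) \<rightarrow> SobS0 n" by (simp add: assms laplacian_Sobolev)
  show "A (v + w) = A v + A w" if "v \<in> SobS0 (n + 2)" "w \<in> SobS0 (n + 2)" for v w
    using subspace_add[OF subspace_SobS0 that] that by (simp add: assms laplacian_add)
  show "A (a *\<^sub>R v) = a *\<^sub>R A v" if "v \<in> SobS0 (n + 2)" for a v
    using subspace_scale[OF subspace_SobS0 that] that by (simp add: assms laplacian_scaleR)
qed

lemma difference_quotient_exp:
  "((\<lambda>h. (exp (- h * x) - 1) / h) \<longlongrightarrow> - x) (at_right (0::real))"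
proof -
  have "((\<lambda>h. exp (- h * x)) has_real_derivative - x) (at 0)"
    by (auto intro!: derivative_eq_intros)
  then have "((\<lambda>h. (exp (- (0 + h) * x) - exp (- 0 * x)) / h) \<longlongrightarrow> - x) (at 0)"
    unfolding DERIV_def .
  then show ?thesis by (simp add: filterlim_at_split)
qed

lemma abs_difference_quotient_exp_le:
  fixes h x :: real
  assumes "0 < h" "0 \<le> x"
  shows "\<bar>(exp (- h * x) - 1) / h + x\<bar> \<le> x"
proof -
  have "1 + - h * x \<le> exp (- h * x)" by (rule exp_ge_add_one_self)
  then have "- x \<le> (exp (- h * x) - 1) / h" using assms by (simp add: field_simps)
  moreover have "(exp (- h * x) - 1) / h \<le> 0" using assms by (simp add: divide_le_0_iff)
  ultimately show ?thesis by linarith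
qed

lemma fcoeff_heat_difference_quotient:
  assumes "0 < h"
  shows "fcoeff ((1 / h) *\<^sub>R (heat h v - v) - w) k =
    ((exp (- h * (norm (rvec k))\<^sup>2) - 1) / h) *\<^sub>R fcoeff v k - fcoeff w k"
proof -
  have "fcoeff (heat h v - v) k = (exp (- h * (norm (rvec k))\<^sup>2) - 1) *\<^sub>R fcoeff v k"
    using assms by (simp add: fcoeff_diff fcoeff_heat scaleR_left_diff_distrib)
  then have "(1 / h) *\<^sub>R fcoeff (heat h v - v) k =
      ((exp (- h * (norm (rvec k))\<^sup>2) - 1) / h) *\<^sub>R fcoeff v k"
    by simp
  then show ?thesis by (simp only: fcoeff_diff[of _ w] fcoeff_scaleR)
qed

lemma tendsto_fcoeff:
  assumes "((\<lambda>h. Sob_norm n (u h)) \<longlongrightarrow> 0) F" and "eventually (\<lambda>h. u h \<in> Sob0 n) F"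
  shows "((\<lambda>h. fcoeff (u h) k) \<longlongrightarrow> 0) F"
proof (rule Lim_null_comparison)
  show "eventually (\<lambda>h. norm (fcoeff (u h) k) \<le> norm (rvec k) powr (- n) * Sob_norm n (u h)) F"
    using assms(2) by eventually_elim (rule norm_fcoeff_le_Sob_norm)
  show "((\<lambda>h. norm (rvec k) powr (- n) * Sob_norm n (u h)) \<longlongrightarrow> 0) F"
    using tendsto_mult_right_zero[OF assms(1)] .
qed

text \<open>
  The difference quotients of the symbol at \<open>h = 0\<close> tend to \<open>- |k|\<^sup>2\<close> and stay within
  \<open>|k|\<^sup>2\<close> of it, which gives convergence for \<open>v\<close> in the domain by dominated
  convergence.  Conversely, a limit \<open>w\<close> must have the coefficients \<open>- |k|\<^sup>2 v\<^sub>k\<close>,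
  and \<open>w\<close> being in the space says that \<open>v\<close> has two more derivatives.
\<close>

lemma heat_generator_iff:
  assumes v: "v \<in> SobS0 n" and w: "w \<in> SobS0 n"
  shows "v \<in> SobS0 (n + 2) \<and> laplacian v = w \<longleftrightarrow>
    ((\<lambda>h. Sob_norm n ((1 / h) *\<^sub>R (heat h v - v) - w)) \<longlongrightarrow> 0) (at_right 0)" (is "?L \<longleftrightarrow> ?R")
proof
  have pos: "eventually (\<lambda>h::real. 0 < h) (at_right 0)" by (rule eventually_at_right_less)
  {
    assume ?L
    then have v2: "v \<in> SobS0 (n + 2)" and w: "w = laplacian v" by simp_all
    have co: "fcoeff ((1 / h) *\<^sub>R (heat h v - v) - w) k =
        ((exp (- h * (norm (rvec k))\<^sup>2) - 1) / h + (norm (rvec k))\<^sup>2) *\<^sub>R fcoeff v k" if "0 < h" for h k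
      by (simp add: fcoeff_heat_difference_quotient[OF that] w fcoeff_laplacian scaleR_left_distrib)
    show ?R
    proof (rule Sob_norm_tendsto_zero)
      show "(\<lambda>k. (sob_amp (n + 2) v k)\<^sup>2) summable_on UNIV"
        using v2 by (simp add: SobS0_iff Sob0_iff)
      show "eventually (\<lambda>h. \<forall>k. sob_amp n ((1 / h) *\<^sub>R (heat h v - v) - w) k \<le> sob_amp (n + 2) v k) (at_right 0)"
        using pos
      proof eventually_elim
        case (elim h)
        show ?case
        proof
          fix k
          have "sob_amp n ((1 / h) *\<^sub>R (heat h v - v) - w) k =
              \<bar>(exp (- h * (norm (rvec k))\<^sup>2) - 1) / h + (norm (rvec k))\<^sup>2\<bar> * sob_amp n v k"
            by (simp add: sob_amp_def co[OF elim])
          also have "\<dots> \<le> (norm (rvec k))\<^sup>2 * sob_amp n v k"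
            by (rule mult_right_mono[OF abs_difference_quotient_exp_le[OF elim]]) simp_all
          also have "\<dots> = sob_amp n (laplacian v) k" by (simp add: sob_amp_def fcoeff_laplacian)
          finally show "sob_amp n ((1 / h) *\<^sub>R (heat h v - v) - w) k \<le> sob_amp (n + 2) v k"
            by (simp add: sob_amp_laplacian)
        qed
      qed
      show "((\<lambda>h. fcoeff ((1 / h) *\<^sub>R (heat h v - v) - w) k) \<longlongrightarrow> 0) (at_right 0)" for k
      proof -
        let ?x = "(norm (rvec k))\<^sup>2"
        have "((\<lambda>h. ((exp (- h * ?x) - 1) / h + ?x) *\<^sub>R fcoeff v k) \<longlongrightarrow> (- ?x + ?x) *\<^sub>R fcoeff v k) (at_right 0)"
          by (intro tendsto_intros difference_quotient_exp)
        then have "((\<lambda>h. ((exp (- h * ?x) - 1) / h + ?x) *\<^sub>R fcoeff v k) \<longlongrightarrow> 0) (at_right 0)" by simp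
        then show ?thesis
          by (rule Lim_transform_eventually) (use pos in eventually_elim, simp only: co)
      qed
    qed
  next
    assume R: ?R
    have "fcoeff (laplacian v) k = fcoeff w k" for k
    proof -
      let ?x = "(norm (rvec k))\<^sup>2"
      have "eventually (\<lambda>h. (1 / h) *\<^sub>R (heat h v - v) - w \<in> Sob0 n) (at_right 0)"
        using pos
      proof eventually_elim
        case (elim h)
        have "heat h v \<in> SobS0 n" using elim by (intro heat_contraction v) simp
        then show ?case
          by (intro SobS0_imp_Sob0 SobS0_diff subspace_scale[OF subspace_SobS0] v w)
      qed
      from tendsto_fcoeff[OF R this]
      have 1: "((\<lambda>h. fcoeff ((1 / h) *\<^sub>R (heat h v - v) - w) k) \<longlongrightarrow> 0) (at_right 0)" .
      have "((\<lambda>h. ((exp (- h * ?x) - 1) / h) *\<^sub>R fcoeff v k - fcoeff w k) \<longlongrightarrow> (- ?x) *\<^sub>R fcoeff v k - fcoeff w k) (at_right 0)"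
        by (intro tendsto_intros difference_quotient_exp)
      then have 2: "((\<lambda>h. fcoeff ((1 / h) *\<^sub>R (heat h v - v) - w) k) \<longlongrightarrow> (- ?x) *\<^sub>R fcoeff v k - fcoeff w k) (at_right 0)"
        by (rule Lim_transform_eventually) (use pos in eventually_elim, simp only: fcoeff_heat_difference_quotient)
      have "(- ?x) *\<^sub>R fcoeff v k - fcoeff w k = 0"
        by (rule tendsto_unique[OF _ 2 1]) simp
      then show ?thesis by (simp add: fcoeff_laplacian)
    qed
    then have eq: "laplacian v = w" by (rule vfield_fcoeff_eqI)
    have "sob_amp (n + 2) v k \<le> 1 * sob_amp n w k" for k
      by (simp add: eq[symmetric] sob_amp_laplacian)
    from Sob0_dominated(1)[OF SobS0_imp_Sob0[OF w] _ _ this] v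
    have "v \<in> SobS0 (n + 2)" by (simp add: SobS0_iff Sob0_iff)
    then show ?L using eq by simp
  }
qed

lemma generates_heat:
  assumes A: "\<And>v. v \<in> SobS0 (n + 2) \<Longrightarrow> A v = laplacian v"
  shows "generates (SobS0 n :: ('d::finite) vfield set) (Sob_norm n) (SobS0 (n + 2)) A heat"
  unfolding generates_def
proof (intro conjI ballI C0_semigroup_heat)
  show "SobS0 (n + 2) \<subseteq> (SobS0 n :: 'd vfield set)" by (rule SobS0_mono) simp
  show "A \<in> SobS0 (n + 2) \<rightarrow> SobS0 n" by (simp add: A laplacian_Sobolev)
  fix v w :: "'d vfield" assume "v \<in> SobS0 n" "w \<in> SobS0 n"
  from heat_generator_iff[OF this]
  show "v \<in> SobS0 (n + 2) \<and> A v = w \<longleftrightarrow>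
    ((\<lambda>h. Sob_norm n ((1 / h) *\<^sub>R (heat h v - v) - w)) \<longlongrightarrow> 0) (at_right 0)"
    by (simp only: A cong: conj_cong)
qed

lemma heat_tendsto_initial:
  assumes "v \<in> SobS0 n"
  shows "((\<lambda>h. Sob_norm n (heat h v - v)) \<longlongrightarrow> 0) (at_right 0)"
proof -
  have ev: "eventually (\<lambda>h::real. 0 \<le> h) (at_right 0)"
    using eventually_at_right_less[of "0::real"] by eventually_elim simp
  have "((\<lambda>h. Sob_norm n (heat h v - heat 0 v)) \<longlongrightarrow> 0) (at_right 0)"
    by (rule heat_tendsto[where s = 0 and C = 1 and n = n, OF _ _ ev _ _ SobS0_imp_Sob0[OF assms]])
      simp_all
  then show ?thesis by (simp add: heat_zero)
qed

text \<open>
  A field \<open>v\<close> is approximated by \<open>heat h v\<close>, which for \<open>h > 0\<close> lies in every smaller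
  Sobolev space.
\<close>

lemma densely_defined_laplacian:
  assumes A: "\<And>v. v \<in> SobS0 (n + 2) \<Longrightarrow> A v = laplacian v"
  shows "densely_defined (SobS0 n :: ('d::finite) vfield set) (Sob_norm n) (SobS0 (n + 2)) A"
proof -
  interpret Metric_space "SobS0 n :: 'd vfield set" "norm_dist (SobS0 n) (Sob_norm n)"
    by (rule Metric_space_SobS0)
  have sub: "SobS0 (n + 2) \<subseteq> (SobS0 n :: 'd vfield set)" by (rule SobS0_mono) simp
  have dense: "\<exists>w\<in>SobS0 (n + 2). w \<in> mball v r" if v: "v \<in> SobS0 n" and r: "0 < r" for v r
  proof -
    have "eventually (\<lambda>h. Sob_norm n (heat h v - v) < r) (at_right 0)"
      by (rule order_tendstoD(2)[OF heat_tendsto_initial[OF v] r])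
    then have "eventually (\<lambda>h. 0 < h \<and> Sob_norm n (heat h v - v) < r) (at_right 0)"
      using eventually_at_right_less[of "0::real"] by eventually_elim simp
    then obtain h where h: "0 < h" "Sob_norm n (heat h v - v) < r"
      using eventually_happens'[of "at_right (0::real)"] by (auto simp: trivial_limit_at_right_real)
    have "heat h v \<in> SobS0 (n + 2)" by (rule heat_regularizes[OF h(1) _ v]) simp
    moreover from this have "heat h v \<in> mball v r"
      using sub v h(2) Sob_norm_minus_commute[of n v "heat h v"] by auto
    ultimately show ?thesis by blast
  qed
  have "mtopology closure_of SobS0 (n + 2) = SobS0 n"
    unfolding metric_closure_of using dense by blast
  then show ?thesis
    unfolding densely_defined_def using sub linear_map_on_laplacian[OF A] by blast
qed

section \<open>A semigroup is determined by its generator\<close>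

text \<open>
  For \<open>e > 0\<close> let \<open>z\<close> be the supremum of the times up to which \<open>f\<close> moves away from
  \<open>f 0\<close> at speed at most \<open>e\<close>.  By continuity the bound holds at \<open>z\<close>, and if \<open>z < t\<close>, the
  right derivative would extend it beyond \<open>z\<close>.
\<close>

lemma right_derivative_zero_imp_constant:
  fixes f :: "real \<Rightarrow> 'a::real_normed_vector"
  assumes cont: "continuous_on {0..} f"
    and deriv: "\<And>s. 0 \<le> s \<Longrightarrow> ((\<lambda>h. (1 / h) *\<^sub>R (f (s + h) - f s)) \<longlongrightarrow> 0) (at_right 0)"
    and t: "0 \<le> t"
  shows "f t = f 0"
proof -
  have le: "norm (f t - f 0) \<le> e * t" if e: "0 < e" for e
  proof -
    define S where "S = {s \<in> {0..t}. \<forall>r\<in>{0..s}. norm (f r - f 0) \<le> e * r}"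
    define z where "z = Sup S"
    have S0: "0 \<in> S" using t by (simp add: S_def)
    have bdd: "bdd_above S" by (rule bdd_aboveI[of _ t]) (simp add: S_def)
    have z0: "0 \<le> z" unfolding z_def by (rule cSup_upper[OF S0 bdd])
    have zt: "z \<le> t" unfolding z_def by (rule cSup_least) (use S0 in \<open>auto simp: S_def\<close>)
    have below: "norm (f r - f 0) \<le> e * r" if r: "0 \<le> r" "r < z" for r
    proof -
      obtain s where "s \<in> S" "r < s" using less_cSupD[of S r] S0 r(2) by (auto simp: z_def)
      then show ?thesis using r(1) by (simp add: S_def)
    qed
    have at_z: "norm (f z - f 0) \<le> e * z"
    proof (cases "z = 0")
      case False
      with z0 have z: "0 < z" by simp
      have "closed {r \<in> {0..z}. norm (f r - f 0) \<le> e * r}"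
        by (intro continuous_on_closed_Collect_le continuous_intros continuous_on_subset[OF cont]) auto
      moreover have "{0<..<z} \<subseteq> {r \<in> {0..z}. norm (f r - f 0) \<le> e * r}" using below by auto
      ultimately have "closure {0<..<z} \<subseteq> {r \<in> {0..z}. norm (f r - f 0) \<le> e * r}" by (rule closure_minimal[rotated])
      moreover have "z \<in> closure {0<..<z}" using z by simp
      ultimately show ?thesis by blast
    qed simp
    have "z = t"
    proof (rule ccontr)
      assume "z \<noteq> t"
      with zt have zt: "z < t" by simp
      have "((\<lambda>h. norm ((1 / h) *\<^sub>R (f (z + h) - f z))) \<longlongrightarrow> 0) (at_right 0)"
        by (rule tendsto_norm_zero[OF deriv[OF z0]])
      from order_tendstoD(2)[OF this e]
      obtain b where b: "0 < b" "\<And>h. 0 < h \<Longrightarrow> h < b \<Longrightarrow> norm ((1 / h) *\<^sub>R (f (z + h) - f z)) < e"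
        unfolding eventually_at_right_field by auto
      have step: "norm (f (z + h) - f 0) \<le> e * (z + h)" if h: "0 \<le> h" "h < b" for h
      proof (cases "h = 0")
        case True
        then show ?thesis using at_z by simp
      next
        case False
        with h have h0: "0 < h" by simp
        have "norm (f (z + h) - f z) / h < e" using b(2)[OF h0 h(2)] h0 by simp
        then have "norm (f (z + h) - f z) \<le> e * h" using h0 by (simp add: field_simps)
        moreover have "norm (f (z + h) - f 0) \<le> norm (f (z + h) - f z) + norm (f z - f 0)"
          using norm_triangle_ineq[of "f (z + h) - f z" "f z - f 0"] by simp
        ultimately show ?thesis using at_z by (simp add: distrib_left)
      qed
      define h where "h = min (b / 2) (t - z)"
      have h: "0 < h" "h < b" "z + h \<le> t" using b(1) zt by (auto simp: h_def)
      have "norm (f r - f 0) \<le> e * r" if r: "0 \<le> r" "r \<le> z + h" for r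
      proof (cases "r < z")
        case True
        then show ?thesis by (rule below[OF r(1)])
      next
        case False
        then show ?thesis using step[of "r - z"] r h by simp
      qed
      then have "z + h \<in> S" using h z0 by (simp add: S_def)
      then have "z + h \<le> z" unfolding z_def by (rule cSup_upper[OF _ bdd])
      then show False using h by simp
    qed
    then show ?thesis using at_z by simp
  qed
  have "norm (f t - f 0) \<le> 0"
  proof (rule field_le_epsilon)
    fix e :: real assume e: "0 < e"
    have "norm (f t - f 0) \<le> e / (t + 1) * t" by (rule le) (use e t in simp)
    also have "\<dots> \<le> e" using e t by (simp add: field_simps)
    finally show "norm (f t - f 0) \<le> 0 + e" by simp
  qed
  then show ?thesis by simp
qed

lemma continuous_map_norm_topology_imp_tendsto:
  fixes g :: "real \<Rightarrow> ('d::finite) vfield"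
  assumes cont: "continuous_map (top_of_set S) (norm_topology (SobS0 n) (Sob_norm n)) g"
    and t: "t \<in> S"
  shows "((\<lambda>s. Sob_norm n (g s - g t)) \<longlongrightarrow> 0) (at t within S)"
proof (rule tendstoI)
  fix e :: real assume e: "0 < e"
  interpret Metric_space "SobS0 n :: 'd vfield set" "norm_dist (SobS0 n) (Sob_norm n)"
    by (rule Metric_space_SobS0)
  have "t \<in> topspace (top_of_set S)" using t by simp
  with cont e obtain U where U: "openin (top_of_set S) U" "t \<in> U" "\<forall>s\<in>U. g s \<in> mball (g t) e"
    unfolding continuous_map_to_metric by blast
  then obtain V where V: "open V" "U = S \<inter> V" by (auto simp: openin_open)
  have "eventually (\<lambda>s. s \<in> V) (at t within S)" using V U(2) by (intro topological_tendstoD[OF tendsto_ident_at]) auto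
  moreover have "eventually (\<lambda>s. s \<in> S) (at t within S)" by (simp add: eventually_at_filter)
  ultimately show "eventually (\<lambda>s. dist (Sob_norm n (g s - g t)) 0 < e) (at t within S)"
  proof eventually_elim
    case (elim s)
    then have "s \<in> U" using V(2) by blast
    then have m: "g s \<in> mball (g t) e" using U(3) by blast
    then have "g t \<in> SobS0 n" "g s \<in> SobS0 n" by simp_all
    then have "Sob_norm n (g t - g s) < e" using m by simp
    then show ?case by (simp add: Sob_norm_minus_commute)
  qed
qed

text \<open>
  On the domain of the generator the orbits of the semigroup are differentiable from the right,
  so that each Fourier coefficient solves \<open>c' = - |k|\<^sup>2 c\<close>; hence they are the orbits of
  the heat flow.  Density of the domain extends this to the whole space.
\<close>

lemma generated_semigroup_eq_heat:
  fixes A :: "('d::finite) vfield \<Rightarrow> 'd vfield"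
  assumes gen: "generates (SobS0 n) (Sob_norm n) (SobS0 (n + 2)) A T"
    and A: "\<And>v. v \<in> SobS0 (n + 2) \<Longrightarrow> A v = laplacian v"
    and t: "0 \<le> t" and v: "v \<in> SobS0 n"
  shows "T t v = heat t v"
proof -
  have C0: "C0_semigroup (SobS0 n) (Sob_norm n) T"
    and iff: "\<And>v w. v \<in> SobS0 n \<Longrightarrow> w \<in> SobS0 n \<Longrightarrow> v \<in> SobS0 (n + 2) \<and> A v = w \<longleftrightarrow>
        ((\<lambda>h. Sob_norm n ((1 / h) *\<^sub>R (T h v - v) - w)) \<longlongrightarrow> 0) (at_right 0)"
    using gen unfolding generates_def by blast+
  have sub: "v \<in> SobS0 n" if "v \<in> SobS0 (n + 2)" for v :: "'d vfield"
    using SobS0_mono[of n "n + 2"] that by auto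
  have TX: "T s v \<in> SobS0 n" if "0 \<le> s" "v \<in> SobS0 n" for s v
    using C0 that unfolding C0_semigroup_def linear_map_on_def by blast
  have Tadd: "T s (v + w) = T s v + T s w" if "0 \<le> s" "v \<in> SobS0 n" "w \<in> SobS0 n" for s v w
    using C0 that unfolding C0_semigroup_def linear_map_on_def by blast
  have Tscale: "T s (a *\<^sub>R v) = a *\<^sub>R T s v" if "0 \<le> s" "v \<in> SobS0 n" for s a v
    using C0 that unfolding C0_semigroup_def linear_map_on_def by blast
  have Tbound: "\<exists>C. \<forall>v\<in>SobS0 n. Sob_norm n (T s v) \<le> C * Sob_norm n v" if "0 \<le> s" for s
    using C0 that unfolding C0_semigroup_def by blast
  have T0: "T 0 v = v" if "v \<in> SobS0 n" for v
    using C0 that unfolding C0_semigroup_def by blast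
  have Tsg: "T (s + r) v = T s (T r v)" if "0 \<le> s" "0 \<le> r" "v \<in> SobS0 n" for s r v
    using C0 that unfolding C0_semigroup_def by blast
  have Tcont: "continuous_map (top_of_set {0..}) (norm_topology (SobS0 n) (Sob_norm n)) (\<lambda>s. T s v)"
    if "v \<in> SobS0 n" for v
    using C0 that unfolding C0_semigroup_def by blast
  have scX: "a *\<^sub>R v \<in> SobS0 n" if "v \<in> SobS0 n" for a and v :: "'d vfield"
    by (rule subspace_scale[OF subspace_SobS0 that])
  have Tdiff: "T s (v - w) = T s v - T s w" if "0 \<le> s" "v \<in> SobS0 n" "w \<in> SobS0 n" for s v w
    using Tadd[OF that(1,2) scX[OF that(3)], of "-1"] Tscale[OF that(1,3), of "-1"] by simp
  have lapX: "laplacian v \<in> SobS0 n" if "v \<in> SobS0 (n + 2)" for v :: "'d vfield"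
    by (rule laplacian_Sobolev(1)[OF that])
  have pos: "eventually (\<lambda>h::real. 0 < h) (at_right 0)" by (rule eventually_at_right_less)
  have quot: "((\<lambda>h. Sob_norm n ((1 / h) *\<^sub>R (T h (T s v) - T s v) - T s (laplacian v))) \<longlongrightarrow> 0) (at_right 0)"
    if s: "0 \<le> s" and v2: "v \<in> SobS0 (n + 2)" for s v
  proof -
    note v = sub[OF v2] and w = lapX[OF v2]
    obtain C where C: "\<forall>v\<in>SobS0 n. Sob_norm n (T s v) \<le> C * Sob_norm n v" using Tbound[OF s] by blast
    have lim: "((\<lambda>h. Sob_norm n ((1 / h) *\<^sub>R (T h v - v) - laplacian v)) \<longlongrightarrow> 0) (at_right 0)"
      using iff[OF v w] v2 A[OF v2] by blast
    show ?thesis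
    proof (rule Lim_null_comparison)
      show "((\<lambda>h. C * Sob_norm n ((1 / h) *\<^sub>R (T h v - v) - laplacian v)) \<longlongrightarrow> 0) (at_right 0)"
        by (rule tendsto_mult_right_zero[OF lim])
      show "eventually (\<lambda>h. norm (Sob_norm n ((1 / h) *\<^sub>R (T h (T s v) - T s v) - T s (laplacian v)))
          \<le> C * Sob_norm n ((1 / h) *\<^sub>R (T h v - v) - laplacian v)) (at_right 0)"
        using pos
      proof eventually_elim
        case (elim h)
        then have h: "0 \<le> h" by simp
        have Thv: "T h v \<in> SobS0 n" by (rule TX[OF h v])
        have "T h (T s v) = T s (T h v)" using Tsg[OF h s v] Tsg[OF s h v] by (simp add: add.commute)
        then have "(1 / h) *\<^sub>R (T h (T s v) - T s v) - T s (laplacian v) =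
            T s ((1 / h) *\<^sub>R (T h v - v) - laplacian v)"
          by (simp only: Tdiff[OF s scX[OF SobS0_diff[OF Thv v]] w] Tscale[OF s SobS0_diff[OF Thv v]]
              Tdiff[OF s Thv v])
        then show ?case
          using C SobS0_diff[OF scX[OF SobS0_diff[OF Thv v]] w] by simp
      qed
    qed
  qed
  have on_domain: "T t v = heat t v" if v2: "v \<in> SobS0 (n + 2)" for v
  proof (rule vfield_fcoeff_eqI)
    fix k :: "int^'d"
    note v = sub[OF v2] and w = lapX[OF v2]
    let ?x = "(norm (rvec k))\<^sup>2"
    let ?c = "\<lambda>s. fcoeff (T s v) k"
    let ?f = "\<lambda>s. exp (s * ?x) *\<^sub>R ?c s"
    have right: "((\<lambda>h. (1 / h) *\<^sub>R (?c (s + h) - ?c s)) \<longlongrightarrow> (- ?x) *\<^sub>R ?c s) (at_right 0)"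
      if s: "0 \<le> s" for s
    proof -
      note Ts = TX[OF s v] and Tw = TX[OF s w]
      have "T s v \<in> SobS0 (n + 2) \<and> A (T s v) = T s (laplacian v)"
        using iff[OF Ts Tw] quot[OF s v2] by blast
      then have lap: "laplacian (T s v) = T s (laplacian v)" using A by metis
      have "eventually (\<lambda>h. (1 / h) *\<^sub>R (T h (T s v) - T s v) - T s (laplacian v) \<in> Sob0 n) (at_right 0)"
        using pos
      proof eventually_elim
        case (elim h)
        then have "0 \<le> h" by simp
        then show ?case by (rule SobS0_imp_Sob0[OF SobS0_diff[OF scX[OF SobS0_diff[OF TX[OF _ Ts] Ts]] Tw]])
      qed
      from tendsto_add[OF tendsto_fcoeff[OF quot[OF s v2] this, of k] tendsto_const[of "fcoeff (T s (laplacian v)) k"]]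
      have "((\<lambda>h. fcoeff ((1 / h) *\<^sub>R (T h (T s v) - T s v)) k) \<longlongrightarrow> fcoeff (T s (laplacian v)) k) (at_right 0)"
        by (simp add: fcoeff_diff)
      moreover have "fcoeff (T s (laplacian v)) k = (- ?x) *\<^sub>R ?c s"
        by (simp add: lap[symmetric] fcoeff_laplacian)
      ultimately have "((\<lambda>h. fcoeff ((1 / h) *\<^sub>R (T h (T s v) - T s v)) k) \<longlongrightarrow> (- ?x) *\<^sub>R ?c s) (at_right 0)"
        by (simp only:)
      then show ?thesis
      proof (rule Lim_transform_eventually)
        show "eventually (\<lambda>h. fcoeff ((1 / h) *\<^sub>R (T h (T s v) - T s v)) k = (1 / h) *\<^sub>R (?c (s + h) - ?c s)) (at_right 0)"
          using pos
        proof eventually_elim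
          case (elim h)
          then show ?case
            using Tsg[of h s v] s v by (simp add: fcoeff_scaleR fcoeff_diff add.commute)
        qed
      qed
    qed
    have cont: "continuous_on {0..} ?c"
      unfolding continuous_on_def
    proof
      fix s :: real assume s: "s \<in> {0..}"
      have "((\<lambda>r. fcoeff (T r v - T s v) k) \<longlongrightarrow> 0) (at s within {0..})"
      proof (rule tendsto_fcoeff[OF continuous_map_norm_topology_imp_tendsto[OF Tcont[OF v] s]])
        have "eventually (\<lambda>r. r \<in> {0..}) (at s within {0..})" by (simp add: eventually_at_filter)
        then show "eventually (\<lambda>r. T r v - T s v \<in> Sob0 n) (at s within {0..})"
          by eventually_elim (use s TX v in \<open>simp add: SobS0_imp_Sob0 SobS0_diff\<close>)
      qed
      then show "(?c \<longlongrightarrow> ?c s) (at s within {0..})"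
        unfolding fcoeff_diff by (rule LIM_zero_cancel)
    qed
    \<comment> \<open>The integrating factor turns the equation into a vanishing right derivative.\<close>
    have "?f t = ?f 0"
    proof (rule right_derivative_zero_imp_constant[OF _ _ t])
      show "continuous_on {0..} ?f" by (intro continuous_intros cont)
      fix s :: real assume s: "0 \<le> s"
      have c0: "((\<lambda>h. ?c (s + h)) \<longlongrightarrow> ?c s) (at_right 0)"
      proof -
        have "((\<lambda>h. h *\<^sub>R ((1 / h) *\<^sub>R (?c (s + h) - ?c s))) \<longlongrightarrow> 0 *\<^sub>R ((- ?x) *\<^sub>R ?c s)) (at_right 0)"
          by (intro tendsto_scaleR right[OF s]) (rule tendsto_ident_at)
        then have "((\<lambda>h. h *\<^sub>R ((1 / h) *\<^sub>R (?c (s + h) - ?c s))) \<longlongrightarrow> 0) (at_right 0)" by simp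
        then have "((\<lambda>h. ?c (s + h) - ?c s) \<longlongrightarrow> 0) (at_right 0)"
          by (rule Lim_transform_eventually) (use pos in eventually_elim, simp)
        then show ?thesis by (rule LIM_zero_cancel)
      qed
      have e: "((\<lambda>h. (exp (h * ?x) - 1) / h) \<longlongrightarrow> ?x) (at_right 0)"
        using difference_quotient_exp[of "- ?x"] by simp
      have "((\<lambda>h. exp (s * ?x) *\<^sub>R (((exp (h * ?x) - 1) / h) *\<^sub>R ?c (s + h) + (1 / h) *\<^sub>R (?c (s + h) - ?c s)))
          \<longlongrightarrow> exp (s * ?x) *\<^sub>R (?x *\<^sub>R ?c s + (- ?x) *\<^sub>R ?c s)) (at_right 0)"
        by (intro tendsto_intros e c0 right[OF s])
      then have "((\<lambda>h. exp (s * ?x) *\<^sub>R (((exp (h * ?x) - 1) / h) *\<^sub>R ?c (s + h) + (1 / h) *\<^sub>R (?c (s + h) - ?c s)))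
          \<longlongrightarrow> 0) (at_right 0)" by simp
      moreover have "exp (s * ?x) *\<^sub>R (((exp (h * ?x) - 1) / h) *\<^sub>R ?c (s + h) + (1 / h) *\<^sub>R (?c (s + h) - ?c s))
          = (1 / h) *\<^sub>R (?f (s + h) - ?f s)" for h
      proof -
        have ex: "exp ((s + h) * ?x) = exp (s * ?x) * exp (h * ?x)" by (simp add: distrib_right exp_add)
        have alg: "a *\<^sub>R (((b - 1) / h) *\<^sub>R y + (1 / h) *\<^sub>R (y - z)) = (1 / h) *\<^sub>R ((a * b) *\<^sub>R y - a *\<^sub>R z)"
          for a b :: real and y z :: "complex^'d"
        proof -
          have "((b - 1) / h) *\<^sub>R y = (1 / h) *\<^sub>R (b *\<^sub>R y - y)"
            by (simp add: scaleR_left_diff_distrib scaleR_diff_right diff_divide_distrib)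
          then have "((b - 1) / h) *\<^sub>R y + (1 / h) *\<^sub>R (y - z) = (1 / h) *\<^sub>R (b *\<^sub>R y - z)"
            by (simp flip: scaleR_add_right)
          then have "a *\<^sub>R (((b - 1) / h) *\<^sub>R y + (1 / h) *\<^sub>R (y - z)) = a *\<^sub>R ((1 / h) *\<^sub>R (b *\<^sub>R y - z))"
            by (rule arg_cong)
          also have "\<dots> = (1 / h) *\<^sub>R (a *\<^sub>R (b *\<^sub>R y - z))" by (rule scaleR_left_commute)
          also have "\<dots> = (1 / h) *\<^sub>R ((a * b) *\<^sub>R y - a *\<^sub>R z)"
            by (simp only: scaleR_right_diff_distrib scaleR_scaleR)
          finally show ?thesis .
        qed
        show ?thesis unfolding ex by (rule alg)
      qed
      ultimately show "((\<lambda>h. (1 / h) *\<^sub>R (?f (s + h) - ?f s)) \<longlongrightarrow> 0) (at_right 0)" by (simp only:)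
    qed
    then have f: "exp (t * ?x) *\<^sub>R ?c t = fcoeff v k" using T0[OF v] by simp
    have "exp (- t * ?x) *\<^sub>R (exp (t * ?x) *\<^sub>R ?c t) = ?c t"
      by (simp flip: exp_add)
    then show "?c t = fcoeff (heat t v) k" using f by (simp add: fcoeff_heat[OF t])
  qed
  obtain C where C: "\<forall>v\<in>SobS0 n. Sob_norm n (T t v) \<le> C * Sob_norm n v" using Tbound[OF t] by blast
  have HX: "heat s v \<in> SobS0 n" if "0 \<le> s" "v \<in> SobS0 n" for s and v :: "'d vfield"
    by (rule heat_contraction(1)[OF that])
  have "((\<lambda>h. Sob_norm n (T t v - heat t v)) \<longlongrightarrow> 0) (at_right (0::real))"
  proof (rule Lim_null_comparison)
    show "((\<lambda>h. (C + exp (- t)) * Sob_norm n (heat h v - v)) \<longlongrightarrow> 0) (at_right 0)"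
      by (rule tendsto_mult_right_zero[OF heat_tendsto_initial[OF v]])
    show "eventually (\<lambda>h. norm (Sob_norm n (T t v - heat t v)) \<le> (C + exp (- t)) * Sob_norm n (heat h v - v)) (at_right 0)"
      using pos
    proof eventually_elim
      case (elim h)
      then have h: "0 \<le> h" by simp
      let ?u = "heat h v"
      have u: "?u \<in> SobS0 n" by (rule HX[OF h v])
      have u2: "?u \<in> SobS0 (n + 2)" by (rule heat_regularizes[OF elim _ v]) simp
      have d: "v - ?u \<in> SobS0 n" "?u - v \<in> SobS0 n" by (intro SobS0_diff u v)+
      have "T t v - heat t v = T t (v - ?u) + heat t (?u - v)"
        by (simp add: Tdiff[OF t v u] heat_diff[OF t] on_domain[OF u2])
      then have "Sob_norm n (T t v - heat t v) \<le> Sob_norm n (T t (v - ?u)) + Sob_norm n (heat t (?u - v))"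
        using Sob_norm_triangle[OF TX[OF t d(1)] HX[OF t d(2)]] by simp
      also have "\<dots> \<le> C * Sob_norm n (v - ?u) + exp (- t) * Sob_norm n (?u - v)"
        using C d(1) heat_contraction(2)[OF t d(2)] by (intro add_mono) simp_all
      also have "\<dots> = (C + exp (- t)) * Sob_norm n (?u - v)"
        by (simp add: Sob_norm_minus_commute[of n v] distrib_right)
      finally show ?case by simp
    qed
  qed
  then have "Sob_norm n (T t v - heat t v) = 0" by (simp add: tendsto_const_iff)
  then have "T t v - heat t v = 0"
    by (rule Sob_norm_eq_0[OF SobS0_imp_Sob0[OF SobS0_diff[OF TX[OF t v] HX[OF t v]]]])
  then show ?thesis by simp
qed

section \<open>The smoothing rate\<close>

lemma mu_heat_pos:
  assumes "0 < \<omega>" "0 < t"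
  shows "0 < mu_heat \<omega> t"
  using assms by (simp add: mu_heat_def)

lemma continuous_on_mu_heat:
  assumes "0 < \<omega>"
  shows "continuous_on {0<..} (mu_heat \<omega>)"
  unfolding mu_heat_def
proof (rule continuous_on_cases_le)
  show "continuous_on {t \<in> {0<..}. t \<le> (1 + \<omega>) / 2}
      (\<lambda>t. ((1 + \<omega>) / (2 * exp 1 * t)) powr ((1 + \<omega>) / 2) * exp t)"
    using assms by (intro continuous_intros) auto
  show "continuous_on {t \<in> {0<..}. (1 + \<omega>) / 2 \<le> t} (\<lambda>t. 1 :: real)" by simp
  show "continuous_on {0<..} (\<lambda>t::real. t)" by simp
  fix t :: real assume t: "t = (1 + \<omega>) / 2"
  have "2 * exp 1 * t = exp 1 * (1 + \<omega>)" by (simp add: t)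
  then have "(1 + \<omega>) / (2 * exp 1 * t) = exp (- 1)" using assms by (simp only:) (simp add: exp_minus inverse_eq_divide)
  then have "((1 + \<omega>) / (2 * exp 1 * t)) powr ((1 + \<omega>) / 2) = exp (- t)"
    by (simp add: t powr_def)
  then show "((1 + \<omega>) / (2 * exp 1 * t)) powr ((1 + \<omega>) / 2) * exp t = 1"
    by (simp flip: exp_add)
qed

text \<open>
  For small times the bound is the maximum of the symbol over all positive numbers; for
  \<open>t > (1 + \<omega>) / 2\<close> the symbol decreases on \<open>[1, \<infinity>)\<close> and the lowest
  frequency dominates.
\<close>

lemma symbol_le_mu_heat:
  assumes "0 < \<omega>" "0 < t" "1 \<le> x"
  shows "x powr (1 + \<omega>) * exp (- t * x\<^sup>2) \<le> mu_heat \<omega> t * exp (- t)"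
proof (cases "t \<le> (1 + \<omega>) / 2")
  case True
  have "x powr (1 + \<omega>) * exp (- t * x\<^sup>2) \<le> ((1 + \<omega>) / 2 / (exp 1 * t)) powr ((1 + \<omega>) / 2)"
    using assms by (intro powr_mult_exp_square_le) simp_all
  also have "(1 + \<omega>) / 2 / (exp 1 * t) = (1 + \<omega>) / (2 * exp 1 * t)" by simp
  also have "((1 + \<omega>) / (2 * exp 1 * t)) powr ((1 + \<omega>) / 2) = mu_heat \<omega> t * exp (- t)"
    using True by (simp add: mu_heat_def mult.assoc flip: exp_add)
  finally show ?thesis .
next
  case False
  let ?y = "x\<^sup>2"
  have y: "1 \<le> ?y" using assms(3) by simp
  have "ln ?y \<le> ?y - 1" using y by (intro ln_le_minus_one) linarith
  then have "(1 + \<omega>) / 2 * ln ?y \<le> (1 + \<omega>) / 2 * (?y - 1)" using assms(1) by (intro mult_left_mono) simp_all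
  also have "\<dots> \<le> t * (?y - 1)" using False y by (intro mult_right_mono) simp_all
  finally have "(1 + \<omega>) * ln x \<le> t * ?y - t" using assms(3) by (simp add: ln_realpow right_diff_distrib)
  then have "exp ((1 + \<omega>) * ln x + - t * ?y) \<le> exp (- t)" by simp
  then have "exp ((1 + \<omega>) * ln x) * exp (- t * ?y) \<le> exp (- t)" by (simp only: exp_add)
  then show ?thesis using False assms(3) by (simp add: mu_heat_def powr_def)
qed

text \<open>
  This isolates the singularity at \<open>t = 0\<close>, whose exponent is \<open>(1 + \<omega>) / 2\<close>; the
  remaining factor \<open>exp (t - (1 + \<omega>) / 2)\<close> is at most 1.
\<close>

lemma mu_heat_le_powr:
  assumes "0 < \<omega>" "0 \<le> t" "t \<le> (1 + \<omega>) / 2"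
  shows "mu_heat \<omega> t \<le> ((1 + \<omega>) / 2) powr ((1 + \<omega>) / 2) * t powr (- ((1 + \<omega>) / 2))"
proof (cases "t = 0")
  case True
  \<comment> \<open>Both sides are 0 here, by division by zero and \<open>0 powr a = 0\<close>.\<close>
  then show ?thesis using assms by (simp add: mu_heat_def)
next
  case False
  let ?a = "(1 + \<omega>) / 2"
  have t: "0 < t" using False assms by simp
  have eq: "(1 + \<omega>) / (2 * exp 1 * t) = ?a * inverse (exp 1) * inverse t"
    by (simp add: field_simps)
  have "((1 + \<omega>) / (2 * exp 1 * t)) powr ?a = ?a powr ?a * inverse (exp 1) powr ?a * inverse t powr ?a"
    unfolding eq using assms t by (simp only: powr_mult) 
  also have "inverse (exp 1) powr ?a = exp (- ?a)" by (simp add: powr_def ln_inverse)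
  also have "inverse t powr ?a = t powr (- ?a)" using t by (simp add: powr_minus inverse_powr)
  finally have "mu_heat \<omega> t = ?a powr ?a * exp (- ?a) * t powr (- ?a) * exp t"
    by (simp only: mu_heat_def assms(3) if_True)
  also have "\<dots> = (?a powr ?a * t powr (- ?a)) * (exp t * exp (- ?a))" by (simp only: ac_simps)
  also have "exp t * exp (- ?a) = exp (t - ?a)" by (simp flip: exp_add)
  finally have "mu_heat \<omega> t = (?a powr ?a * t powr (- ?a)) * exp (t - ?a)" .
  also have "\<dots> \<le> (?a powr ?a * t powr (- ?a)) * 1"
    using assms by (intro mult_left_mono) simp_all
  finally show ?thesis by simp
qed

lemma mu_heat_bigo:
  assumes "0 < \<omega>"
  shows "mu_heat \<omega> \<in> O[at_right 0](\<lambda>t. 1 / t powr ((1 + \<omega>) / 2))"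
proof (rule bigoI)
  let ?a = "(1 + \<omega>) / 2"
  have "eventually (\<lambda>t. t \<in> {0<..<?a}) (at_right 0)"
    by (rule eventually_at_right_real) (use assms in simp)
  then show "eventually (\<lambda>t. norm (mu_heat \<omega> t) \<le> ?a powr ?a * norm (1 / t powr ?a)) (at_right 0)"
  proof eventually_elim
    case (elim t)
    then have "0 < mu_heat \<omega> t" using mu_heat_pos[OF assms, of t] by simp
    then show ?case using mu_heat_le_powr[OF assms, of t] elim by (simp add: powr_minus_divide)
  qed
qed

text \<open>
  The rate is 1 for large times and otherwise dominated by a power of exponent greater than
  \<open>- 1\<close>.  The first part contributes at most the total mass of \<open>exp (- s)\<close>, the second,
  where \<open>exp (- s)\<close> is estimated by 1, the integral \<open>I\<close> of the power.
\<close>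

lemma mu_heat_convolution_bounded:
  assumes "0 < \<omega>" "\<omega> < 1"
  shows "(SUP t\<in>{0..}. \<integral>\<^sup>+ s\<in>{0..t}. ennreal (exp (- s) * mu_heat \<omega> (t - s)) \<partial>lborel) < \<infinity>"
proof -
  let ?a = "(1 + \<omega>) / 2"
  define K where "K = ?a powr ?a"
  define g where "g u = ennreal (K * u powr (- ?a)) * indicator {0..?a} u" for u :: real
  define I where "I = K * (?a powr (- ?a + 1) / (- ?a + 1))"
  have g[measurable]: "g \<in> borel_measurable borel" unfolding g_def by measurable
  have K0: "0 \<le> K" by (simp add: K_def)
  have intg: "(\<integral>\<^sup>+ u. g u \<partial>lborel) = ennreal I"
  proof -
    have "((\<lambda>u. K * u powr (- ?a)) has_integral I) {0..?a}"
      unfolding I_def by (intro has_integral_mult_right has_integral_powr_from_0) (use assms in simp_all)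
    then show ?thesis
      unfolding g_def by (rule nn_integral_has_integral_lebesgue'[rotated]) (use K0 in simp)
  qed
  have intg': "(\<integral>\<^sup>+ s. g (t - s) \<partial>lborel) = ennreal I" for t
    using nn_integral_real_affine[OF g, of "-1" t] intg by simp
  have inte: "(\<integral>\<^sup>+ s. ennreal (exp (- s)) * indicator {0..} s \<partial>lborel) = ennreal 1"
  proof -
    have "(\<integral>\<^sup>+ s. ennreal (exp (- s)) * indicator {0..} s \<partial>lborel) = ennreal (0 - (- exp (- 0)))"
    proof (rule nn_integral_FTC_atLeast)
      show "((\<lambda>s::real. - exp (- s)) has_real_derivative exp (- s)) (at s)" for s
        by (auto intro!: derivative_eq_intros)
      have "((\<lambda>s::real. exp (- s)) \<longlongrightarrow> 0) at_top"
        by (rule filterlim_compose[OF exp_at_bot filterlim_uminus_at_bot_at_top])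
      then show "((\<lambda>s::real. - exp (- s)) \<longlongrightarrow> 0) at_top" using tendsto_minus by fastforce
    qed auto
    then show ?thesis by simp
  qed
  have "(\<integral>\<^sup>+ s\<in>{0..t}. ennreal (exp (- s) * mu_heat \<omega> (t - s)) \<partial>lborel) \<le> ennreal 1 + ennreal I" for t
  proof -
    have "(\<integral>\<^sup>+ s\<in>{0..t}. ennreal (exp (- s) * mu_heat \<omega> (t - s)) \<partial>lborel)
        \<le> (\<integral>\<^sup>+ s. ennreal (exp (- s)) * indicator {0..} s + g (t - s) \<partial>lborel)"
    proof (rule nn_integral_mono)
      fix s
      show "ennreal (exp (- s) * mu_heat \<omega> (t - s)) * indicator {0..t} s
          \<le> ennreal (exp (- s)) * indicator {0..} s + g (t - s)"
      proof (cases "0 \<le> s \<and> s \<le> t")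
        case st: True
        show ?thesis
        proof (cases "t - s \<le> ?a")
          case True
          have "exp (- s) * mu_heat \<omega> (t - s) \<le> 1 * (K * (t - s) powr (- ?a))"
            unfolding K_def using st True assms
            by (intro mult_mono mu_heat_le_powr) (simp_all add: mu_heat_def)
          then have "ennreal (exp (- s) * mu_heat \<omega> (t - s)) \<le> g (t - s)"
            using st True by (simp add: g_def ennreal_leI)
          then show ?thesis using st by (simp add: add_increasing)
        next
          case False
          then show ?thesis using st by (simp add: mu_heat_def)
        qed
      qed auto
    qed
    also have "\<dots> = ennreal 1 + ennreal I"
      by (subst nn_integral_add) (simp_all add: inte intg')
    finally show ?thesis .
  qed
  then have "(SUP t\<in>{0..}. \<integral>\<^sup>+ s\<in>{0..t}. ennreal (exp (- s) * mu_heat \<omega> (t - s)) \<partial>lborel) \<le> ennreal 1 + ennreal I"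
    by (intro SUP_least)
  also have "\<dots> < \<infinity>" by (simp add: ennreal_add_eq_top less_top)
  finally show ?thesis .
qed

section \<open>The heat semigroup and the smoothing estimate\<close>

text \<open>
  The definition involves only nonnegative times and vectors of the space, and these are the values
  by which the generator determines a semigroup.
\<close>

lemma C0_semigroup_cong:
  assumes "C0_semigroup X N T" and eq: "\<And>t v. 0 \<le> t \<Longrightarrow> v \<in> X \<Longrightarrow> S t v = T t v"
  shows "C0_semigroup X N S"
proof -
  have B: "banach_on X N" and lin: "\<And>t. 0 \<le> t \<Longrightarrow> linear_map_on X X (T t)"
    and bd: "\<And>t. 0 \<le> t \<Longrightarrow> \<exists>C. \<forall>v\<in>X. N (T t v) \<le> C * N v"
    and init: "\<And>v. v \<in> X \<Longrightarrow> T 0 v = v"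
    and sg: "\<And>s t v. 0 \<le> s \<Longrightarrow> 0 \<le> t \<Longrightarrow> v \<in> X \<Longrightarrow> T (s + t) v = T s (T t v)"
    and cont: "\<And>v. v \<in> X \<Longrightarrow> continuous_map (top_of_set {0..}) (norm_topology X N) (\<lambda>t. T t v)"
    using assms(1) unfolding C0_semigroup_def by blast+
  have X: "T t v \<in> X" if "0 \<le> t" "v \<in> X" for t v
    using lin[OF that(1)] that(2) unfolding linear_map_on_def by blast
  show ?thesis
    unfolding C0_semigroup_def
  proof (intro conjI ballI allI impI B)
    fix t :: real assume t: "0 \<le> t"
    have sub: "subspace X" using lin[OF t] unfolding linear_map_on_def by blast
    show "linear_map_on X X (S t)"
      using lin[OF t] subspace_add[OF sub] subspace_scale[OF sub]
      unfolding linear_map_on_def by (simp add: eq[OF t] Pi_iff)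
    show "\<exists>C. \<forall>v\<in>X. N (S t v) \<le> C * N v" using bd[OF t] by (simp add: eq[OF t])
  next
    show "S 0 v = v" if "v \<in> X" for v using that by (simp add: eq init)
  next
    fix s t :: real and v assume "0 \<le> s" "0 \<le> t" "v \<in> X"
    then show "S (s + t) v = S s (S t v)" by (simp add: eq X sg)
  next
    fix v assume v: "v \<in> X"
    show "continuous_map (top_of_set {0..}) (norm_topology X N) (\<lambda>t. S t v)"
      by (rule continuous_map_eq[OF cont[OF v]]) (simp add: eq v)
  qed
qed

lemma continuous_map_swap_args:
  assumes "continuous_map (prod_topology X Y) Z (\<lambda>(x, y). f x y)"
    and "\<And>x y. x \<in> topspace X \<Longrightarrow> y \<in> topspace Y \<Longrightarrow> g x y = f x y"
  shows "continuous_map (prod_topology Y X) Z (\<lambda>(y, x). g x y)"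
proof -
  have "continuous_map (prod_topology Y X) (prod_topology X Y) (\<lambda>p. (snd p, fst p))"
    by (intro continuous_map_pairedI continuous_map_fst continuous_map_snd)
  from continuous_map_compose[OF this assms(1)]
  show ?thesis by (rule continuous_map_eq) (auto simp: assms(2))
qed

lemma topspace_norm_topology_SobS0:
  "topspace (norm_topology (SobS0 n) (Sob_norm n)) = SobS0 n"
  by (rule Metric_space.topspace_mtopology[OF Metric_space_SobS0])

lemma heat_smoothing_mu:
  assumes "0 < \<omega>" "0 < t" "v \<in> SobS0 (- \<omega>)"
  shows "heat t v \<in> SobS0 1"
    and "Sob_norm 1 (heat t v) \<le> mu_heat \<omega> t * exp (- t) * Sob_norm (- \<omega>) v"
proof -
  have C: "x powr (1 - - \<omega>) * exp (- t * x\<^sup>2) \<le> mu_heat \<omega> t * exp (- t)" if "1 \<le> x" for x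
    using symbol_le_mu_heat[OF assms(1,2) that] by simp
  have "0 \<le> mu_heat \<omega> t * exp (- t)" using mu_heat_pos[OF assms(1,2)] by simp
  from heat_smoothing[OF less_imp_le[OF assms(2)] this C assms(3)]
  show "heat t v \<in> SobS0 1"
    "Sob_norm 1 (heat t v) \<le> mu_heat \<omega> t * exp (- t) * Sob_norm (- \<omega>) v" by simp_all
qed

theorem proposition4p1:
  fixes \<omega> :: real
    and Fp F Fm :: "('d::finite) vfield set"
    and \<A> :: "'d vfield \<Rightarrow> 'd vfield"
    and \<mu> :: "real \<Rightarrow> real"
  assumes d: "CARD('d) \<ge> 2"
    and \<omega>: "0 < \<omega>" "\<omega> < 1"
    and Fp: "Fp = SobS0 (2 - \<omega>)"
    and F: "F = SobS0 1"
    and Fm: "Fm = SobS0 (- \<omega>)"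
    and \<A>: "\<A> = restrict laplacian Fp"
    and \<mu>: "\<mu> = mu_heat \<omega>"
  shows
    \<comment> \<open>(i)\<close>
    "(densely_defined Fm (Sob_norm (- \<omega>)) Fp \<A> \<and>
      (\<exists>T. generates Fm (Sob_norm (- \<omega>)) Fp \<A> T) \<and>
      (\<forall>T. generates Fm (Sob_norm (- \<omega>)) Fp \<A> T \<longrightarrow> (\<forall>t\<ge>0. \<forall>v\<in>Fm. T t v = heat t v)))
     \<and>
     \<comment> \<open>(ii)\<close>
     (C0_semigroup F (Sob_norm 1) heat \<and>
      (\<forall>t\<ge>0. \<forall>v\<in>F. Sob_norm 1 (heat t v) \<le> exp (- t) * Sob_norm 1 v))
     \<and>
     \<comment> \<open>(iii)\<close>
     (continuous_map
        (prod_topology (top_of_set {0<..}) (norm_topology Fm (Sob_norm (- \<omega>))))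
        (norm_topology F (Sob_norm 1)) (\<lambda>(t, v). heat t v) \<and>
      (\<forall>t>0. \<forall>v\<in>Fm. Sob_norm 1 (heat t v) \<le> \<mu> t * exp (- t) * Sob_norm (- \<omega>) v) \<and>
      \<mu> \<in> O[at_right 0](\<lambda>t. 1 / t powr ((1 + \<omega>) / 2)) \<and>
      (SUP t\<in>{0..}. \<integral>\<^sup>+ s\<in>{0..t}. ennreal (exp (- s) * \<mu> (t - s)) \<partial>lborel) < \<infinity>)
     \<and>
     \<comment> \<open>(iv)\<close>
     (\<forall>N B :: real.
        0 < N \<and> (SUP t\<in>{0..}. \<integral>\<^sup>+ s\<in>{0..t}. ennreal (exp (- s) * \<mu> (t - s)) \<partial>lborel) \<le> ennreal N \<and>
        B = 1 \<longrightarrow>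
        \<comment> \<open>(a)\<close>
        (linear_map_on Fp Fm \<A> \<and>
         (\<exists>c>0. \<exists>C>0. \<forall>v\<in>Fp.
            c * Sob_norm (2 - \<omega>) v \<le> Sob_norm (- \<omega>) v + Sob_norm (- \<omega>) (\<A> v) \<and>
            Sob_norm (- \<omega>) v + Sob_norm (- \<omega>) (\<A> v) \<le> C * Sob_norm (2 - \<omega>) v)) \<and>
        \<comment> \<open>(b)\<close>
        (densely_defined Fm (Sob_norm (- \<omega>)) Fp \<A> \<and>
         (\<exists>T. generates Fm (Sob_norm (- \<omega>)) Fp \<A> T)) \<and>
        (\<forall>T. generates Fm (Sob_norm (- \<omega>)) Fp \<A> T \<longrightarrow>
           \<comment> \<open>(c)\<close>
           ((\<forall>t\<ge>0. T t ` F \<subseteq> F) \<and>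
            continuous_map
              (prod_topology (norm_topology F (Sob_norm 1)) (top_of_set {0..}))
              (norm_topology F (Sob_norm 1)) (\<lambda>(v, t). T t v) \<and>
            C0_semigroup F (Sob_norm 1) T \<and>
            (\<forall>t\<ge>0. \<forall>v\<in>F. Sob_norm 1 (T t v) \<le> exp (- B * t) * Sob_norm 1 v)) \<and>
           \<comment> \<open>(d)\<close>
           ((\<forall>t>0. T t ` Fm \<subseteq> F) \<and>
            continuous_map
              (prod_topology (norm_topology Fm (Sob_norm (- \<omega>))) (top_of_set {0<..}))
              (norm_topology F (Sob_norm 1)) (\<lambda>(v, t). T t v) \<and>
            continuous_on {0<..} \<mu> \<and> (\<forall>t>0. \<mu> t > 0) \<and>
            (\<forall>t>0. \<forall>v\<in>Fm. Sob_norm 1 (T t v) \<le> \<mu> t * exp (- B * t) * Sob_norm (- \<omega>) v) \<and>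
            (\<exists>\<epsilon>. 0 \<le> \<epsilon> \<and> \<epsilon> < 1 \<and> \<mu> \<in> O[at_right 0](\<lambda>t. 1 / t powr \<epsilon>)) \<and>
            (\<forall>t\<ge>0. (\<integral>\<^sup>+ s\<in>{0..t}. ennreal (exp (- B * s) * \<mu> (t - s)) \<partial>lborel) \<le> ennreal N))))"
proof -
  have sum: "2 - \<omega> = - \<omega> + 2" by simp
  have A: "\<A> v = laplacian v" if "v \<in> SobS0 (- \<omega> + 2)" for v
    using that unfolding \<A> Fp sum by simp
  have Fp': "Fp = SobS0 (- \<omega> + 2)" by (simp only: Fp sum)
  let ?M = "SUP t\<in>{0..}. \<integral>\<^sup>+ s\<in>{0..t}. ennreal (exp (- s) * \<mu> (t - s)) \<partial>lborel"
  have FFm: "v \<in> Fm" if "v \<in> F" for v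
    using SobS0_mono[of "- \<omega>" 1] that \<omega> by (auto simp: F Fm)
  have dense: "densely_defined Fm (Sob_norm (- \<omega>)) Fp \<A>"
    unfolding Fm Fp' by (rule densely_defined_laplacian[OF A])
  have gen: "generates Fm (Sob_norm (- \<omega>)) Fp \<A> heat"
    unfolding Fm Fp' by (rule generates_heat[OF A])
  have uniq: "T t v = heat t v"
    if "generates Fm (Sob_norm (- \<omega>)) Fp \<A> T" "0 \<le> t" "v \<in> Fm" for T t v
    using generated_semigroup_eq_heat[of "- \<omega>" \<A> T t v] A that unfolding Fm Fp' by blast
  have sgF: "C0_semigroup F (Sob_norm 1) heat" unfolding F by (rule C0_semigroup_heat)
  have contrF: "Sob_norm 1 (heat t v) \<le> exp (- t) * Sob_norm 1 v" if "0 \<le> t" "v \<in> F" for t v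
    using heat_contraction(2)[OF that(1), of v 1] that(2) by (simp add: F)
  have FF: "heat t v \<in> F" if "0 \<le> t" "v \<in> F" for t v
    using heat_contraction(1)[OF that(1), of v 1] that(2) by (simp add: F)
  have smooth: "heat t v \<in> F" "Sob_norm 1 (heat t v) \<le> \<mu> t * exp (- t) * Sob_norm (- \<omega>) v"
    if "0 < t" "v \<in> Fm" for t v
    using heat_smoothing_mu[OF \<omega>(1) that(1), of v] that(2) by (simp_all add: F Fm \<mu>)
  have contF: "continuous_map (prod_topology (top_of_set {0..}) (norm_topology F (Sob_norm 1)))
      (norm_topology F (Sob_norm 1)) (\<lambda>(t, v). heat t v)"
    unfolding F by (rule heat_jointly_continuous_nonneg_times)
  have contFm: "continuous_map (prod_topology (top_of_set {0<..}) (norm_topology Fm (Sob_norm (- \<omega>))))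
      (norm_topology F (Sob_norm 1)) (\<lambda>(t, v). heat t v)"
    unfolding F Fm by (rule heat_jointly_continuous_pos_times) (use \<omega> in simp)
  have bigo: "\<mu> \<in> O[at_right 0](\<lambda>t. 1 / t powr ((1 + \<omega>) / 2))"
    unfolding \<mu> by (rule mu_heat_bigo[OF \<omega>(1)])
  have fin: "?M < \<infinity>" unfolding \<mu> by (rule mu_heat_convolution_bounded[OF \<omega>])
  have i: "densely_defined Fm (Sob_norm (- \<omega>)) Fp \<A> \<and>
      (\<exists>T. generates Fm (Sob_norm (- \<omega>)) Fp \<A> T) \<and>
      (\<forall>T. generates Fm (Sob_norm (- \<omega>)) Fp \<A> T \<longrightarrow> (\<forall>t\<ge>0. \<forall>v\<in>Fm. T t v = heat t v))"
    using dense gen uniq by blast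
  \<comment> \<open>The Laplacian is an isometry from \<open>Fp\<close> to \<open>Fm\<close>; the other term of the
    graph norm costs at most the embedding constant 1.\<close>
  have graph: "1 * Sob_norm (2 - \<omega>) v \<le> Sob_norm (- \<omega>) v + Sob_norm (- \<omega>) (\<A> v)"
      "Sob_norm (- \<omega>) v + Sob_norm (- \<omega>) (\<A> v) \<le> 2 * Sob_norm (2 - \<omega>) v" if v: "v \<in> Fp" for v
  proof -
    have eq: "Sob_norm (- \<omega>) (\<A> v) = Sob_norm (2 - \<omega>) v"
      using laplacian_Sobolev(2)[of v "- \<omega>"] A[of v] v by (simp add: Fp')
    have "Sob_norm (- \<omega>) v \<le> Sob_norm (2 - \<omega>) v"
      using Sobolev_embedding(2)[of "- \<omega>" "2 - \<omega>" v] v by (simp add: Fp)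
    then show "1 * Sob_norm (2 - \<omega>) v \<le> Sob_norm (- \<omega>) v + Sob_norm (- \<omega>) (\<A> v)"
      "Sob_norm (- \<omega>) v + Sob_norm (- \<omega>) (\<A> v) \<le> 2 * Sob_norm (2 - \<omega>) v"
      by (simp_all add: eq)
  qed
  have lin: "linear_map_on Fp Fm \<A>" unfolding Fp' Fm by (rule linear_map_on_laplacian[OF A])
  have a: "linear_map_on Fp Fm \<A> \<and>
         (\<exists>c>0. \<exists>C>0. \<forall>v\<in>Fp.
            c * Sob_norm (2 - \<omega>) v \<le> Sob_norm (- \<omega>) v + Sob_norm (- \<omega>) (\<A> v) \<and>
            Sob_norm (- \<omega>) v + Sob_norm (- \<omega>) (\<A> v) \<le> C * Sob_norm (2 - \<omega>) v)"
    by (rule conjI[OF lin], rule exI[of _ 1], rule conjI[OF zero_less_one],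
        rule exI[of _ 2], rule conjI[OF zero_less_numeral], intro ballI conjI graph)
  have c: "(\<forall>t\<ge>0. T t ` F \<subseteq> F) \<and>
            continuous_map
              (prod_topology (norm_topology F (Sob_norm 1)) (top_of_set {0..}))
              (norm_topology F (Sob_norm 1)) (\<lambda>(v, t). T t v) \<and>
            C0_semigroup F (Sob_norm 1) T \<and>
            (\<forall>t\<ge>0. \<forall>v\<in>F. Sob_norm 1 (T t v) \<le> exp (- B * t) * Sob_norm 1 v)"
    if T: "generates Fm (Sob_norm (- \<omega>)) Fp \<A> T" and B: "B = 1" for T B
  proof (intro conjI allI impI ballI)
    have eq: "T t v = heat t v" if "0 \<le> t" "v \<in> F" for t v by (rule uniq[OF T that(1) FFm[OF that(2)]])
    show "T t ` F \<subseteq> F" if "0 \<le> t" for t using that by (auto simp: eq FF)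
    have top: "topspace (norm_topology F (Sob_norm 1)) = F" unfolding F by (rule topspace_norm_topology_SobS0)
    show "continuous_map (prod_topology (norm_topology F (Sob_norm 1)) (top_of_set {0..}))
        (norm_topology F (Sob_norm 1)) (\<lambda>(v, t). T t v)"
      by (rule continuous_map_swap_args[OF contF]) (simp add: eq top)
    show "C0_semigroup F (Sob_norm 1) T" by (rule C0_semigroup_cong[OF sgF eq])
    show "Sob_norm 1 (T t v) \<le> exp (- B * t) * Sob_norm 1 v" if "0 \<le> t" "v \<in> F" for t v
      using contrF[OF that] by (simp add: eq that B)
  qed
  have d: "(\<forall>t>0. T t ` Fm \<subseteq> F) \<and>
            continuous_map
              (prod_topology (norm_topology Fm (Sob_norm (- \<omega>))) (top_of_set {0<..}))
              (norm_topology F (Sob_norm 1)) (\<lambda>(v, t). T t v) \<and>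
            continuous_on {0<..} \<mu> \<and> (\<forall>t>0. \<mu> t > 0) \<and>
            (\<forall>t>0. \<forall>v\<in>Fm. Sob_norm 1 (T t v) \<le> \<mu> t * exp (- B * t) * Sob_norm (- \<omega>) v) \<and>
            (\<exists>\<epsilon>. 0 \<le> \<epsilon> \<and> \<epsilon> < 1 \<and> \<mu> \<in> O[at_right 0](\<lambda>t. 1 / t powr \<epsilon>)) \<and>
            (\<forall>t\<ge>0. (\<integral>\<^sup>+ s\<in>{0..t}. ennreal (exp (- B * s) * \<mu> (t - s)) \<partial>lborel) \<le> ennreal N)"
    if T: "generates Fm (Sob_norm (- \<omega>)) Fp \<A> T" and N: "?M \<le> ennreal N" and B: "B = 1" for T N B
  proof (intro conjI allI impI ballI)
    have eq: "T t v = heat t v" if "0 < t" "v \<in> Fm" for t v using uniq[OF T _ that(2)] that(1) by simp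
    show "T t ` Fm \<subseteq> F" if "0 < t" for t using that by (auto simp: eq smooth)
    have top: "topspace (norm_topology Fm (Sob_norm (- \<omega>))) = Fm" unfolding Fm by (rule topspace_norm_topology_SobS0)
    show "continuous_map (prod_topology (norm_topology Fm (Sob_norm (- \<omega>))) (top_of_set {0<..}))
        (norm_topology F (Sob_norm 1)) (\<lambda>(v, t). T t v)"
      by (rule continuous_map_swap_args[OF contFm]) (simp add: eq top)
    show "continuous_on {0<..} \<mu>" unfolding \<mu> by (rule continuous_on_mu_heat[OF \<omega>(1)])
    show "0 < \<mu> t" if "0 < t" for t unfolding \<mu> by (rule mu_heat_pos[OF \<omega>(1) that])
    show "Sob_norm 1 (T t v) \<le> \<mu> t * exp (- B * t) * Sob_norm (- \<omega>) v" if "0 < t" "v \<in> Fm" for t v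
      using smooth(2)[OF that] by (simp add: eq that B)
    show "\<exists>\<epsilon>. 0 \<le> \<epsilon> \<and> \<epsilon> < 1 \<and> \<mu> \<in> O[at_right 0](\<lambda>t. 1 / t powr \<epsilon>)"
      by (rule exI[of _ "(1 + \<omega>) / 2"]) (use \<omega> bigo in simp)
    fix t :: real assume t: "0 \<le> t"
    have "(\<integral>\<^sup>+ s\<in>{0..t}. ennreal (exp (- s) * \<mu> (t - s)) \<partial>lborel) \<le> ?M"
      by (rule SUP_upper) (use t in simp)
    also note N
    finally show "(\<integral>\<^sup>+ s\<in>{0..t}. ennreal (exp (- B * s) * \<mu> (t - s)) \<partial>lborel) \<le> ennreal N"
      by (simp add: B)
  qed
  have ii: "C0_semigroup F (Sob_norm 1) heat \<and>
      (\<forall>t\<ge>0. \<forall>v\<in>F. Sob_norm 1 (heat t v) \<le> exp (- t) * Sob_norm 1 v)"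
    using sgF contrF by simp
  have iii: "continuous_map
        (prod_topology (top_of_set {0<..}) (norm_topology Fm (Sob_norm (- \<omega>))))
        (norm_topology F (Sob_norm 1)) (\<lambda>(t, v). heat t v) \<and>
      (\<forall>t>0. \<forall>v\<in>Fm. Sob_norm 1 (heat t v) \<le> \<mu> t * exp (- t) * Sob_norm (- \<omega>) v) \<and>
      \<mu> \<in> O[at_right 0](\<lambda>t. 1 / t powr ((1 + \<omega>) / 2)) \<and> ?M < \<infinity>"
    by (intro conjI contFm bigo fin allI impI ballI smooth(2))
  have b: "densely_defined Fm (Sob_norm (- \<omega>)) Fp \<A> \<and>
      (\<exists>T. generates Fm (Sob_norm (- \<omega>)) Fp \<A> T)"
    using dense gen by blast
  show ?thesis
    by (rule conjI[OF i conjI[OF ii conjI[OF iii]]], intro allI impI, elim conjE,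
        rule conjI[OF a conjI[OF b]], intro allI impI, rule conjI[OF c d]) assumption+
qed

end
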